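(* Let $G$ be a locally compact group, and let $S$ be a non-empty, closed subspace of $G$ that is a subsemigroup of $G$. Let $X$, $Y$, and $Z$ be vector sublattices of $\mathrm{C}_{\mathrm c}(S,\mathbb R)^{\sim}$ that are Banach lattices (in the induced order, each with its own norm), where $Z$ is Dedekind complete. Suppose that $\star: X\times Y\to Z$ is a bilinear map such that $x\star y\in Z^+$ whenever $x\in X^+$ and $y\in Y^+$. Define the positive linear map $\pi:X\to \mathrm{L}_{\mathrm r}(Y,Z)$ by $\pi_x(y):= x\star y$ for $x\in X$ and $y\in Y$. Suppose that the following conditions are satisfied: (1) $\operatorname{supp}(x\star y)\subseteq \operatorname{supp}x\cdot\operatorname{supp}y$ for all $x\in X^+$ and $y\in Y^+$ with compact support; (2) the elements of $X$ with compact, separated support are dense in $X$; (3) the elements of $Y^+$ with compact support are dense in $Y^+$; (4) $\chi_A y$ is an element of $Y$ again, whenever $y\in Y^+$ has compact support and $A$ is a Borel subset of $\operatorname{supp}y$. Then $\pi$ is a lattice homomorphism.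
   Context: All topological spaces are Hausdorff; vector spaces are real; semigroups need not have an identity element. $A_1\cdot A_2=\{a_1a_2: a_1\in A_1,\ a_2\in A_2\}$ for subsets $A_1,A_2$ of a semigroup. For a non-empty locally compact space $T$, $\mathrm{C}_{\mathrm c}(T,\mathbb R)$ is the vector lattice of continuous, real-valued functions on $T$ with compact support, with pointwise ordering. Its order dual $\mathrm{C}_{\mathrm c}(T,\mathbb R)^\sim$ is the space of linear functionals on it that map order bounded sets to bounded sets (equivalently, differences of two positive functionals), with $\varphi\ge\psi$ iff $\langle\varphi,f\rangle\ge\langle\psi,f\rangle$ for all $f\ge0$; it is a Dedekind complete vector lattice. For a vector lattice $E$, $E^+$ is its set of positive elements, and $x^+=x\vee0$, $x^-=(-x)\vee0$, $|x|=x\vee(-x)$. Support: $\varphi\in\mathrm{C}_{\mathrm c}(T,\mathbb R)^\sim$ vanishes on an open set $U\subseteq T$ if $\langle\varphi,f\rangle=0$ for all $f\in \mathrm{C}_{\mathrm c}(T,\mathbb R)$ with $\operatorname{supp} f\subseteq U$; $\operatorname{supp}\varphi$ is the complement of the union of all open sets on which $\varphi$ vanishes. The support of $\varphi$ is separated if $\operatorname{supp}\varphi^+\cap\operatorname{supp}\varphi^-=\emptyset$. Product with bounded Borel functions: for $\varphi\in \mathrm{C}_{\mathrm c}(T,\mathbb R)^\sim$ and a non-empty, open, relatively compact $U\subseteq T$, there is a unique finite signed regular Borel measure $\mu_U$ on $U$ with $\langle\varphi,h\rangle=\int_U h\,d\mu_U$ for all $h\in\mathrm{C}_{\mathrm c}(T,\mathbb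 R)$ with $\operatorname{supp}h\subseteq U$. For a bounded Borel measurable $g:T\to\mathbb R$, the element $g\varphi$ of $\mathrm{C}_{\mathrm c}(T,\mathbb R)^\sim$ is defined by $\langle g\varphi,f\rangle:=\int_U fg\,d\mu_U$, where $U$ is any open relatively compact neighbourhood of $\operatorname{supp}f$ (this is independent of $U$). $\chi_A$ is the characteristic function of $A$. A Banach lattice is a vector lattice with a complete norm such that $|x|\le|y|$ implies $\|x\|\le\|y\|$. A vector lattice is Dedekind complete if every non-empty subset that is bounded above has a supremum. $\mathrm{L}_{\mathrm r}(Y,Z)$ is the space of regular operators (differences of two positive linear operators) from $Y$ to $Z$, ordered by $S\ge T$ iff $Sy\ge Ty$ for all $y\in Y^+$; since $Z$ is Dedekind complete it is a vector lattice. A linear map $T$ between vector lattices is a lattice homomorphism if $|Tx|=T|x|$ for all $x$. *)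

theory Defs
  imports "HOL-Analysis.Analysis" "HOL-Algebra.Coset" "HOL-Library.Function_Algebras"
begin

instantiation "fun" :: (type, real_vector) real_vector
begin

definition scaleR_fun :: "real \<Rightarrow> ('a \<Rightarrow> 'b) \<Rightarrow> 'a \<Rightarrow> 'b" where
  "scaleR_fun c f = (\<lambda>x. c *\<^sub>R f x)"

instance
  by standard (auto simp: scaleR_fun_def plus_fun_def fun_eq_iff scaleR_add_right scaleR_add_left)

end


section \<open>Vector lattices on carrier sets\<close>

text \<open>
  A vector lattice is a linear subspace \<open>E\<close> of a real vector space together with an order
  relation \<open>leq\<close>, which is only meaningful on \<open>E\<close>. Suprema are taken within the carrier.
\<close>

definition linear_on :: "'v::real_vector set \<Rightarrow> 'w::real_vector set \<Rightarrow> ('v \<Rightarrow> 'w) \<Rightarrow> bool" where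
  "linear_on E F T \<longleftrightarrow>
     T \<in> E \<rightarrow> F \<and>
     (\<forall>x\<in>E. \<forall>y\<in>E. T (x + y) = T x + T y) \<and>
     (\<forall>c. \<forall>x\<in>E. T (c *\<^sub>R x) = c *\<^sub>R T x)"

definition is_supremum :: "'v set \<Rightarrow> ('v \<Rightarrow> 'v \<Rightarrow> bool) \<Rightarrow> 'v set \<Rightarrow> 'v \<Rightarrow> bool" where
  "is_supremum E leq A s \<longleftrightarrow>
     s \<in> E \<and> (\<forall>a\<in>A. leq a s) \<and> (\<forall>t\<in>E. (\<forall>a\<in>A. leq a t) \<longrightarrow> leq s t)"

text \<open>
  Binary infima need no separate clause: the infimum of \<open>x\<close> and \<open>y\<close> is the negative of the
  supremum of \<open>- x\<close> and \<open>- y\<close>.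
\<close>

definition vector_lattice :: "'v::real_vector set \<Rightarrow> ('v \<Rightarrow> 'v \<Rightarrow> bool) \<Rightarrow> bool" where
  "vector_lattice E leq \<longleftrightarrow>
     subspace E \<and>
     (\<forall>x\<in>E. leq x x) \<and>
     (\<forall>x\<in>E. \<forall>y\<in>E. leq x y \<longrightarrow> leq y x \<longrightarrow> x = y) \<and>
     (\<forall>x\<in>E. \<forall>y\<in>E. \<forall>z\<in>E. leq x y \<longrightarrow> leq y z \<longrightarrow> leq x z) \<and>
     (\<forall>x\<in>E. \<forall>y\<in>E. \<forall>z\<in>E. leq x y \<longrightarrow> leq (x + z) (y + z)) \<and>
     (\<forall>x\<in>E. \<forall>y\<in>E. \<forall>c\<ge>0. leq x y \<longrightarrow> leq (c *\<^sub>R x) (c *\<^sub>R y)) \<and>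
     (\<forall>x\<in>E. \<forall>y\<in>E. \<exists>s. is_supremum E leq {x, y} s)"

definition vsup :: "'v set \<Rightarrow> ('v \<Rightarrow> 'v \<Rightarrow> bool) \<Rightarrow> 'v \<Rightarrow> 'v \<Rightarrow> 'v" where
  "vsup E leq x y = (THE s. is_supremum E leq {x, y} s)"

definition vpos :: "'v::real_vector set \<Rightarrow> ('v \<Rightarrow> 'v \<Rightarrow> bool) \<Rightarrow> 'v \<Rightarrow> 'v" where
  "vpos E leq x = vsup E leq x 0"

definition vneg :: "'v::real_vector set \<Rightarrow> ('v \<Rightarrow> 'v \<Rightarrow> bool) \<Rightarrow> 'v \<Rightarrow> 'v" where
  "vneg E leq x = vsup E leq (- x) 0"

definition vabs :: "'v::real_vector set \<Rightarrow> ('v \<Rightarrow> 'v \<Rightarrow> bool) \<Rightarrow> 'v \<Rightarrow> 'v" where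
  "vabs E leq x = vsup E leq x (- x)"

definition positive_cone :: "'v::real_vector set \<Rightarrow> ('v \<Rightarrow> 'v \<Rightarrow> bool) \<Rightarrow> 'v set" where
  "positive_cone E leq = {x \<in> E. leq 0 x}"

definition vector_sublattice ::
    "'v::real_vector set \<Rightarrow> ('v \<Rightarrow> 'v \<Rightarrow> bool) \<Rightarrow> 'v set \<Rightarrow> bool" where
  "vector_sublattice E leq X \<longleftrightarrow>
     subspace X \<and> X \<subseteq> E \<and> (\<forall>x\<in>X. \<forall>y\<in>X. vsup E leq x y \<in> X)"

definition Dedekind_complete :: "'v set \<Rightarrow> ('v \<Rightarrow> 'v \<Rightarrow> bool) \<Rightarrow> bool" where
  "Dedekind_complete E leq \<longleftrightarrow>
     (\<forall>A. A \<subseteq> E \<longrightarrow> A \<noteq> {} \<longrightarrow> (\<exists>u\<in>E. \<forall>a\<in>A. leq a u) \<longrightarrow> (\<exists>s. is_supremum E leq A s))"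

definition norm_on :: "'v::real_vector set \<Rightarrow> ('v \<Rightarrow> real) \<Rightarrow> bool" where
  "norm_on E N \<longleftrightarrow>
     (\<forall>x\<in>E. 0 \<le> N x) \<and>
     (\<forall>x\<in>E. N x = 0 \<longleftrightarrow> x = 0) \<and>
     (\<forall>c. \<forall>x\<in>E. N (c *\<^sub>R x) = \<bar>c\<bar> * N x) \<and>
     (\<forall>x\<in>E. \<forall>y\<in>E. N (x + y) \<le> N x + N y)"

definition complete_norm_on :: "'v::real_vector set \<Rightarrow> ('v \<Rightarrow> real) \<Rightarrow> bool" where
  "complete_norm_on E N \<longleftrightarrow>
     (\<forall>s :: nat \<Rightarrow> 'v. range s \<subseteq> E \<longrightarrow>
        (\<forall>e>0. \<exists>M. \<forall>m\<ge>M. \<forall>n\<ge>M. N (s m - s n) < e) \<longrightarrow>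
        (\<exists>x\<in>E. (\<lambda>n. N (s n - x)) \<longlonglongrightarrow> 0))"

definition Banach_lattice ::
    "'v::real_vector set \<Rightarrow> ('v \<Rightarrow> 'v \<Rightarrow> bool) \<Rightarrow> ('v \<Rightarrow> real) \<Rightarrow> bool" where
  "Banach_lattice E leq N \<longleftrightarrow>
     vector_lattice E leq \<and> norm_on E N \<and> complete_norm_on E N \<and>
     (\<forall>x\<in>E. \<forall>y\<in>E. leq (vabs E leq x) (vabs E leq y) \<longrightarrow> N x \<le> N y)"

definition norm_dense_in ::
    "('v::real_vector \<Rightarrow> real) \<Rightarrow> 'v set \<Rightarrow> 'v set \<Rightarrow> bool" where
  "norm_dense_in N D E \<longleftrightarrow> D \<subseteq> E \<and> (\<forall>x\<in>E. \<forall>e>0. \<exists>d\<in>D. N (x - d) < e)"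

definition positive_operator ::
    "'v::real_vector set \<Rightarrow> ('v \<Rightarrow> 'v \<Rightarrow> bool) \<Rightarrow> 'w::real_vector set \<Rightarrow> ('w \<Rightarrow> 'w \<Rightarrow> bool) \<Rightarrow>
     ('v \<Rightarrow> 'w) \<Rightarrow> bool" where
  "positive_operator E leqE F leqF T \<longleftrightarrow>
     linear_on E F T \<and> (\<forall>x\<in>positive_cone E leqE. T x \<in> positive_cone F leqF)"

text \<open>
  Operators on \<open>E\<close> are set to zero outside \<open>E\<close>, so that equality of regular operators is
  equality of functions and the pointwise vector space operations are the right ones.
\<close>

definition regular_operators ::
    "'v::real_vector set \<Rightarrow> ('v \<Rightarrow> 'v \<Rightarrow> bool) \<Rightarrow> 'w::real_vector set \<Rightarrow> ('w \<Rightarrow> 'w \<Rightarrow> bool) \<Rightarrow>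
     ('v \<Rightarrow> 'w) set" where
  "regular_operators E leqE F leqF =
     {T. (\<exists>P Q. positive_operator E leqE F leqF P \<and> positive_operator E leqE F leqF Q \<and>
                (\<forall>x\<in>E. T x = P x - Q x)) \<and>
         (\<forall>x. x \<notin> E \<longrightarrow> T x = 0)}"

definition operator_le ::
    "'v::real_vector set \<Rightarrow> ('v \<Rightarrow> 'v \<Rightarrow> bool) \<Rightarrow> ('w \<Rightarrow> 'w \<Rightarrow> bool) \<Rightarrow>
     ('v \<Rightarrow> 'w) \<Rightarrow> ('v \<Rightarrow> 'w) \<Rightarrow> bool" where
  "operator_le E leqE leqF R T \<longleftrightarrow> (\<forall>x\<in>positive_cone E leqE. leqF (R x) (T x))"

definition lattice_homomorphism ::
    "'v::real_vector set \<Rightarrow> ('v \<Rightarrow> 'v \<Rightarrow> bool) \<Rightarrow> 'w::real_vector set \<Rightarrow> ('w \<Rightarrow> 'w \<Rightarrow> bool) \<Rightarrow>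
     ('v \<Rightarrow> 'w) \<Rightarrow> bool" where
  "lattice_homomorphism E leqE F leqF T \<longleftrightarrow>
     linear_on E F T \<and> (\<forall>x\<in>E. vabs F leqF (T x) = T (vabs E leqE x))"


section \<open>The order dual of the compactly supported continuous functions\<close>

definition fsupp :: "'a topology \<Rightarrow> ('a \<Rightarrow> real) \<Rightarrow> 'a set" where
  "fsupp T f = T closure_of {x \<in> topspace T. f x \<noteq> 0}"

text \<open>
  Functions on \<open>topspace T\<close> are extended by zero to the whole type; the pointwise order on the
  type is then the pointwise order on \<open>topspace T\<close>. Likewise functionals are zero outside \<open>Cc T\<close>.
\<close>

definition Cc :: "'a topology \<Rightarrow> ('a \<Rightarrow> real) set" where
  "Cc T = {f. continuous_map T euclideanreal f \<and> compactin T (fsupp T f) \<and>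
              (\<forall>x. x \<notin> topspace T \<longrightarrow> f x = 0)}"

definition order_dual :: "'a topology \<Rightarrow> (('a \<Rightarrow> real) \<Rightarrow> real) set" where
  "order_dual T = {\<phi>. linear_on (Cc T) UNIV \<phi> \<and>
                      (\<forall>a\<in>Cc T. \<forall>b\<in>Cc T. bounded (\<phi> ` {f \<in> Cc T. a \<le> f \<and> f \<le> b})) \<and>
                      (\<forall>f. f \<notin> Cc T \<longrightarrow> \<phi> f = 0)}"

definition dual_le :: "'a topology \<Rightarrow> (('a \<Rightarrow> real) \<Rightarrow> real) \<Rightarrow> (('a \<Rightarrow> real) \<Rightarrow> real) \<Rightarrow> bool" where
  "dual_le T \<phi> \<psi> \<longleftrightarrow> (\<forall>f\<in>Cc T. 0 \<le> f \<longrightarrow> \<phi> f \<le> \<psi> f)"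

definition vanishes_on :: "'a topology \<Rightarrow> (('a \<Rightarrow> real) \<Rightarrow> real) \<Rightarrow> 'a set \<Rightarrow> bool" where
  "vanishes_on T \<phi> U \<longleftrightarrow> (\<forall>f\<in>Cc T. fsupp T f \<subseteq> U \<longrightarrow> \<phi> f = 0)"

definition dsupp :: "'a topology \<Rightarrow> (('a \<Rightarrow> real) \<Rightarrow> real) \<Rightarrow> 'a set" where
  "dsupp T \<phi> = topspace T - \<Union>{U. openin T U \<and> vanishes_on T \<phi> U}"

definition separated_support :: "'a topology \<Rightarrow> (('a \<Rightarrow> real) \<Rightarrow> real) \<Rightarrow> bool" where
  "separated_support T \<phi> \<longleftrightarrow>
     dsupp T (vpos (order_dual T) (dual_le T) \<phi>) \<inter> dsupp T (vneg (order_dual T) (dual_le T) \<phi>) = {}"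


section \<open>Products with bounded Borel functions\<close>

definition borel_of :: "'a topology \<Rightarrow> 'a measure" where
  "borel_of T = sigma (topspace T) {U. openin T U}"

text \<open>
  A finite signed Borel measure is a countably additive real-valued set function on the Borel
  sets. Taking all \<open>A i\<close> empty gives \<open>\<nu> {} = 0\<close>. Values of \<open>\<nu>\<close> on other sets are irrelevant.
\<close>

definition finite_signed_borel_measure :: "'a topology \<Rightarrow> ('a set \<Rightarrow> real) \<Rightarrow> bool" where
  "finite_signed_borel_measure T \<nu> \<longleftrightarrow>
     (\<forall>A :: nat \<Rightarrow> 'a set. range A \<subseteq> sets (borel_of T) \<longrightarrow> disjoint_family A \<longrightarrow>
        (\<lambda>i. \<nu> (A i)) sums \<nu> (\<Union>i. A i))"

text \<open>
  The Jordan decomposition: \<open>\<nu>\<^sup>+ A\<close> is the supremum of \<open>\<nu> B\<close> over the Borel sets \<open>B \<subseteq> A\<close>. The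
  truncation of negative values by \<^const>\<open>ennreal\<close> is harmless because \<open>B\<close> may be empty.
\<close>

definition pos_variation :: "'a topology \<Rightarrow> ('a set \<Rightarrow> real) \<Rightarrow> 'a measure" where
  "pos_variation T \<nu> =
     measure_of (topspace T) (sets (borel_of T))
       (\<lambda>A. SUP B\<in>{B \<in> sets (borel_of T). B \<subseteq> A}. ennreal (\<nu> B))"

definition neg_variation :: "'a topology \<Rightarrow> ('a set \<Rightarrow> real) \<Rightarrow> 'a measure" where
  "neg_variation T \<nu> = pos_variation T (\<lambda>A. - \<nu> A)"

definition signed_integral :: "'a topology \<Rightarrow> ('a set \<Rightarrow> real) \<Rightarrow> ('a \<Rightarrow> real) \<Rightarrow> real" where
  "signed_integral T \<nu> h =
     (LINT x|pos_variation T \<nu>. h x) - (LINT x|neg_variation T \<nu>. h x)"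

definition regular_borel_measure :: "'a topology \<Rightarrow> 'a measure \<Rightarrow> bool" where
  "regular_borel_measure T M \<longleftrightarrow>
     (\<forall>A\<in>sets (borel_of T).
        emeasure M A = (INF V\<in>{V. openin T V \<and> A \<subseteq> V}. emeasure M V) \<and>
        emeasure M A = (SUP K\<in>{K. compactin T K \<and> K \<subseteq> A}. emeasure M K))"

definition regular_signed_borel_measure :: "'a topology \<Rightarrow> ('a set \<Rightarrow> real) \<Rightarrow> bool" where
  "regular_signed_borel_measure T \<nu> \<longleftrightarrow>
     finite_signed_borel_measure T \<nu> \<and>
     regular_borel_measure T (pos_variation T \<nu>) \<and>
     regular_borel_measure T (neg_variation T \<nu>)"

definition represents_on ::
    "'a topology \<Rightarrow> (('a \<Rightarrow> real) \<Rightarrow> real) \<Rightarrow> 'a set \<Rightarrow> ('a set \<Rightarrow> real) \<Rightarrow> bool" where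
  "represents_on T \<phi> U \<nu> \<longleftrightarrow>
     regular_signed_borel_measure (subtopology T U) \<nu> \<and>
     (\<forall>h\<in>Cc T. fsupp T h \<subseteq> U \<longrightarrow> \<phi> h = signed_integral (subtopology T U) \<nu> h)"

text \<open>
  For \<open>\<phi>\<close> in the order dual and \<open>U\<close> non-empty, open and relatively compact, the Riesz
  representation theorem provides a representing measure whose values on the Borel sets of \<open>U\<close>
  are unique; the choice only affects its irrelevant values on other sets.
\<close>

definition representing_measure ::
    "'a topology \<Rightarrow> (('a \<Rightarrow> real) \<Rightarrow> real) \<Rightarrow> 'a set \<Rightarrow> 'a set \<Rightarrow> real" where
  "representing_measure T \<phi> U = (SOME \<nu>. represents_on T \<phi> U \<nu>)"

definition relatively_compact_nhd :: "'a topology \<Rightarrow> 'a set \<Rightarrow> 'a set \<Rightarrow> bool" where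
  "relatively_compact_nhd T K U \<longleftrightarrow>
     openin T U \<and> U \<noteq> {} \<and> compactin T (T closure_of U) \<and> K \<subseteq> U"

text \<open>The value does not depend on the chosen neighbourhood \<open>U\<close> of the support of \<open>f\<close>.\<close>

definition borel_multiple ::
    "'a topology \<Rightarrow> ('a \<Rightarrow> real) \<Rightarrow> (('a \<Rightarrow> real) \<Rightarrow> real) \<Rightarrow> ('a \<Rightarrow> real) \<Rightarrow> real" where
  "borel_multiple T g \<phi> =
     (\<lambda>f. if f \<in> Cc T
          then let U = (SOME U. relatively_compact_nhd T (fsupp T f) U)
               in signed_integral (subtopology T U) (representing_measure T \<phi> U) (\<lambda>x. f x * g x)
          else 0)"


section \<open>Locally compact groups\<close>

definition topological_group :: "('g, 'm) monoid_scheme \<Rightarrow> 'g topology \<Rightarrow> bool" where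
  "topological_group G T \<longleftrightarrow>
     group G \<and> topspace T = carrier G \<and>
     continuous_map (prod_topology T T) T (\<lambda>(a, b). a \<otimes>\<^bsub>G\<^esub> b) \<and>
     continuous_map T T (\<lambda>a. inv\<^bsub>G\<^esub> a)"

definition locally_compact_group :: "('g, 'm) monoid_scheme \<Rightarrow> 'g topology \<Rightarrow> bool" where
  "locally_compact_group G T \<longleftrightarrow>
     topological_group G T \<and> Hausdorff_space T \<and> locally_compact_space T"

end

theory Submission
  imports Defs
begin

text \<open>
  Since \<open>x = x\<^sup>+ - x\<^sup>-\<close>, it suffices that every regular \<open>R\<close> dominating both \<open>\<pi>\<^sub>x\<close> and \<open>- \<pi>\<^sub>x\<close> dominates
  \<open>\<pi>\<^sub>p + \<pi>\<^sub>n\<close>, where \<open>p = x\<^sup>+\<close> and \<open>n = x\<^sup>-\<close>. Positive operators between Banach lattices are continuous,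
  so by density \<open>x\<close> has compact separated support and \<open>y \<ge> 0\<close> has compact support. For each point \<open>k\<close>
  of \<open>supp y\<close> the translates \<open>(supp p) k\<close> and \<open>(supp n) k\<close> are disjoint compact sets, hence
  \<open>(supp p) W\<close> and \<open>(supp n) W\<close> are still disjoint for some neighbourhood \<open>W\<close> of \<open>k\<close>. Cutting \<open>supp y\<close>
  into finitely many small Borel pieces \<open>A\<close> therefore writes \<open>y\<close> as a sum of \<open>y\<^sub>A = \<chi>\<^sub>A y\<close> for which
  \<open>p \<star> y\<^sub>A\<close> and \<open>n \<star> y\<^sub>A\<close> have disjoint supports; by a partition of unity, \<open>R y\<^sub>A\<close>, which dominates
  \<open>\<plusminus> (p \<star> y\<^sub>A - n \<star> y\<^sub>A)\<close>, dominates their sum. That \<open>\<chi>\<^sub>A y\<close> is positive and additive in \<open>A\<close> rests on the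
  Riesz representation theorem and on the uniqueness of the representing measure.
\<close>

section \<open>Compactly supported functions\<close>

text \<open>Domination does not pass to approximants: if \<open>R\<close> dominates
  \<open>\<plusminus> \<pi>\<^sub>x\<close> and \<open>x'\<close> is close to \<open>x\<close>,
  nothing bounds \<open>\<pi>\<close> at \<open>x'\<close> by \<open>R\<close>. With
  \<open>d = |x - x'|\<close> one has \<open>\<plusminus> x' \<le> \<plusminus> x + d\<close>, so
  the corrected operator \<open>R + \<pi>\<^sub>d\<close> dominates
  \<open>\<plusminus> \<pi>\<close> at \<open>x'\<close>. The case of separated support then bounds
  \<open>\<pi>\<close> at \<open>|x'|\<close> by \<open>R + \<pi>\<^sub>d\<close>, and
  \<open>|x| \<le> |x'| + d\<close> leaves the error \<open>2 \<pi>\<^sub>d\<close>, which is small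
  in norm at each fixed \<open>y \<ge> 0\<close>. Closedness of the positive cone of
  \<open>Z\<close> removes it. The cutting takes place in \<open>Y\<close>, the space assumed stable
  under multiplication by characteristic functions. There the difficulty is that
  \<open>borel_multiple\<close> integrates against a chosen signed measure: this has to be compared
  with the positive Riesz measure before \<open>\<chi>\<^sub>A y \<ge> 0\<close> becomes
  visible.\<close>

lemma fsuppD: "x \<in> topspace T \<Longrightarrow> f x \<noteq> 0 \<Longrightarrow> x \<in> fsupp T f"
  using closure_of_subset[of "{x \<in> topspace T. f x \<noteq> 0}" T] by (auto simp: fsupp_def)

lemma closedin_fsupp [simp]: "closedin T (fsupp T f)"
  by (simp add: fsupp_def)

lemma fsupp_minimal: "closedin T C \<Longrightarrow> (\<And>x. x \<in> topspace T \<Longrightarrow> f x \<noteq> 0 \<Longrightarrow> x \<in> C) \<Longrightarrow> fsupp T f \<subseteq> C"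
  unfolding fsupp_def by (rule closure_of_minimal) auto

lemma CcI:
  assumes "continuous_map T euclideanreal f" "compactin T C" "closedin T C"
    and "\<And>x. f x \<noteq> 0 \<Longrightarrow> x \<in> C"
  shows "f \<in> Cc T"
proof -
  have "fsupp T f \<subseteq> C" using assms by (intro fsupp_minimal) auto
  then have "compactin T (fsupp T f)" using closed_compactin[OF assms(2)] by simp
  then show ?thesis
    using assms compactin_subset_topspace[OF assms(2)] by (auto simp: Cc_def)
qed

lemma Cc_D:
  assumes "f \<in> Cc T"
  shows Cc_continuous: "continuous_map T euclideanreal f"
    and Cc_compact: "compactin T (fsupp T f)"
    and Cc_fsuppD: "f x \<noteq> 0 \<Longrightarrow> x \<in> fsupp T f"
  using assms by (auto simp: Cc_def intro: fsuppD)

lemma Cc_dominated: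
  assumes "f \<in> Cc T" "continuous_map T euclideanreal k" "\<And>x. f x = 0 \<Longrightarrow> k x = 0"
  shows "k \<in> Cc T" "fsupp T k \<subseteq> fsupp T f"
proof -
  show "k \<in> Cc T"
    by (rule CcI[OF assms(2) Cc_compact[OF assms(1)]]) (use assms(3) Cc_fsuppD[OF assms(1)] in auto)
  show "fsupp T k \<subseteq> fsupp T f"
    by (rule fsupp_minimal) (use assms(3) fsuppD[of _ T f] in \<open>simp, metis\<close>)
qed

lemma Cc_zero [simp]: "0 \<in> Cc T" "(\<lambda>x. 0) \<in> Cc T"
  by (auto intro!: CcI[of _ _ "{}"] simp: zero_fun_def)

lemma fsupp_zero [simp]: "fsupp T (\<lambda>x. 0) = {}" "fsupp T 0 = {}"
  by (auto simp: fsupp_def)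

lemma fsupp_combine:
  assumes "\<And>x. f x = 0 \<Longrightarrow> g x = 0 \<Longrightarrow> k x = 0"
  shows "fsupp T k \<subseteq> fsupp T f \<union> fsupp T g"
  by (rule fsupp_minimal) (use assms fsuppD[of _ T] in auto)

lemma Cc_combine:
  assumes "f \<in> Cc T" "g \<in> Cc T" "continuous_map T euclideanreal k" "\<And>x. f x = 0 \<Longrightarrow> g x = 0 \<Longrightarrow> k x = 0"
  shows "k \<in> Cc T"
  by (rule CcI[of _ _ "fsupp T f \<union> fsupp T g"])
    (use assms Cc_fsuppD[of _ T] in \<open>auto intro!: compactin_Un Cc_compact\<close>)

lemma Cc_add: "f \<in> Cc T \<Longrightarrow> g \<in> Cc T \<Longrightarrow> f + g \<in> Cc T"
  and Cc_diff: "f \<in> Cc T \<Longrightarrow> g \<in> Cc T \<Longrightarrow> f - g \<in> Cc T"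
  and Cc_min: "f \<in> Cc T \<Longrightarrow> g \<in> Cc T \<Longrightarrow> (\<lambda>x. min (f x) (g x)) \<in> Cc T"
  by (rule Cc_combine[of f T g]; simp add: plus_fun_def fun_diff_def Cc_continuous continuous_intros)+

lemma Cc_scale: "f \<in> Cc T \<Longrightarrow> c *\<^sub>R f \<in> Cc T"
  by (rule Cc_dominated(1)[of f T]; simp add: scaleR_fun_def fun_Compl_def Cc_continuous continuous_intros)+

lemma Cc_mult:
  assumes "f \<in> Cc T" "continuous_map T euclideanreal r"
  shows "(\<lambda>x. f x * r x) \<in> Cc T" "fsupp T (\<lambda>x. f x * r x) \<subseteq> fsupp T f"
  by (rule Cc_dominated[OF assms(1)]; simp add: assms Cc_continuous continuous_intros)+

lemma Cc_pos_part:
  assumes "f \<in> Cc T"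
  shows "(\<lambda>x. max (f x) 0) \<in> Cc T" "fsupp T (\<lambda>x. max (f x) 0) \<subseteq> fsupp T f"
    and "(\<lambda>x. max (- f x) 0) \<in> Cc T" "fsupp T (\<lambda>x. max (- f x) 0) \<subseteq> fsupp T f"
  by (rule Cc_dominated[OF assms]; simp add: assms Cc_continuous continuous_intros)+

lemma fun_pos_part: "f = (\<lambda>x. max (f x) 0) - (\<lambda>x. max (- f x) (0::real))"
  by (auto simp: fun_eq_iff)

lemma sum_fun_apply: "sum g I x = (\<Sum>i\<in>I. g i x)"
  by (induction I rule: infinite_finite_induct) auto

section \<open>Linear maps on subspaces and functionals in the order dual\<close>

lemma linear_on_zero: "linear_on E F h \<Longrightarrow> 0 \<in> E \<Longrightarrow> h 0 = 0"
  unfolding linear_on_def by (metis scale_zero_left)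

lemma linear_on_diff:
  assumes "linear_on E F h" "subspace E" "x \<in> E" "y \<in> E"
  shows "h (x - y) = h x - h y"
proof -
  have "h (x + (-1) *\<^sub>R y) = h x + h ((-1) *\<^sub>R y)"
    using assms unfolding linear_on_def by (meson subspace_scale)
  moreover have "h ((-1) *\<^sub>R y) = (-1) *\<^sub>R h y"
    using assms unfolding linear_on_def by blast
  ultimately show ?thesis by simp
qed

lemma linear_on_sum:
  assumes "linear_on E F h" "subspace E" "\<And>i. i \<in> I \<Longrightarrow> g i \<in> E"
  shows "h (sum g I) = (\<Sum>i\<in>I. h (g i))"
  using assms(3)
proof (induction I rule: infinite_finite_induct)
  case (insert i I)
  then show ?case
    using assms(1,2) by (simp add: linear_on_def subspace_sum)
qed (use linear_on_zero[OF assms(1) subspace_0[OF assms(2)]] in auto)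

lemma subspace_Cc: "subspace (Cc T)"
  by (auto simp: subspace_def intro: Cc_add Cc_scale)

lemma order_dual_linear: "\<phi> \<in> order_dual T \<Longrightarrow> linear_on (Cc T) UNIV \<phi>"
  by (simp add: order_dual_def)

lemma order_dual_simps:
  assumes "\<phi> \<in> order_dual T"
  shows order_dual_add: "f \<in> Cc T \<Longrightarrow> g \<in> Cc T \<Longrightarrow> \<phi> (f + g) = \<phi> f + \<phi> g"
    and order_dual_diff: "f \<in> Cc T \<Longrightarrow> g \<in> Cc T \<Longrightarrow> \<phi> (f - g) = \<phi> f - \<phi> g"
    and order_dual_scale: "f \<in> Cc T \<Longrightarrow> \<phi> (c *\<^sub>R f) = c * \<phi> f"
    and order_dual_zero: "\<phi> 0 = 0"
    and order_dual_sum: "(\<And>i. i \<in> I \<Longrightarrow> h i \<in> Cc T) \<Longrightarrow> \<phi> (sum h I) = (\<Sum>i\<in>I. \<phi> (h i))"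
    and order_dual_outside: "f \<notin> Cc T \<Longrightarrow> \<phi> f = 0"
proof -
  note l = order_dual_linear[OF assms]
  show "f \<in> Cc T \<Longrightarrow> g \<in> Cc T \<Longrightarrow> \<phi> (f + g) = \<phi> f + \<phi> g"
    and "f \<in> Cc T \<Longrightarrow> \<phi> (c *\<^sub>R f) = c * \<phi> f"
    using l by (simp_all add: linear_on_def)
  show "f \<in> Cc T \<Longrightarrow> g \<in> Cc T \<Longrightarrow> \<phi> (f - g) = \<phi> f - \<phi> g"
    by (rule linear_on_diff[OF l subspace_Cc])
  show "\<phi> 0 = 0"
    by (rule linear_on_zero[OF l]) simp
  show "(\<And>i. i \<in> I \<Longrightarrow> h i \<in> Cc T) \<Longrightarrow> \<phi> (sum h I) = (\<Sum>i\<in>I. \<phi> (h i))"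
    by (rule linear_on_sum[OF l subspace_Cc])
  show "f \<notin> Cc T \<Longrightarrow> \<phi> f = 0"
    using assms by (simp add: order_dual_def)
qed

lemma order_dual_pos_part:
  assumes "\<phi> \<in> order_dual T" "f \<in> Cc T"
  shows "\<phi> f = \<phi> (\<lambda>x. max (f x) 0) - \<phi> (\<lambda>x. max (- f x) 0)"
  using order_dual_diff[OF assms(1) Cc_pos_part(1,3)[OF assms(2)]] fun_pos_part[of f] by simp

section \<open>Urysohn functions, partitions of unity and supports of functionals\<close>

locale locally_compact_Hausdorff =
  fixes T :: "'a topology"
  assumes Hausdorff: "Hausdorff_space T" and locally_compact: "locally_compact_space T"
begin

lemma compact_closed: "compactin T K \<Longrightarrow> closedin T K"
  using Hausdorff compactin_imp_closedin by blast

lemma completely_regular: "completely_regular_space T"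
  using Hausdorff locally_compact locally_compact_regular_imp_completely_regular_space by blast

lemma compact_nhd:
  assumes "compactin T K"
  obtains V L where "openin T V" "compactin T L" "closedin T L" "K \<subseteq> V" "V \<subseteq> L"
  using assms Hausdorff locally_compact locally_compact_space_compact_closed_compact[of T] by blast

lemma relatively_compact_nhd_ex:
  assumes "compactin T K" "topspace T \<noteq> {}"
  shows "\<exists>U. relatively_compact_nhd T K U"
proof -
  \<comment> \<open>\<open>relatively_compact_nhd\<close> demands a non-empty set; the extra point
    covers the case of empty \<open>K\<close>, such as the support of \<open>0\<close>.\<close>
  obtain a where a: "a \<in> topspace T" using assms(2) by blast
  have "compactin T (insert a K)"
    using compactin_Un[of T "{a}" K] a assms by auto
  then obtain V L where "openin T V" "compactin T L" "closedin T L" "insert a K \<subseteq> V" "V \<subseteq> L"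
    by (rule compact_nhd)
  moreover from this have "compactin T (T closure_of V)"
    by (meson closed_compactin closedin_closure_of closure_of_minimal)
  ultimately show ?thesis
    unfolding relatively_compact_nhd_def by auto
qed

lemma Urysohn_Cc:
  assumes "compactin T K" "openin T U" "K \<subseteq> U"
  obtains r N where "r \<in> Cc T" "\<And>x. 0 \<le> r x" "\<And>x. r x \<le> 1" "fsupp T r \<subseteq> U"
    "openin T N" "K \<subseteq> N" "\<And>x. x \<in> N \<Longrightarrow> r x = 1"
proof -
  obtain V L where V: "openin T V" "compactin T L" "closedin T L" "K \<subseteq> V" "V \<subseteq> L"
    using compact_nhd[OF assms(1)] .
  define C where "C = topspace T - U \<inter> V"
  have "closedin T C" "disjnt C K"
    using V assms unfolding C_def disjnt_def by auto
  then obtain f where f: "continuous_map T (top_of_set {0..1::real}) f" "f ` K \<subseteq> {0}" "f ` C \<subseteq> {1}"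
    using Urysohn_completely_regular_closed_compact[OF zero_le_one completely_regular _ assms(1)] by blast
  have fc: "continuous_map T euclideanreal f"
    using f(1) continuous_map_into_fulltopology by blast
  \<comment> \<open>Urysohn only gives \<open>f = 0\<close> on \<open>K\<close> and
    \<open>f = 1\<close> off \<open>U \<inter> V\<close>. The rescaling creates two plateaus:
    \<open>r\<close> is 1 on the open set where \<open>f < 1/3\<close>, and its support stays in the
    closed set where \<open>f \<le> 2/3\<close>, hence inside \<open>U\<close>.\<close>
  define r where "r = (\<lambda>x. if x \<in> topspace T then min 1 (max 0 (2 - 3 * f x)) else 0)"
  have rc: "continuous_map T euclideanreal r"
    by (rule continuous_map_eq[of _ _ "\<lambda>x. min 1 (max 0 (2 - 3 * f x))"])
      (auto simp: r_def intro!: continuous_intros fc)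
  define D where "D = {x \<in> topspace T. f x \<in> {..2/3}}"
  have D: "closedin T D" unfolding D_def
    using closedin_continuous_map_preimage[OF fc, of "{..2/3}"] by simp
  have rD: "x \<in> D" if "r x \<noteq> 0" for x
    using that by (auto simp: r_def D_def split: if_splits)
  have DUV: "D \<subseteq> U \<inter> V"
    using f(3) by (force simp: D_def C_def)
  define N where "N = {x \<in> topspace T. f x \<in> {..<1/3}}"
  show thesis
  proof (rule that[of r N])
    show "r \<in> Cc T"
      by (rule CcI[OF rc V(2,3)]) (use rD DUV V in blast)
    show "fsupp T r \<subseteq> U"
      using fsupp_minimal[OF D, of r] rD DUV by auto
    show "openin T N" unfolding N_def
      using openin_continuous_map_preimage[OF fc, of "{..<1/3}"] by simp
    show "K \<subseteq> N"
      using f(2) compactin_subset_topspace[OF assms(1)] by (force simp: N_def)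
  qed (auto simp: r_def N_def)
qed

text \<open>A Urysohn function \<open>r\<close> for the compact set \<open>fsupp T f - V\<close>
  inside \<open>U\<close> gives the pieces \<open>f r\<close> and \<open>f (1 - r)\<close>. Since
  \<open>r\<close> is 1 on a whole neighbourhood \<open>N\<close> of that set, even the closed
  support of the second piece avoids \<open>N\<close> and so lies in \<open>V\<close>.\<close>

lemma partition2:
  assumes f: "f \<in> Cc T" and sub: "fsupp T f \<subseteq> U \<union> V" "openin T U" "openin T V"
  obtains g h where "g \<in> Cc T" "h \<in> Cc T" "f = g + h" "fsupp T g \<subseteq> U" "fsupp T h \<subseteq> V"
    "0 \<le> f \<Longrightarrow> 0 \<le> g" "0 \<le> f \<Longrightarrow> 0 \<le> h"
proof -
  have "compactin T (fsupp T f - V)"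
    using closed_compactin[OF Cc_compact[OF f], of "fsupp T f - V"] closedin_diff[OF closedin_fsupp sub(3)] by auto
  then obtain r N where r: "r \<in> Cc T" "\<And>x. 0 \<le> r x" "\<And>x. r x \<le> 1" "fsupp T r \<subseteq> U"
    "openin T N" "fsupp T f - V \<subseteq> N" "\<And>x. x \<in> N \<Longrightarrow> r x = 1"
    using Urysohn_Cc[of "fsupp T f - V" U] sub by blast
  note rc = Cc_continuous[OF r(1)]
  show thesis
  proof (rule that[of "\<lambda>x. f x * r x" "\<lambda>x. f x * (1 - r x)"])
    show "(\<lambda>x. f x * r x) \<in> Cc T" "(\<lambda>x. f x * (1 - r x)) \<in> Cc T"
      using Cc_mult[OF f] rc by (auto intro!: continuous_intros)
    show "f = (\<lambda>x. f x * r x) + (\<lambda>x. f x * (1 - r x))"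
      by (auto simp: fun_eq_iff algebra_simps)
    show "fsupp T (\<lambda>x. f x * r x) \<subseteq> U"
      using fsupp_minimal[OF closedin_fsupp, of T "\<lambda>x. f x * r x" r] fsuppD[of _ T r] r(4) by force
    have "fsupp T (\<lambda>x. f x * (1 - r x)) \<subseteq> fsupp T f - N"
      by (rule fsupp_minimal) (use r fsuppD[of _ T f] in \<open>auto intro: closedin_diff\<close>)
    then show "fsupp T (\<lambda>x. f x * (1 - r x)) \<subseteq> V"
      using r by auto
  qed (use r in \<open>auto simp: le_fun_def\<close>)
qed

lemma partition_finite:
  assumes "finite I" "f \<in> Cc T" "fsupp T f \<subseteq> (\<Union>i\<in>I. U i)" "\<And>i. i \<in> I \<Longrightarrow> openin T (U i)"
  shows "\<exists>g. (\<forall>i\<in>I. g i \<in> Cc T \<and> fsupp T (g i) \<subseteq> U i \<and> (0 \<le> f \<longrightarrow> 0 \<le> g i)) \<and> f = sum g I"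
  using assms
proof (induction I arbitrary: f)
  case empty
  then have "f x = 0" for x using Cc_fsuppD[of f T x] by auto
  then show ?case by (auto simp: fun_eq_iff)
next
  case (insert i I)
  have op: "openin T (\<Union>i\<in>I. U i)" using insert.prems by auto
  obtain a b where ab: "a \<in> Cc T" "b \<in> Cc T" "f = a + b" "fsupp T a \<subseteq> U i" "fsupp T b \<subseteq> (\<Union>i\<in>I. U i)"
    "0 \<le> f \<Longrightarrow> 0 \<le> a" "0 \<le> f \<Longrightarrow> 0 \<le> b"
    using partition2[of f "U i" "\<Union>i\<in>I. U i"] insert.prems op by (auto simp del: UN_simps)
  obtain g where g: "(\<forall>i\<in>I. g i \<in> Cc T \<and> fsupp T (g i) \<subseteq> U i \<and> (0 \<le> b \<longrightarrow> 0 \<le> g i))" "b = sum g I"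
    using insert.IH[OF ab(2,5)] insert.prems(3) by (metis insertI2)
  define g' where "g' j = (if j = i then a else g j)" for j
  have "sum g' I = b"
    unfolding g(2) using insert.hyps by (intro sum.cong) (auto simp: g'_def)
  then have "f = sum g' (insert i I)"
    using insert.hyps ab(3) by (simp add: g'_def)
  moreover have "\<forall>j\<in>insert i I. g' j \<in> Cc T \<and> fsupp T (g' j) \<subseteq> U j \<and> (0 \<le> f \<longrightarrow> 0 \<le> g' j)"
  proof
    fix j assume that: "j \<in> insert i I"
    show "g' j \<in> Cc T \<and> fsupp T (g' j) \<subseteq> U j \<and> (0 \<le> f \<longrightarrow> 0 \<le> g' j)"
    proof (cases "j = i")
      case True
      then have "g' j = a" by (simp add: g'_def)
      then show ?thesis using ab(1,4,6) True by simp
    next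
      case False
      then have "g' j = g j" "j \<in> I" using that by (simp_all add: g'_def)
      then show ?thesis using g(1) ab(7) by auto
    qed
  qed
  ultimately show ?case by (intro exI[of _ g'] conjI)
qed

lemma partition_of_unity:
  assumes f: "f \<in> Cc T" and sub: "fsupp T f \<subseteq> \<Union>\<U>" "\<And>U. U \<in> \<U> \<Longrightarrow> openin T U"
  shows "\<exists>\<F> g. finite \<F> \<and> \<F> \<subseteq> \<U> \<and>
    (\<forall>U\<in>\<F>. g U \<in> Cc T \<and> fsupp T (g U) \<subseteq> U \<and> (0 \<le> f \<longrightarrow> 0 \<le> g U)) \<and> f = sum g \<F>"
proof -
  obtain \<F> where F: "finite \<F>" "\<F> \<subseteq> \<U>" "fsupp T f \<subseteq> \<Union>\<F>"
    using Cc_compact[OF f] sub unfolding compactin_def by metis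
  moreover have "\<exists>g. (\<forall>i\<in>\<F>. g i \<in> Cc T \<and> fsupp T (g i) \<subseteq> i \<and> (0 \<le> f \<longrightarrow> 0 \<le> g i)) \<and> f = sum g \<F>"
    using partition_finite[OF F(1) f, of "\<lambda>U. U"] F(2,3) sub(2) by (metis image_ident subsetD)
  ultimately show ?thesis by blast
qed

text \<open>A partition of unity cuts \<open>f\<close> into finitely many pieces, each supported in
  an open set on which \<phi> vanishes. So \<phi> vanishes on the union of all these open sets as
  well, which the definition of \<open>dsupp\<close> does not assert.\<close>

lemma vanishes_off_dsupp:
  assumes "\<phi> \<in> order_dual T" "f \<in> Cc T" "fsupp T f \<inter> dsupp T \<phi> = {}"
  shows "\<phi> f = 0"
proof -
  let ?\<U> = "{U. openin T U \<and> vanishes_on T \<phi> U}"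
  have "fsupp T f \<subseteq> \<Union>?\<U>"
    using assms(3) closedin_subset[OF closedin_fsupp, of T f] unfolding dsupp_def by auto
  then obtain \<F> g where g: "\<F> \<subseteq> ?\<U>" "\<forall>U\<in>\<F>. g U \<in> Cc T \<and> fsupp T (g U) \<subseteq> U" "f = sum g \<F>"
    using partition_of_unity[OF assms(2), of ?\<U>] by (metis (lifting) mem_Collect_eq)
  then have "\<phi> (g U) = 0" if "U \<in> \<F>" for U
    using that unfolding vanishes_on_def by blast
  then show ?thesis
    using order_dual_sum[OF assms(1), of \<F> g] g(2,3) by simp
qed

lemma closedin_dsupp: "closedin T (dsupp T \<phi>)"
  unfolding dsupp_def by (auto intro!: closedin_diff openin_Union)

text \<open>The complements of the two supports cover the space, so \<open>f = g + h\<close> with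
  \<open>z2 g = 0\<close> and \<open>z1 h = 0\<close>. On \<open>g\<close> the sum
  \<open>z1 + z2\<close> agrees with \<open>z1 - z2\<close>, on \<open>h\<close> with
  \<open>z2 - z1\<close>, and each of the two bounds on \<open>w\<close> handles one piece.\<close>

lemma disjoint_supports_sum_le:
  assumes od: "z1 \<in> order_dual T" "z2 \<in> order_dual T" "w \<in> order_dual T"
    and disj: "dsupp T z1 \<inter> dsupp T z2 = {}"
    and w: "dual_le T (z1 - z2) w" "dual_le T (z2 - z1) w"
  shows "dual_le T (z1 + z2) w"
  unfolding dual_le_def
proof (intro ballI impI)
  fix f assume f: "f \<in> Cc T" "0 \<le> f"
  have "fsupp T f \<subseteq> (topspace T - dsupp T z2) \<union> (topspace T - dsupp T z1)"
    using disj closedin_subset[OF closedin_fsupp, of T f] by auto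
  then obtain g h where gh: "g \<in> Cc T" "h \<in> Cc T" "f = g + h" "fsupp T g \<subseteq> topspace T - dsupp T z2"
    "fsupp T h \<subseteq> topspace T - dsupp T z1" "0 \<le> g" "0 \<le> h"
    using partition2[OF f(1), of "topspace T - dsupp T z2" "topspace T - dsupp T z1"] closedin_dsupp f(2)
    by (metis closedin_def)
  have "z2 g = 0" "z1 h = 0"
    using vanishes_off_dsupp[OF od(2) gh(1)] vanishes_off_dsupp[OF od(1) gh(2)] gh(4,5) by blast+
  moreover have "z1 g - z2 g \<le> w g" "z2 h - z1 h \<le> w h"
    using w gh unfolding dual_le_def by auto
  ultimately show "(z1 + z2) f \<le> w f"
    using order_dual_add[OF od(1) gh(1,2)] order_dual_add[OF od(2) gh(1,2)] order_dual_add[OF od(3) gh(1,2)] gh(3)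
    by simp
qed

end

section \<open>The Riesz measure of a positive functional\<close>

lemma sets_borel_of: "sets (borel_of X) = sigma_sets (topspace X) {U. openin X U}"
  and space_borel_of [simp]: "space (borel_of X) = topspace X"
proof -
  have "{U. openin X U} \<subseteq> Pow (topspace X)"
    by (auto dest: openin_subset)
  then show "sets (borel_of X) = sigma_sets (topspace X) {U. openin X U}"
    and "space (borel_of X) = topspace X"
    by (auto simp: borel_of_def)
qed

lemma openin_borel_of: "openin X V \<Longrightarrow> V \<in> sets (borel_of X)"
  by (auto simp: sets_borel_of)

lemma closedin_borel_of: "closedin X C \<Longrightarrow> C \<in> sets (borel_of X)"
  using sets.compl_sets[OF openin_borel_of[of X "topspace X - C"]]
  by (simp add: closedin_def double_diff)

lemma borel_of_subset: "A \<in> sets (borel_of X) \<Longrightarrow> A \<subseteq> topspace X"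
  using sets.sets_into_space by fastforce

lemma sigma_algebra_borel_of: "sigma_algebra (topspace X) (sets (borel_of X))"
  using sets.sigma_algebra_axioms[of "borel_of X"] by simp

lemma continuous_map_borel_measurable:
  assumes "continuous_map X euclideanreal f" "sets M = sets (borel_of X)"
  shows "f \<in> borel_measurable M"
proof (rule borel_measurableI)
  fix S :: "real set" assume "open S"
  then have "openin X {x \<in> topspace X. f x \<in> S}"
    using openin_continuous_map_preimage[OF assms(1), of S] by simp
  moreover have "f -` S \<inter> space M = {x \<in> topspace X. f x \<in> S}"
    using sets_eq_imp_space_eq[OF assms(2)] by auto
  ultimately show "f -` S \<inter> space M \<in> sets M"
    by (simp add: assms(2) openin_borel_of)
qed

lemma sets_borel_of_subtopology:
  assumes "A \<in> sets (borel_of X)"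
  shows "U \<inter> A \<in> sets (borel_of (subtopology X U))"
proof -
  have "A \<in> sigma_sets (topspace X) {U. openin X U}" using assms by (simp add: sets_borel_of)
  then have "topspace X \<inter> U \<inter> A \<in> sigma_sets (topspace X \<inter> U) {V. openin (subtopology X U) V}"
  proof induction
    case (Basic a)
    then have "openin (subtopology X U) (U \<inter> a)" "topspace X \<inter> U \<inter> a = U \<inter> a"
      using openin_subset[of X a] by (auto intro: openin_subtopology_Int2)
    then show ?case by (simp add: sigma_sets.Basic)
  next
    case (Compl a)
    have "topspace X \<inter> U - topspace X \<inter> U \<inter> a \<in> sigma_sets (topspace X \<inter> U) {V. openin (subtopology X U) V}"
      using Compl by (intro sigma_sets.Compl)
    moreover have "topspace X \<inter> U - topspace X \<inter> U \<inter> a = topspace X \<inter> U \<inter> (topspace X - a)" by auto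
    ultimately show ?case by simp
  next
    case (Union a)
    have "(\<Union>i. topspace X \<inter> U \<inter> a i) \<in> sigma_sets (topspace X \<inter> U) {V. openin (subtopology X U) V}"
      using Union by (intro sigma_sets.Union)
    then show ?case by (simp only: Int_UN_distrib)
  qed (simp add: sigma_sets.Empty)
  moreover have "topspace X \<inter> U \<inter> A = U \<inter> A" using borel_of_subset[OF assms] by auto
  ultimately show ?thesis by (simp add: sets_borel_of)
qed

section \<open>The outer measure induced by a positive functional\<close>

locale positive_functional = locally_compact_Hausdorff +
  fixes \<phi> :: "('a \<Rightarrow> real) \<Rightarrow> real" and U :: "'a set"
  assumes order_dual: "\<phi> \<in> order_dual T"
    and nonneg: "\<And>f. f \<in> Cc T \<Longrightarrow> (\<And>x. 0 \<le> f x) \<Longrightarrow> 0 \<le> \<phi> f"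
    and open_U: "openin T U"
    and relatively_compact_U: "compactin T (T closure_of U)"
begin

text \<open>The test functions written \<open>f \<prec> V\<close> in the classical proof of the
  Riesz representation theorem.\<close>

definition below :: "'a set \<Rightarrow> ('a \<Rightarrow> real) set" where
  "below V = {f \<in> Cc T. (\<forall>x. 0 \<le> f x \<and> f x \<le> 1) \<and> fsupp T f \<subseteq> V}"

definition content :: "'a set \<Rightarrow> ennreal" where
  "content V = (SUP f\<in>below V. ennreal (\<phi> f))"

text \<open>Only open sets inside \<open>U\<close> compete, so that the values stay finite on
  subsets of \<open>U\<close>. For other sets the infimum is over the empty family, hence
  infinite.\<close>

definition outer :: "'a set \<Rightarrow> ennreal" where
  "outer A = (INF V\<in>{V. openin T V \<and> A \<subseteq> V \<and> V \<subseteq> U}. content V)"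

lemma mono: "f \<in> Cc T \<Longrightarrow> g \<in> Cc T \<Longrightarrow> (\<And>x. f x \<le> g x) \<Longrightarrow> \<phi> f \<le> \<phi> g"
  using nonneg[of "g - f"] Cc_diff[of g T f] order_dual_diff[OF order_dual, of g f] by simp

lemma zero_below [simp]: "0 \<in> below V"
  by (simp add: below_def)

lemma content_mono: "V \<subseteq> W \<Longrightarrow> content V \<le> content W"
  unfolding content_def below_def by (rule SUP_subset_mono) auto

text \<open>Relative compactness of \<open>U\<close> enters here: a compactly supported
  \<open>r\<close> that is 1 near the closure of \<open>U\<close> dominates every function in
  \<open>below U\<close>, so \<open>\<phi> r\<close> bounds the content.\<close>

lemma content_finite: "content U < \<infinity>"
proof -
  have "T closure_of U \<subseteq> topspace T" by (rule closure_of_subset_topspace)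
  then obtain r N where r: "r \<in> Cc T" "\<And>x. 0 \<le> r x" "\<And>x. r x \<le> 1"
    "T closure_of U \<subseteq> N" "\<And>x. x \<in> N \<Longrightarrow> r x = 1"
    using Urysohn_Cc[OF relatively_compact_U openin_topspace] by metis
  have UN: "U \<subseteq> N" using closure_of_subset[of U T] openin_subset[OF open_U] r by auto
  have "ennreal (\<phi> f) \<le> ennreal (\<phi> r)" if "f \<in> below U" for f
  proof (rule ennreal_leI, rule mono)
    show "f x \<le> r x" for x
      using that Cc_fsuppD[of f T x] r UN by (cases "f x = 0") (auto simp: below_def)
  qed (use that r in \<open>auto simp: below_def\<close>)
  then have "content U \<le> ennreal (\<phi> r)"
    unfolding content_def by (rule SUP_least)
  then show ?thesis
    by (rule order_le_less_trans) simp
qed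

lemma content_empty: "content {} = 0"
proof -
  have "\<phi> f = 0" if "f \<in> below {}" for f
  proof -
    have "f = 0" using that Cc_fsuppD[of f T] by (auto simp: below_def fun_eq_iff)
    then show ?thesis using order_dual_zero[OF order_dual] by simp
  qed
  then show ?thesis unfolding content_def using zero_below[of "{}"] by (intro SUP_eq_const) force+
qed

text \<open>Compactness of \<open>fsupp T f\<close> leaves finitely many of the sets. A partition of
  \<open>f\<close> over these has non-negative parts below \<open>f \<le> 1\<close>, so each part is
  a competitor in the content of its own set.\<close>

lemma content_countably_subadditive:
  fixes V :: "nat \<Rightarrow> 'a set"
  assumes V: "\<And>i. openin T (V i)"
  shows "content (\<Union>i. V i) \<le> (\<Sum>i. content (V i))"
  unfolding content_def[of "\<Union>i. V i"]
proof (rule SUP_least)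
  fix f assume "f \<in> below (\<Union>i. V i)"
  then have f: "f \<in> Cc T" "\<And>x. 0 \<le> f x" "\<And>x. f x \<le> 1" "fsupp T f \<subseteq> \<Union>(range V)"
    by (auto simp: below_def)
  obtain \<F> where "finite \<F>" "\<F> \<subseteq> range V" "fsupp T f \<subseteq> \<Union>\<F>"
    using Cc_compact[OF f(1)] f(4) V unfolding compactin_def by (metis rangeE)
  then obtain I where I: "finite I" "fsupp T f \<subseteq> (\<Union>i\<in>I. V i)"
    by (metis finite_subset_image)
  then obtain g where g: "\<forall>i\<in>I. g i \<in> Cc T \<and> fsupp T (g i) \<subseteq> V i \<and> (0 \<le> f \<longrightarrow> 0 \<le> g i)" and sum: "f = sum g I"
    using partition_finite[OF I(1) f(1) I(2) V] by auto
  have "0 \<le> f" using f(2) by (simp add: le_fun_def)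
  then have g0: "0 \<le> g i x" if "i \<in> I" for i x using g that by (simp add: le_fun_def)
  have below: "g i \<in> below (V i)" if "i \<in> I" for i
  proof -
    have "g i x \<le> f x" for x
      using sum sum_fun_apply[of g I x] member_le_sum[OF that, of "\<lambda>i. g i x"] g0 I(1) by auto
    then have "g i x \<le> 1" for x using f(3)[of x] by (meson order_trans)
    then show ?thesis using g g0 that by (auto simp: below_def)
  qed
  have "\<phi> f = (\<Sum>i\<in>I. \<phi> (g i))"
    using order_dual_sum[OF order_dual, of I g] g sum by auto
  then have "ennreal (\<phi> f) = (\<Sum>i\<in>I. ennreal (\<phi> (g i)))"
    using g g0 nonneg by (simp add: sum_ennreal)
  also have "\<dots> \<le> (\<Sum>i\<in>I. content (V i))"
    unfolding content_def by (intro sum_mono SUP_upper below)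
  also have "\<dots> \<le> (\<Sum>i. content (V i))"
    by (rule sum_le_suminf) (use I in auto)
  finally show "ennreal (\<phi> f) \<le> (\<Sum>i. content (V i))" .
qed

lemma outer_open: "openin T V \<Longrightarrow> V \<subseteq> U \<Longrightarrow> outer V = content V"
  unfolding outer_def by (rule antisym) (auto intro!: INF_lower INF_greatest content_mono)

lemma outer_mono: "A \<subseteq> B \<Longrightarrow> outer A \<le> outer B"
  unfolding outer_def by (rule INF_superset_mono) auto

lemma outer_le_content: "openin T V \<Longrightarrow> A \<subseteq> V \<Longrightarrow> V \<subseteq> U \<Longrightarrow> outer A \<le> content V"
  unfolding outer_def by (rule INF_lower) auto

lemma outer_finite: "A \<subseteq> U \<Longrightarrow> outer A < \<infinity>"
  using outer_le_content[OF open_U, of A] content_finite order_le_less_trans by blast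

lemma outer_approx:
  assumes "A \<subseteq> U" "0 < (e::real)"
  obtains V where "openin T V" "A \<subseteq> V" "V \<subseteq> U" "content V \<le> outer A + ennreal e"
proof -
  have "outer A < outer A + ennreal e"
    using outer_finite[OF assms(1)] assms(2) by (simp add: ennreal_add_left_cancel_less[of _ 0, simplified])
  then show thesis
    unfolding outer_def[of A] INF_less_iff using that by (auto simp: outer_def[symmetric] intro: less_imp_le)
qed

lemma outer_countably_subadditive:
  fixes A :: "nat \<Rightarrow> 'a set"
  assumes A: "\<And>i. A i \<subseteq> U"
  shows "outer (\<Union>i. A i) \<le> (\<Sum>i. outer (A i))"
proof (rule ennreal_le_epsilon)
  fix e :: real assume e: "0 < e"
  have "\<exists>V. openin T V \<and> A i \<subseteq> V \<and> V \<subseteq> U \<and> content V \<le> outer (A i) + ennreal (e * (1/2)^Suc i)" for i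
    using outer_approx[OF A, of "e * (1/2)^Suc i" i] e by (metis half_gt_zero_iff mult_pos_pos zero_less_one zero_less_power)
  then obtain V where V: "\<And>i. openin T (V i)" "\<And>i. A i \<subseteq> V i" "\<And>i. V i \<subseteq> U"
    "\<And>i. content (V i) \<le> outer (A i) + ennreal (e * (1/2)^Suc i)" by metis
  have "outer (\<Union>i. A i) \<le> content (\<Union>i. V i)"
    using V(1-3) by (intro outer_le_content) blast+
  also have "\<dots> \<le> (\<Sum>i. content (V i))"
    by (rule content_countably_subadditive[OF V(1)])
  also have "\<dots> \<le> (\<Sum>i. outer (A i) + ennreal (e * (1/2)^Suc i))"
    by (intro suminf_le V(4)) auto
  also have "\<dots> = (\<Sum>i. outer (A i)) + (\<Sum>i. ennreal (e * (1/2)^Suc i))"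
    by (rule suminf_add[symmetric]) auto
  also have "(\<Sum>i. ennreal (e * (1/2)^Suc i)) = ennreal e"
    using e sums_mult[OF power_half_series, of e] by (intro suminf_ennreal_eq) auto
  finally show "outer (\<Union>i. A i) \<le> (\<Sum>i. outer (A i)) + ennreal e" .
qed

lemma outer_measure_space_outer: "outer_measure_space (Pow U) outer"
proof -
  have "outer {} = 0"
    using outer_open[of "{}"] content_empty by simp
  then show ?thesis
    unfolding outer_measure_space_def
    by (auto simp: positive_def increasing_def countably_subadditive_def
        intro!: outer_mono outer_countably_subadditive)
qed

text \<open>Any \<open>g\<close> in \<open>below W'\<close> is supported off the support of
  \<open>f\<close>, so \<open>f + g\<close> still stays below 1 and competes in
  \<open>content W\<close>.\<close>

lemma below_union_le:
  assumes "openin T W" "f \<in> below W" "W - fsupp T f = W'"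
  shows "ennreal (\<phi> f) + content W' \<le> content W"
proof -
  have f: "f \<in> Cc T" "\<And>x. 0 \<le> f x" "\<And>x. f x \<le> 1" "fsupp T f \<subseteq> W"
    using assms(2) by (auto simp: below_def)
  have "ennreal (\<phi> f) + ennreal (\<phi> g) \<le> content W" if "g \<in> below W'" for g
  proof -
    have g: "g \<in> Cc T" "\<And>x. 0 \<le> g x" "\<And>x. g x \<le> 1" "fsupp T g \<subseteq> W'"
      using that by (auto simp: below_def)
    have "(f + g) x \<le> 1" for x
      using f(3)[of x] g(3)[of x] g(4) assms(3) Cc_fsuppD[OF f(1), of x] Cc_fsuppD[OF g(1), of x]
      by (cases "f x = 0"; cases "g x = 0") auto
    moreover have "fsupp T (f + g) \<subseteq> W"
      using fsupp_combine[of f g "f + g" T] f(4) g(4) assms(3) by auto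
    ultimately have "f + g \<in> below W"
      using f g by (auto simp: below_def intro!: Cc_add)
    then have "ennreal (\<phi> (f + g)) \<le> content W"
      unfolding content_def by (rule SUP_upper)
    then show ?thesis
      using order_dual_add[OF order_dual f(1) g(1)] nonneg f g by (simp add: ennreal_plus)
  qed
  moreover have "below W' \<noteq> {}" using zero_below by blast
  ultimately show ?thesis
    unfolding content_def[of W'] by (subst ennreal_SUP_add_right) (auto intro!: SUP_least)
qed

text \<open>This is Caratheodory's criterion. For open \<open>W\<close> around \<open>x\<close> the
  set \<open>W - V\<close> is not open, but for every \<open>f\<close> in
  \<open>below (W \<inter> V)\<close> the set \<open>W - fsupp T f\<close> is an open set containing
  \<open>x - V\<close>. Now \<open>below_union_le\<close> applies, and the supremum over
  \<open>f\<close> turns \<open>\<phi> f\<close> into \<open>content (W \<inter> V)\<close>.\<close>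

lemma open_lambda_system:
  assumes V: "openin T V" "V \<subseteq> U"
  shows "V \<in> lambda_system U (Pow U) outer"
proof -
  interpret P: sigma_algebra U "Pow U" by (rule sigma_algebra_Pow)
  have sub: "subadditive (Pow U) outer"
    using outer_measure_space_outer P.countably_subadditive_subadditive
    unfolding outer_measure_space_def by blast
  have "outer (x \<inter> V) + outer (x - V) = outer x" if x: "x \<subseteq> U" for x
  proof (rule antisym)
    have "(x \<inter> V) \<inter> (x - V) = {}" "x \<inter> V \<union> (x - V) = x" by auto
    then show "outer x \<le> outer (x \<inter> V) + outer (x - V)"
      using subadditiveD[OF sub, of "x \<inter> V" "x - V"] x by auto
    show "outer (x \<inter> V) + outer (x - V) \<le> outer x"
      unfolding outer_def[of x]
    proof (rule INF_greatest)
      fix W assume "W \<in> {W. openin T W \<and> x \<subseteq> W \<and> W \<subseteq> U}"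
      then have W: "openin T W" "x \<subseteq> W" "W \<subseteq> U" by auto
      have "ennreal (\<phi> f) + outer (x - V) \<le> content W" if f: "f \<in> below (W \<inter> V)" for f
      proof -
        have "x - V \<subseteq> W - fsupp T f" using f W by (auto simp: below_def)
        then have "outer (x - V) \<le> content (W - fsupp T f)"
          using W by (intro outer_le_content) (auto intro!: openin_diff)
        moreover have "ennreal (\<phi> f) + content (W - fsupp T f) \<le> content W"
          using f by (intro below_union_le[OF W(1)]) (auto simp: below_def)
        ultimately show ?thesis by (rule order_trans[OF add_left_mono])
      qed
      moreover have "below (W \<inter> V) \<noteq> {}" using zero_below by blast
      ultimately have "content (W \<inter> V) + outer (x - V) \<le> content W"
        unfolding content_def[of "W \<inter> V"] by (subst ennreal_SUP_add_left[symmetric]) (auto intro!: SUP_least)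
      moreover have "outer (x \<inter> V) \<le> content (W \<inter> V)"
        using W V by (intro outer_le_content) auto
      ultimately show "outer (x \<inter> V) + outer (x - V) \<le> content W"
        by (rule order_trans[OF add_right_mono, rotated])
    qed
  qed
  then show ?thesis
    using V by (auto simp: P.lambda_system_eq)
qed

section \<open>The Riesz measure on \<open>U\<close>\<close>

abbreviation "TU \<equiv> subtopology T U"

definition riesz_measure :: "'a measure" where
  "riesz_measure = measure_of U (sets (borel_of TU)) outer"

lemma topspace_Int_U [simp]: "topspace T \<inter> U = U"
  using openin_subset[OF open_U] by auto

lemma topspace_TU: "topspace TU = U"
  by simp

lemma openin_TU: "openin TU V \<longleftrightarrow> openin T V \<and> V \<subseteq> U"
  by (rule openin_open_subtopology[OF open_U])

lemma measure_space_outer: "measure_space U (sets (borel_of TU)) outer"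
proof -
  interpret P: sigma_algebra U "Pow U" by (rule sigma_algebra_Pow)
  have ms: "measure_space U (lambda_system U (Pow U) outer) outer"
    by (rule P.caratheodory_lemma[OF outer_measure_space_outer])
  then interpret L: sigma_algebra U "lambda_system U (Pow U) outer"
    by (simp add: measure_space_def)
  have "sets (borel_of TU) \<subseteq> lambda_system U (Pow U) outer"
    unfolding sets_borel_of topspace_TU
    by (rule L.sigma_sets_subset) (auto simp: openin_TU open_lambda_system)
  then show ?thesis
    using measure_down[OF ms] sigma_algebra_borel_of[of TU] by simp
qed

lemma sets_riesz_measure [simp, measurable_cong]: "sets riesz_measure = sets (borel_of TU)"
  and space_riesz_measure [simp]: "space riesz_measure = U"
  using sigma_algebra.sets_measure_of_eq[OF sigma_algebra_borel_of[of TU]]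
    sigma_algebra.space_measure_of_eq[OF sigma_algebra_borel_of[of TU]]
  by (simp_all add: riesz_measure_def)

lemma emeasure_riesz_measure: "A \<in> sets (borel_of TU) \<Longrightarrow> emeasure riesz_measure A = outer A"
  using measure_space_outer unfolding riesz_measure_def
  by (intro emeasure_measure_of_sigma) (auto simp: measure_space_def)

end

section \<open>Finite signed Borel measures\<close>

lemma finite_measure_approx_compact:
  assumes "finite_measure M" "space M = topspace X" "sets M = sets (borel_of X)" "Hausdorff_space X"
    and "openin X V" "emeasure M V = (SUP K\<in>{K. compactin X K \<and> K \<subseteq> V}. emeasure M K)" "0 < e"
  obtains K where "compactin X K" "K \<subseteq> V" "K \<in> sets M" "measure M V < measure M K + e"
proof -
  interpret finite_measure M by fact
  have "\<exists>K\<in>{K. compactin X K \<and> K \<subseteq> V}. emeasure M V < emeasure M K + ennreal e"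
    by (rule SUP_approx_ennreal[OF assms(7) _ assms(6)]) auto
  then obtain K where K: "compactin X K" "K \<subseteq> V" "emeasure M V < emeasure M K + ennreal e" by auto
  moreover have "measure M V < measure M K + e"
    using K(3) assms(7) by (simp add: emeasure_eq_measure ennreal_less_iff flip: ennreal_plus)
  moreover have "K \<in> sets M"
    using assms closedin_borel_of compactin_imp_closedin K(1) by blast
  ultimately show thesis using that by blast
qed

text \<open>Finiteness turns outer regularity of the complement of \<open>A\<close> into inner
  regularity of \<open>A\<close>. Take a compact \<open>K\<close> of almost full measure and an open
  \<open>V\<close> that contains the complement of \<open>A\<close> and is hardly larger. Then
  \<open>K - V\<close> is a compact subset of \<open>A\<close>, and \<open>K\<close> and
  \<open>V\<close> each lose less than \<open>e/2\<close>.\<close>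

lemma regular_borel_measureI:
  assumes M: "finite_measure M" "sets M = sets (borel_of X)" and "Hausdorff_space X"
    and outer: "\<And>A. A \<in> sets (borel_of X) \<Longrightarrow> emeasure M A = (INF V\<in>{V. openin X V \<and> A \<subseteq> V}. emeasure M V)"
    and inner: "\<And>V. openin X V \<Longrightarrow> emeasure M V = (SUP K\<in>{K. compactin X K \<and> K \<subseteq> V}. emeasure M K)"
  shows "regular_borel_measure X M"
  unfolding regular_borel_measure_def
proof (intro ballI conjI)
  interpret finite_measure M by fact
  have sp [simp]: "space M = topspace X"
    using sets_eq_imp_space_eq[OF M(2)] by simp
  fix A assume A: "A \<in> sets (borel_of X)"
  then show "emeasure M A = (INF V\<in>{V. openin X V \<and> A \<subseteq> V}. emeasure M V)" by (rule outer)
  show "emeasure M A = (SUP K\<in>{K. compactin X K \<and> K \<subseteq> A}. emeasure M K)"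
  proof (rule antisym)
    show "(SUP K\<in>{K. compactin X K \<and> K \<subseteq> A}. emeasure M K) \<le> emeasure M A"
      using A M by (auto intro!: SUP_least emeasure_mono)
    show "emeasure M A \<le> (SUP K\<in>{K. compactin X K \<and> K \<subseteq> A}. emeasure M K)"
    proof (rule ennreal_le_epsilon)
      fix e :: real assume e: "0 < e"
      obtain K where K: "compactin X K" "K \<in> sets M" "measure M (topspace X) < measure M K + e/2"
        using finite_measure_approx_compact[OF M(1) sp M(2) assms(3) openin_topspace inner[OF openin_topspace], of "e/2"] e
        by (metis half_gt_zero)
      have B: "topspace X - A \<in> sets (borel_of X)"
        using A sets.compl_sets[of A "borel_of X"] by simp
      have "\<exists>V\<in>{V. openin X V \<and> topspace X - A \<subseteq> V}. emeasure M V < emeasure M (topspace X - A) + ennreal (e/2)"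
        by (rule INF_approx_ennreal) (use e outer[OF B] in auto)
      then obtain V where V: "openin X V" "topspace X - A \<subseteq> V"
        "emeasure M V < emeasure M (topspace X - A) + ennreal (e/2)" by auto
      then have V': "measure M V < measure M (topspace X - A) + e/2"
        using e by (simp add: emeasure_eq_measure ennreal_less_iff flip: ennreal_plus)
      have sets: "V \<in> sets M" "A \<in> sets M" "topspace X - A \<in> sets M" "topspace X \<in> sets M"
        using V openin_borel_of A B M(2) by auto
      have KV: "compactin X (K - V)"
        using K V compactin_imp_closedin[OF assms(3) K(1)] by (intro closed_compactin[OF K(1)]) (auto intro: closedin_diff)
      have AX: "A \<subseteq> topspace X" using A borel_of_subset by blast
      have "measure M A \<le> measure M ((K - V) \<union> ((topspace X - K) \<union> (V - (topspace X - A))))"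
        using AX sets K by (intro finite_measure_mono) auto
      also have "\<dots> \<le> measure M (K - V) + measure M ((topspace X - K) \<union> (V - (topspace X - A)))"
        using sets K by (intro measure_Un_le) auto
      also have "\<dots> \<le> measure M (K - V) + (measure M (topspace X - K) + measure M (V - (topspace X - A)))"
        using sets K by (intro add_left_mono measure_Un_le) auto
      also have "measure M (topspace X - K) = measure M (topspace X) - measure M K"
        using finite_measure_compl[OF K(2)] by simp
      also have "measure M (V - (topspace X - A)) = measure M V - measure M (topspace X - A)"
        using sets V by (intro finite_measure_Diff) auto
      finally have "measure M A \<le> measure M (K - V) + e"
        using V' K by simp
      then have "emeasure M A \<le> emeasure M (K - V) + ennreal e"
        using e by (simp add: emeasure_eq_measure flip: ennreal_plus)
      also have "emeasure M (K - V) \<le> (SUP K\<in>{K. compactin X K \<and> K \<subseteq> A}. emeasure M K)"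
        using KV AX V compactin_subset_topspace[OF K(1)] by (intro SUP_upper) auto
      finally show "emeasure M A \<le> (SUP K\<in>{K. compactin X K \<and> K \<subseteq> A}. emeasure M K) + ennreal e"
        by simp
    qed
  qed
qed

text \<open>Call a set bad if \<nu> is unbounded on its Borel subsets. Every bad set
  \<open>A\<close> contains a bad \<open>A'\<close> with
  \<open>\<bar>\<nu> (A - A')\<bar> \<ge> 1\<close>. Starting from a bad whole space, iteration
  yields disjoint differences whose values do not tend to 0, against countable additivity.\<close>

lemma finite_signed_borel_measure_bounded:
  assumes "finite_signed_borel_measure X \<nu>"
  obtains B where "\<And>A. A \<in> sets (borel_of X) \<Longrightarrow> \<bar>\<nu> A\<bar> \<le> B"
proof -
  let ?S = "sets (borel_of X)"
  have sums: "(\<lambda>i. \<nu> (A i)) sums \<nu> (\<Union>i. A i)" if "range A \<subseteq> ?S" "disjoint_family A" for A :: "nat \<Rightarrow> _"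
    using assms that unfolding finite_signed_borel_measure_def by blast
  have "(\<lambda>i. \<nu> {}) sums \<nu> {}"
    using sums[of "\<lambda>i. {}"] by (auto simp: disjoint_family_on_def)
  then have emp: "\<nu> {} = 0"
    using summable_const_iff sums_summable by blast
  have add: "\<nu> (A \<union> B) = \<nu> A + \<nu> B" if "A \<in> ?S" "B \<in> ?S" "A \<inter> B = {}" for A B
  proof -
    define F where "F = (\<lambda>i::nat. if i = 0 then A else if i = 1 then B else {})"
    have "(\<lambda>i. \<nu> (F i)) sums \<nu> (\<Union>i. F i)"
      using that by (intro sums) (auto simp: F_def disjoint_family_on_def)
    moreover have "(\<lambda>i. \<nu> (F i)) sums (\<Sum>i\<in>{0,1}. \<nu> (F i))"
      by (rule sums_finite) (auto simp: F_def emp)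
    moreover have "(\<Union>i. F i) = A \<union> B" by (auto simp: F_def split: if_splits)
    ultimately show ?thesis
      using sums_unique2 by (fastforce simp: F_def)
  qed
  define bad where "bad A \<longleftrightarrow> A \<in> ?S \<and> (\<forall>B. \<exists>C\<in>?S. C \<subseteq> A \<and> B < \<bar>\<nu> C\<bar>)" for A
  have step: "\<exists>A'. bad A' \<and> A' \<subseteq> A \<and> 1 \<le> \<bar>\<nu> (A - A')\<bar>" if A: "bad A" for A
  proof -
    \<comment> \<open>The margin \<open>\<bar>\<nu> A\<bar> + 1\<close> forces both
      \<open>\<bar>\<nu> C\<bar>\<close> and \<open>\<bar>\<nu> (A - C)\<bar>\<close> to be at least
      1, so either of the two parts may play the role of \<open>A'\<close>.\<close>
    obtain C where C: "C \<in> ?S" "C \<subseteq> A" "\<bar>\<nu> A\<bar> + 1 < \<bar>\<nu> C\<bar>" using A unfolding bad_def by meson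
    have AS: "A \<in> ?S" "A - C \<in> ?S" using A C by (auto simp: bad_def)
    have eq: "\<nu> A = \<nu> C + \<nu> (A - C)"
      using add[of C "A - C"] C AS by (simp add: Un_absorb1)
    have or: "bad C \<or> bad (A - C)"
    proof (rule ccontr)
      assume "\<not> (bad C \<or> bad (A - C))"
      then obtain B1 B2 where B: "\<And>D. D \<in> ?S \<Longrightarrow> D \<subseteq> C \<Longrightarrow> \<bar>\<nu> D\<bar> \<le> B1"
        "\<And>D. D \<in> ?S \<Longrightarrow> D \<subseteq> A - C \<Longrightarrow> \<bar>\<nu> D\<bar> \<le> B2"
        using C AS unfolding bad_def by (meson not_le_imp_less)
      obtain D where D: "D \<in> ?S" "D \<subseteq> A" "B1 + B2 < \<bar>\<nu> D\<bar>" using A unfolding bad_def by meson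
      have "\<nu> ((D \<inter> C) \<union> (D - C)) = \<nu> (D \<inter> C) + \<nu> (D - C)"
        using D C by (intro add) auto
      then have "\<nu> D = \<nu> (D \<inter> C) + \<nu> (D - C)" by (simp add: Int_Diff_Un)
      moreover have "\<bar>\<nu> (D \<inter> C)\<bar> \<le> B1" "\<bar>\<nu> (D - C)\<bar> \<le> B2"
        using D C by (auto intro!: B)
      ultimately show False using D by linarith
    qed
    show ?thesis
    proof (cases "bad C")
      case True
      moreover have "1 \<le> \<bar>\<nu> (A - C)\<bar>" using C(3) eq by linarith
      ultimately show ?thesis using C(2) by blast
    next
      case False
      then have "bad (A - C)" using or by blast
      moreover have "A - (A - C) = C" using C by auto
      moreover have "1 \<le> \<bar>\<nu> C\<bar>" using C(3) by linarith
      ultimately show ?thesis by (metis Diff_subset)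
    qed
  qed
  have "\<not> bad (topspace X)"
  proof
    assume "bad (topspace X)"
    then obtain F where F: "\<And>n::nat. bad (F n)" "\<And>n. F (Suc n) \<subseteq> F n" "\<And>n. 1 \<le> \<bar>\<nu> (F n - F (Suc n))\<bar>"
      using dependent_nat_choice[of "\<lambda>n. bad" "\<lambda>n A A'. A' \<subseteq> A \<and> 1 \<le> \<bar>\<nu> (A - A')\<bar>"] step by metis
    have dec: "decseq F" using F(2) by (simp add: decseq_SucI)
    have "disjoint_family (\<lambda>n. F n - F (Suc n))"
      unfolding disjoint_family_on_def
    proof (intro ballI impI)
      fix m n :: nat assume "m \<noteq> n"
      then consider "Suc m \<le> n" | "Suc n \<le> m" by linarith
      then show "(F m - F (Suc m)) \<inter> (F n - F (Suc n)) = {}"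
        by cases (use decseqD[OF dec] in blast)+
    qed
    moreover have "range (\<lambda>n. F n - F (Suc n)) \<subseteq> ?S"
      using F(1) by (auto simp: bad_def)
    ultimately have "(\<lambda>n. \<nu> (F n - F (Suc n))) \<longlonglongrightarrow> 0"
      using sums summable_LIMSEQ_zero sums_summable by blast
    then have "(\<lambda>n. \<bar>\<nu> (F n - F (Suc n))\<bar>) \<longlonglongrightarrow> 0"
      by (rule tendsto_rabs_zero)
    then have "1 \<le> (0::real)"
      by (rule LIMSEQ_le_const) (use F(3) in auto)
    then show False by simp
  qed
  then obtain B where B: "\<And>C. C \<in> ?S \<Longrightarrow> C \<subseteq> topspace X \<Longrightarrow> \<bar>\<nu> C\<bar> \<le> B"
    unfolding bad_def using openin_borel_of[OF openin_topspace] by (meson not_le_imp_less)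
  show thesis
    by (rule that[of B]) (simp add: B borel_of_subset)
qed

section \<open>Variations of signed measures\<close>

lemma
  shows sets_pos_variation [simp]: "sets (pos_variation X \<nu>) = sets (borel_of X)"
    and space_pos_variation [simp]: "space (pos_variation X \<nu>) = topspace X"
  using sigma_algebra.sets_measure_of_eq[OF sigma_algebra_borel_of[of X]]
    sigma_algebra.space_measure_of_eq[OF sigma_algebra_borel_of[of X]]
  by (simp_all add: pos_variation_def)

text \<open>\<open>measure_of\<close> yields either the given set function or, if that fails to be a
  measure, zero. The bound on \<nu> controls both cases.\<close>

lemma finite_measure_pos_variation:
  assumes "\<And>A. A \<in> sets (borel_of X) \<Longrightarrow> \<nu> A \<le> B"
  shows "finite_measure (pos_variation X \<nu>)"
proof
  let ?f = "\<lambda>A. SUP B\<in>{B \<in> sets (borel_of X). B \<subseteq> A}. ennreal (\<nu> B)"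
  have ss: "sigma_sets (topspace X) (sets (borel_of X)) = sets (borel_of X)"
    by (rule sigma_algebra.sigma_sets_eq[OF sigma_algebra_borel_of])
  have "emeasure (pos_variation X \<nu>) (topspace X) \<le> ?f (topspace X)"
    unfolding pos_variation_def emeasure_measure_of_conv ss by (simp split: if_splits)
  also have "\<dots> \<le> ennreal B"
    using assms by (auto intro!: SUP_least ennreal_leI)
  also have "\<dots> < \<infinity>" by simp
  finally show "emeasure (pos_variation X \<nu>) (space (pos_variation X \<nu>)) \<noteq> \<infinity>" by simp
qed

lemma finite_measure_variations:
  assumes "finite_signed_borel_measure X \<nu>"
  shows "finite_measure (pos_variation X \<nu>)" "finite_measure (neg_variation X \<nu>)"
proof -
  obtain B where B: "\<And>A. A \<in> sets (borel_of X) \<Longrightarrow> \<bar>\<nu> A\<bar> \<le> B"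
    using finite_signed_borel_measure_bounded[OF assms] by blast
  show "finite_measure (pos_variation X \<nu>)" "finite_measure (neg_variation X \<nu>)"
    unfolding neg_variation_def
    by (rule finite_measure_pos_variation[of _ _ B]; use B in fastforce)+
qed

lemma sets_neg_variation [simp]: "sets (neg_variation X \<nu>) = sets (borel_of X)"
  and space_neg_variation [simp]: "space (neg_variation X \<nu>) = topspace X"
  by (simp_all add: neg_variation_def)

text \<open>A positive measure is its own Jordan decomposition: the supremum over
  \<open>B \<subseteq> A\<close> is attained at \<open>A\<close>, and the negated values are
  truncated to 0.\<close>

lemma
  assumes "finite_measure M" "sets M = sets (borel_of X)"
  shows finite_signed_borel_measure_measure: "finite_signed_borel_measure X (measure M)"
    and pos_variation_measure: "pos_variation X (measure M) = M"
    and neg_variation_measure: "neg_variation X (measure M) = null_measure M"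
proof -
  interpret finite_measure M by fact
  have sp: "space M = topspace X"
    using sets_eq_imp_space_eq[OF assms(2)] by simp
  have ss: "sigma_sets (topspace X) (sets (borel_of X)) = sets (borel_of X)"
    by (rule sigma_algebra.sigma_sets_eq[OF sigma_algebra_borel_of])
  have sub: "sets (borel_of X) \<subseteq> Pow (topspace X)"
    using borel_of_subset by blast
  show "finite_signed_borel_measure X (measure M)"
    unfolding finite_signed_borel_measure_def using finite_measure_UNION assms(2) by metis
  have "(SUP B\<in>{B \<in> sets (borel_of X). B \<subseteq> A}. ennreal (measure M B)) = emeasure M A"
    if "A \<in> sets (borel_of X)" for A
    using that assms(2) by (intro antisym SUP_least SUP_upper2[of A])
      (auto simp: emeasure_eq_measure[symmetric] intro!: emeasure_mono)
  then have "pos_variation X (measure M) = measure_of (topspace X) (sets (borel_of X)) (emeasure M)"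
    unfolding pos_variation_def by (intro measure_of_eq[OF sub]) (simp add: ss)
  then show "pos_variation X (measure M) = M"
    using measure_of_of_measure[of M] sp assms(2) by simp
  have "(SUP B\<in>{B \<in> sets (borel_of X). B \<subseteq> A}. ennreal (- measure M B)) = 0" for A
    by (rule SUP_eq_const) (auto simp: ennreal_neg intro: exI[of _ "{}"])
  then have "neg_variation X (measure M) = measure_of (topspace X) (sets (borel_of X)) (\<lambda>A. 0)"
    unfolding neg_variation_def pos_variation_def by simp
  then show "neg_variation X (measure M) = null_measure M"
    using sp assms(2) by (simp add: null_measure_def)
qed

lemma regular_borel_measure_null:
  assumes "sets M = sets (borel_of X)"
  shows "regular_borel_measure X (null_measure M)"
  unfolding regular_borel_measure_def
proof (intro ballI conjI)
  fix A assume "A \<in> sets (borel_of X)"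
  then have "topspace X \<in> {V. openin X V \<and> A \<subseteq> V}" "{} \<in> {K. compactin X K \<and> K \<subseteq> A}"
    using borel_of_subset by auto
  then show "emeasure (null_measure M) A = (INF V\<in>{V. openin X V \<and> A \<subseteq> V}. emeasure (null_measure M) V)"
    "emeasure (null_measure M) A = (SUP K\<in>{K. compactin X K \<and> K \<subseteq> A}. emeasure (null_measure M) K)"
    by (auto simp: SUP_constant INF_constant)
qed

section \<open>Integral representation and uniqueness\<close>

lemma Cc_bounded:
  assumes "f \<in> Cc T"
  obtains B where "0 \<le> B" "\<And>x. \<bar>f x\<bar> \<le> B"
proof -
  have "compactin euclideanreal (f ` fsupp T f)"
    by (rule image_compactin[OF Cc_compact[OF assms] Cc_continuous[OF assms]])
  then have "bounded (f ` fsupp T f)"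
    by (simp add: compact_imp_bounded)
  then obtain B where B: "\<And>x. x \<in> fsupp T f \<Longrightarrow> \<bar>f x\<bar> \<le> B"
    by (auto simp: bounded_iff)
  have "\<bar>f x\<bar> \<le> max B 0" for x
    using B[of x] Cc_fsuppD[OF assms, of x] by (cases "f x = 0") auto
  then show thesis using that[of "max B 0"] by simp
qed

text \<open>The sum telescopes, since its \<open>k\<close>-th term is
  \<open>min h (k + 1) - min h k\<close>.\<close>

lemma sum_layers: "0 \<le> h \<Longrightarrow> (\<Sum>k<n. min 1 (max 0 (h - real k))) = min h (real n)"
  by (induction n) (auto simp: min_def max_def)

lemma archimedean_le:
  assumes "\<And>n::nat. real n * a \<le> real n * b + c"
  shows "a \<le> (b::real)"
proof (rule ccontr)
  assume "\<not> a \<le> b"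
  then obtain n :: nat where "c < real n * (a - b)"
    using ex_less_of_nat_mult[of "a - b" c] by auto
  then show False using assms[of n] by (simp add: algebra_simps)
qed

text \<open>Additivity in the measure is clear for indicators and extends to
  \<open>nn_integral\<close> by induction on measurable functions. Finite measures and a bounded
  \<open>f\<close> keep these integrals finite, which allows the return to real-valued
  integrals.\<close>

lemma integral_add_measures:
  fixes f :: "'a \<Rightarrow> real"
  assumes sets: "sets M = sets N" "sets P = sets N"
    and fin: "finite_measure M" "finite_measure N" "finite_measure P"
    and eq: "\<And>A. A \<in> sets N \<Longrightarrow> emeasure N A = emeasure M A + emeasure P A"
    and f: "f \<in> borel_measurable N" "\<And>x. 0 \<le> f x" "\<And>x. f x \<le> B"
  shows "(\<integral>x. f x \<partial>N) = (\<integral>x. f x \<partial>M) + (\<integral>x. f x \<partial>P)"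
proof -
  have mM [measurable_cong]: "sets M = sets N" and mP [measurable_cong]: "sets P = sets N" using sets by auto
  have nn: "(\<integral>\<^sup>+x. g x \<partial>N) = (\<integral>\<^sup>+x. g x \<partial>M) + (\<integral>\<^sup>+x. g x \<partial>P)" if "g \<in> borel_measurable N" for g
    using that
  proof (induction g rule: borel_measurable_induct)
    case (cong f g)
    have "(\<integral>\<^sup>+x. f x \<partial>Q) = (\<integral>\<^sup>+x. g x \<partial>Q)" if "sets Q = sets N" for Q
      using cong(3) sets_eq_imp_space_eq[OF that] by (intro nn_integral_cong) auto
    then show ?case using cong sets by simp
  next
    case (set A)
    then show ?case using sets eq by simp
  next
    case (mult u c)
    have "u \<in> borel_measurable M" "u \<in> borel_measurable P" using mult by measurable
    then show ?case using mult by (simp add: nn_integral_cmult distrib_left)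
  next
    case (add u v)
    have "u \<in> borel_measurable M" "u \<in> borel_measurable P" "v \<in> borel_measurable M" "v \<in> borel_measurable P"
      using add by measurable
    then show ?case using add by (simp add: nn_integral_add ac_simps)
  next
    case (seq U)
    have m: "U i \<in> borel_measurable M" "U i \<in> borel_measurable P" for i using seq.hyps(1) by measurable
    have inc: "incseq (\<lambda>i. \<integral>\<^sup>+x. U i x \<partial>Q)" for Q
      using seq.hyps(3) by (intro incseq_SucI nn_integral_mono le_funD[OF incseq_SucD[OF seq.hyps(3)]])
    have "(\<integral>\<^sup>+x. (SUP i. U i x) \<partial>N) = (SUP i. \<integral>\<^sup>+x. U i x \<partial>N)"
      by (rule nn_integral_monotone_convergence_SUP[OF seq.hyps(3,1)])
    also have "\<dots> = (SUP i. (\<integral>\<^sup>+x. U i x \<partial>M) + (\<integral>\<^sup>+x. U i x \<partial>P))"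
      using seq.IH by simp
    also have "\<dots> = (SUP i. \<integral>\<^sup>+x. U i x \<partial>M) + (SUP i. \<integral>\<^sup>+x. U i x \<partial>P)"
      by (rule ennreal_SUP_add[OF inc inc])
    also have "\<dots> = (\<integral>\<^sup>+x. (SUP i. U i x) \<partial>M) + (\<integral>\<^sup>+x. (SUP i. U i x) \<partial>P)"
      using nn_integral_monotone_convergence_SUP[OF seq.hyps(3) m(1)]
        nn_integral_monotone_convergence_SUP[OF seq.hyps(3) m(2)] by simp
    finally show ?case by (simp add: image_comp)
  qed
  have m: "f \<in> borel_measurable M" "f \<in> borel_measurable P" using f(1) by measurable
  have top: "(\<integral>\<^sup>+x. f x \<partial>Q) < \<infinity>" if "finite_measure Q" for Q
  proof -
    interpret finite_measure Q by fact
    have "(\<integral>\<^sup>+x. f x \<partial>Q) \<le> (\<integral>\<^sup>+x. ennreal B \<partial>Q)"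
      by (intro nn_integral_mono ennreal_leI f)
    also have "\<dots> < \<infinity>" by (simp add: emeasure_eq_measure flip: ennreal_mult'')
    finally show ?thesis .
  qed
  have "(\<integral>x. f x \<partial>Q) = enn2real (\<integral>\<^sup>+x. f x \<partial>Q)" if "f \<in> borel_measurable Q" for Q
    using that f(2) by (intro integral_eq_nn_integral) auto
  then show ?thesis
    using f(1) m nn[of "\<lambda>x. ennreal (f x)"] top[OF fin(1)] top[OF fin(3)]
    by (simp add: enn2real_plus)
qed

text \<open>Dynkin's argument: the open sets are a generator stable under intersections, and the
  identity survives complements, because the measures are finite, and disjoint countable
  unions.\<close>

lemma emeasure_add_eqI_open:
  assumes sets: "sets M = sets (borel_of X)" "sets N = sets (borel_of X)" "sets P = sets (borel_of X)"
    and fin: "finite_measure M" "finite_measure N" "finite_measure P"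
    and eq: "\<And>V. openin X V \<Longrightarrow> measure N V = measure M V + measure P V"
    and A: "A \<in> sets (borel_of X)"
  shows "emeasure N A = emeasure M A + emeasure P A"
proof -
  interpret M: finite_measure M by fact
  interpret N: finite_measure N by fact
  interpret P: finite_measure P by fact
  have sp: "space M = topspace X" "space N = topspace X" "space P = topspace X"
    using sets_eq_imp_space_eq[OF sets(1)] sets_eq_imp_space_eq[OF sets(2)] sets_eq_imp_space_eq[OF sets(3)] by auto
  have "Int_stable {V. openin X V}" "{V. openin X V} \<subseteq> Pow (topspace X)"
    by (auto simp: Int_stable_def dest: openin_subset)
  moreover have "A \<in> sigma_sets (topspace X) {V. openin X V}" using A by (simp add: sets_borel_of)
  ultimately have "measure N A = measure M A + measure P A"
  proof (induction A rule: sigma_sets_induct_disjoint)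
    case (compl A)
    then have A: "A \<in> sets M" "A \<in> sets N" "A \<in> sets P" using sets by (auto simp: sets_borel_of)
    show ?case
      using compl(2) eq[OF openin_topspace] N.finite_measure_compl[OF A(2)] M.finite_measure_compl[OF A(1)]
        P.finite_measure_compl[OF A(3)] sp by simp
  next
    case (union A)
    then have A: "range A \<subseteq> sets M" "range A \<subseteq> sets N" "range A \<subseteq> sets P" using sets by (auto simp: sets_borel_of)
    have "(\<lambda>i. measure M (A i) + measure P (A i)) sums (measure M (\<Union>i. A i) + measure P (\<Union>i. A i))"
      by (intro sums_add M.finite_measure_UNION P.finite_measure_UNION A union)
    then show ?case
      using N.finite_measure_UNION[OF A(2) union(1)] union(3) sums_unique2 by simp
  qed (use eq in auto)
  then show ?thesis
    by (simp add: M.emeasure_eq_measure N.emeasure_eq_measure P.emeasure_eq_measure flip: ennreal_plus)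
qed

section \<open>The Riesz representation theorem on \<open>U\<close>\<close>

context positive_functional begin

lemma finite_riesz_measure: "finite_measure riesz_measure"
proof
  have "U \<in> sets (borel_of TU)" by (rule openin_borel_of) (simp add: openin_TU open_U)
  then show "emeasure riesz_measure (space riesz_measure) \<noteq> \<infinity>"
    using emeasure_riesz_measure outer_finite[of U] by auto
qed

lemma emeasure_riesz_open: "openin T V \<Longrightarrow> V \<subseteq> U \<Longrightarrow> emeasure riesz_measure V = content V"
  using emeasure_riesz_measure[of V] outer_open openin_borel_of[of TU V] by (simp add: openin_TU)

lemma Hausdorff_TU: "Hausdorff_space TU"
  using Hausdorff by (rule Hausdorff_space_subtopology)

lemma compactin_TU: "compactin TU K \<longleftrightarrow> compactin T K \<and> K \<subseteq> U"
  by (rule compactin_subtopology)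

lemma fsupp_compactin_TU: "f \<in> Cc T \<Longrightarrow> fsupp T f \<subseteq> U \<Longrightarrow> compactin TU (fsupp T f)"
  by (simp add: compactin_TU Cc_compact)

lemma compactin_TU_borel: "compactin TU K \<Longrightarrow> K \<in> sets (borel_of TU)"
  using closedin_borel_of compactin_imp_closedin[OF Hausdorff_TU] by blast

text \<open>Outer regularity is built into \<open>outer\<close>. For open \<open>V\<close>, a
  function \<open>f\<close> in \<open>below V\<close> competes in the content of every open set in
  \<open>U\<close> around its support, so \<open>\<phi> f \<le> outer (fsupp T f)\<close>. Hence the
  compact sets \<open>fsupp T f\<close> already exhaust \<open>content V\<close>.\<close>

lemma regular_riesz_measure: "regular_borel_measure TU riesz_measure"
proof (rule regular_borel_measureI[OF finite_riesz_measure sets_riesz_measure Hausdorff_TU])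
  fix A assume A: "A \<in> sets (borel_of TU)"
  have "{V. openin TU V \<and> A \<subseteq> V} = {V. openin T V \<and> A \<subseteq> V \<and> V \<subseteq> U}"
    by (auto simp: openin_TU)
  then have "(INF V\<in>{V. openin TU V \<and> A \<subseteq> V}. emeasure riesz_measure V) = outer A"
    unfolding outer_def by (auto intro!: INF_cong simp: emeasure_riesz_open)
  then show "emeasure riesz_measure A = (INF V\<in>{V. openin TU V \<and> A \<subseteq> V}. emeasure riesz_measure V)"
    using emeasure_riesz_measure[OF A] by simp
next
  fix V assume "openin TU V"
  then have V: "openin T V" "V \<subseteq> U" and VS: "V \<in> sets (borel_of TU)" by (auto simp: openin_TU openin_borel_of)
  show "emeasure riesz_measure V = (SUP K\<in>{K. compactin TU K \<and> K \<subseteq> V}. emeasure riesz_measure K)"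
  proof (rule antisym)
    show "(SUP K\<in>{K. compactin TU K \<and> K \<subseteq> V}. emeasure riesz_measure K) \<le> emeasure riesz_measure V"
      using VS by (auto intro!: SUP_least emeasure_mono)
    have "ennreal (\<phi> f) \<le> (SUP K\<in>{K. compactin TU K \<and> K \<subseteq> V}. emeasure riesz_measure K)"
      if f: "f \<in> below V" for f
    proof -
      have fC: "f \<in> Cc T" "fsupp T f \<subseteq> V" using f by (auto simp: below_def)
      have cpt: "compactin TU (fsupp T f)" using fC V by (intro fsupp_compactin_TU) auto
      have "ennreal (\<phi> f) \<le> outer (fsupp T f)"
        unfolding outer_def
      proof (rule INF_greatest)
        fix W assume "W \<in> {W. openin T W \<and> fsupp T f \<subseteq> W \<and> W \<subseteq> U}"
        then have "f \<in> below W" using f by (auto simp: below_def)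
        then show "ennreal (\<phi> f) \<le> content W" unfolding content_def by (rule SUP_upper)
      qed
      also have "\<dots> = emeasure riesz_measure (fsupp T f)"
        by (rule emeasure_riesz_measure[symmetric, OF compactin_TU_borel[OF cpt]])
      also have "\<dots> \<le> (SUP K\<in>{K. compactin TU K \<and> K \<subseteq> V}. emeasure riesz_measure K)"
        using cpt fC by (intro SUP_upper) auto
      finally show ?thesis .
    qed
    then show "emeasure riesz_measure V \<le> (SUP K\<in>{K. compactin TU K \<and> K \<subseteq> V}. emeasure riesz_measure K)"
      unfolding emeasure_riesz_open[OF V] content_def by (rule SUP_least)
  qed
qed

lemma Cc_measurable: "f \<in> Cc T \<Longrightarrow> sets M = sets (borel_of TU) \<Longrightarrow> f \<in> borel_measurable M"
  by (rule continuous_map_borel_measurable[of TU]) (auto intro: continuous_map_from_subtopology Cc_continuous)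

lemma Cc_integrable:
  assumes "f \<in> Cc T" "sets M = sets (borel_of TU)" "finite_measure M"
  shows "integrable M f"
proof -
  interpret finite_measure M by fact
  obtain B where "\<And>x. \<bar>f x\<bar> \<le> B" using Cc_bounded[OF assms(1)] by blast
  then show ?thesis by (intro integrable_const_bound[of _ B] Cc_measurable assms) auto
qed

lemma below_D:
  assumes "g \<in> below V"
  shows "g \<in> Cc T" "\<And>x. 0 \<le> g x" "\<And>x. g x \<le> 1" "fsupp T g \<subseteq> V" "x \<notin> V \<Longrightarrow> g x = 0"
  using assms Cc_fsuppD[of g T x] by (auto simp: below_def)

lemma integral_below_le:
  assumes "sets M = sets (borel_of TU)" "finite_measure M" "g \<in> below V" "openin T V" "V \<subseteq> U"
  shows "(\<integral>x. g x \<partial>M) \<le> measure M V"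
proof -
  interpret finite_measure M by fact
  note g = below_D[OF assms(3)]
  have V: "V \<in> sets M" using assms openin_borel_of[of TU V] by (simp add: openin_TU)
  have "(\<integral>x. g x \<partial>M) \<le> (\<integral>x. indicator V x \<partial>M)"
  proof (rule integral_mono)
    show "g x \<le> indicator V x" for x using g(3,5)[of x] by (auto simp: indicator_def)
  qed (use V g Cc_integrable assms in \<open>auto simp: integrable_real_indicator emeasure_eq_measure\<close>)
  also have "\<dots> = measure M V" using V sets.sets_into_space[OF V] by (simp add: Int_absorb2)
  finally show ?thesis .
qed

lemma integral_ge_measure:
  assumes "sets M = sets (borel_of TU)" "finite_measure M" "g \<in> below U" "A \<in> sets M" "\<And>x. x \<in> A \<Longrightarrow> g x = 1"
  shows "measure M A \<le> (\<integral>x. g x \<partial>M)"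
proof -
  interpret finite_measure M by fact
  note g = below_D[OF assms(3)]
  have "measure M A = (\<integral>x. indicator A x \<partial>M)" using assms(4) sets.sets_into_space[OF assms(4)] by (simp add: Int_absorb2)
  also have "\<dots> \<le> (\<integral>x. g x \<partial>M)"
  proof (rule integral_mono)
    show "indicator A x \<le> g x" for x using g(2)[of x] assms(5)[of x] by (auto simp: indicator_def)
  qed (use assms g Cc_integrable in \<open>auto simp: integrable_real_indicator emeasure_eq_measure\<close>)
  finally show ?thesis .
qed

text \<open>
  Cut \<open>H\<close> into layers of height 1. On each layer both functionals lie between the measures of
  neighbouring level sets, so the values at \<open>H\<close> differ by a bound that does not depend on \<open>H\<close>;
  rescaling \<open>H\<close> then forces equality.
\<close>

lemma layer_comparison:
  fixes m :: "'a set \<Rightarrow> real"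
  assumes sum1: "\<And>g n. (\<And>k. k < n \<Longrightarrow> g k \<in> Cc T) \<Longrightarrow> F1 (\<Sum>k<n. g k) = (\<Sum>k<(n::nat). F1 (g k))"
    and sum2: "\<And>g n. (\<And>k. k < n \<Longrightarrow> g k \<in> Cc T) \<Longrightarrow> F2 (\<Sum>k<n. g k) = (\<Sum>k<(n::nat). F2 (g k))"
    and upper: "\<And>g V. g \<in> below V \<Longrightarrow> openin T V \<Longrightarrow> V \<subseteq> U \<Longrightarrow> F1 g \<le> m V"
    and lower: "\<And>g V. g \<in> below U \<Longrightarrow> openin T V \<Longrightarrow> V \<subseteq> U \<Longrightarrow> (\<And>x. x \<in> V \<Longrightarrow> g x = 1) \<Longrightarrow> m V \<le> F2 g"
    and m: "\<And>V. V \<subseteq> U \<Longrightarrow> m V \<le> m U" "\<And>V. 0 \<le> m V"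
    and H: "H \<in> Cc T" "\<And>x. 0 \<le> H x" "fsupp T H \<subseteq> U"
  shows "F1 H \<le> F2 H + 2 * m U"
proof -
  obtain B where B: "\<And>x. \<bar>H x\<bar> \<le> B" using Cc_bounded[OF H(1)] by blast
  obtain n where n: "B \<le> real n" using real_arch_simple by blast
  define g where "g k = (\<lambda>x. min 1 (max 0 (H x - real k)))" for k
  define V where "V k = {x \<in> topspace T. H x \<in> {real k <..}}" for k
  have gC: "g k \<in> Cc T" "fsupp T (g k) \<subseteq> U" for k
    using Cc_dominated[OF H(1), of "g k"] H(3) Cc_continuous[OF H(1)]
    by (force simp: g_def intro!: continuous_intros)+
  have gU: "g k \<in> below U" for k using gC by (auto simp: below_def g_def)
  have Hsum: "H = (\<Sum>k<n. g k)"
  proof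
    fix x
    have "H x \<le> real n" using B[of x] n by linarith
    then show "H x = (\<Sum>k<n. g k) x"
      unfolding sum_fun_apply using sum_layers[of "H x" n] H(2)[of x] by (simp add: g_def)
  qed
  have Vop: "openin T (V k)" for k
    unfolding V_def by (rule openin_continuous_map_preimage[OF Cc_continuous[OF H(1)]]) simp
  have VU: "V k \<subseteq> U" for k
    using H(3) Cc_fsuppD[OF H(1)] by (force simp: V_def)
  have low: "m (V (Suc k)) \<le> F2 (g k)" for k
    by (rule lower[OF gU Vop VU]) (auto simp: V_def g_def)
  \<comment> \<open>The layer \<open>g (Suc k)\<close> is non-zero only where
    \<open>H > k + 1\<close>. Its support may also contain points with \<open>H = k + 1\<close>, so
    it is compared with the larger open set \<open>V k\<close>; this shifts the index by one against
    \<open>low\<close>.\<close>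
  have up: "F1 (g (Suc k)) \<le> m (V k)" for k
  proof (rule upper[OF _ Vop VU])
    have "closedin T {x \<in> topspace T. H x \<in> {real (Suc k)..}}"
      by (rule closedin_continuous_map_preimage[OF Cc_continuous[OF H(1)]]) simp
    then have "fsupp T (g (Suc k)) \<subseteq> {x \<in> topspace T. H x \<in> {real (Suc k)..}}"
      by (rule fsupp_minimal) (auto simp: g_def)
    also have "\<dots> \<subseteq> V k" by (auto simp: V_def)
    finally show "g (Suc k) \<in> below (V k)" using gU by (auto simp: below_def)
  qed
  have F2nn: "0 \<le> F2 (g k)" for k using low[of k] m(2)[of "V (Suc k)"] by linarith
  show ?thesis
  proof (cases n)
    case 0
    then show ?thesis using Hsum sum1[of 0] sum2[of 0] m(2)[of U] by simp
  next
    case (Suc p)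
    have "F1 H = (\<Sum>k<Suc p. F1 (g k))" unfolding Hsum Suc by (rule sum1) (rule gC)
    also have "\<dots> = F1 (g 0) + (\<Sum>k<p. F1 (g (Suc k)))" by (rule sum.lessThan_Suc_shift)
    \<comment> \<open>The two index shifts leave one boundary term each, \<open>F1 (g 0)\<close>
      here and \<open>m (V 0)\<close> below. Both are at most \<open>m U\<close>, whence the
      constant \<open>2 * m U\<close>.\<close>
    also have "\<dots> \<le> m U + (\<Sum>k<p. m (V k))"
      by (intro add_mono sum_mono up upper[OF gU open_U]) auto
    also have "(\<Sum>k<p. m (V k)) \<le> (\<Sum>k<Suc p. m (V k))" using m(2) by simp
    also have "\<dots> = m (V 0) + (\<Sum>k<p. m (V (Suc k)))" by (rule sum.lessThan_Suc_shift)
    also have "\<dots> \<le> m U + (\<Sum>k<p. F2 (g k))"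
      by (intro add_mono sum_mono low m VU)
    also have "(\<Sum>k<p. F2 (g k)) \<le> (\<Sum>k<n. F2 (g k))" using F2nn Suc by simp
    also have "\<dots> = F2 H" unfolding Hsum by (rule sum2[symmetric]) (rule gC)
    finally show ?thesis by simp
  qed
qed

lemma riesz_representation_nonneg:
  assumes H: "H \<in> Cc T" "\<And>x. 0 \<le> H x" "fsupp T H \<subseteq> U"
  shows "\<phi> H = (\<integral>x. H x \<partial>riesz_measure)"
proof -
  interpret M: finite_measure riesz_measure by (rule finite_riesz_measure)
  let ?I = "\<lambda>f. \<integral>x. f x \<partial>riesz_measure"
  let ?m = "measure riesz_measure"
  have int: "f \<in> Cc T \<Longrightarrow> integrable riesz_measure f" for f
    by (rule Cc_integrable[OF _ sets_riesz_measure finite_riesz_measure])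
  have sum1: "\<phi> (\<Sum>k<n. g k) = (\<Sum>k<(n::nat). \<phi> (g k))" if "\<And>k. k < n \<Longrightarrow> g k \<in> Cc T" for g n
    using order_dual_sum[OF order_dual, of "{..<n}" g] that by simp
  have sum2: "?I (\<Sum>k<n. g k) = (\<Sum>k<(n::nat). ?I (g k))" if "\<And>k. k < n \<Longrightarrow> g k \<in> Cc T" for g n
    using that int by (simp add: sum_fun_apply)
  have upper1: "\<phi> g \<le> ?m V" if "g \<in> below V" "openin T V" "V \<subseteq> U" for g V
  proof -
    have "ennreal (\<phi> g) \<le> ennreal (?m V)"
      using that(1) emeasure_riesz_open[OF that(2,3)] unfolding content_def M.emeasure_eq_measure
      by (metis SUP_upper)
    then show ?thesis by simp
  qed
  have lower1: "?m V \<le> \<phi> g" if "g \<in> below U" "openin T V" "V \<subseteq> U" "\<And>x. x \<in> V \<Longrightarrow> g x = 1" for g V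
  proof -
    note g = below_D[OF that(1)] and one = that(4)
    have "\<phi> f \<le> \<phi> g" if f: "f \<in> below V" for f
    proof (rule mono)
      show "f x \<le> g x" for x
        using below_D(3,5)[OF f, of x] g(2)[of x] one[of x] by (cases "x \<in> V") auto
    qed (use below_D(1)[OF f] g(1) in auto)
    then have "content V \<le> ennreal (\<phi> g)"
      unfolding content_def by (auto intro!: SUP_least ennreal_leI)
    then have "ennreal (?m V) \<le> ennreal (\<phi> g)"
      using emeasure_riesz_open[OF that(2,3)] by (simp add: M.emeasure_eq_measure)
    then show ?thesis using nonneg[OF g(1,2)] by simp
  qed
  have upper2: "?I g \<le> ?m V" if "g \<in> below V" "openin T V" "V \<subseteq> U" for g V
    by (rule integral_below_le[OF sets_riesz_measure finite_riesz_measure that])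
  have lower2: "?m V \<le> ?I g" if "g \<in> below U" "openin T V" "V \<subseteq> U" "\<And>x. x \<in> V \<Longrightarrow> g x = 1" for g V
    by (rule integral_ge_measure[OF sets_riesz_measure finite_riesz_measure that(1) _ that(4)])
      (use that openin_TU openin_borel_of[of TU V] in auto)
  have mU: "?m V \<le> ?m U" for V
    using M.bounded_measure[of V] by simp
  have H': "real n *\<^sub>R H \<in> Cc T" "\<And>x. 0 \<le> (real n *\<^sub>R H) x" "fsupp T (real n *\<^sub>R H) \<subseteq> U" for n
    using H Cc_scale[OF H(1)] fsupp_combine[of H H "real n *\<^sub>R H" T] by (auto simp: scaleR_fun_def)
  have sc: "?I (real n *\<^sub>R H) = real n * ?I H" "\<phi> (real n *\<^sub>R H) = real n * \<phi> H" for n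
    by (simp add: scaleR_fun_def, rule order_dual_scale[OF order_dual H(1)])
  \<comment> \<open>The error \<open>2 * ?m U\<close> is the same for all multiples
    \<open>real n *\<^sub>R H\<close>. The comparison is made with \<open>\<phi>\<close> and
    \<open>?I\<close> in either role, one for each inequality.\<close>
  note cmp = layer_comparison[where m = ?m, OF _ _ _ _ mU measure_nonneg H']
  show ?thesis
  proof (rule antisym)
    show "\<phi> H \<le> ?I H"
    proof (rule archimedean_le)
      show "real n * \<phi> H \<le> real n * ?I H + 2 * ?m U" for n
        unfolding sc[symmetric] by (rule cmp[of \<phi> ?I, OF sum1 sum2 upper1 lower2])
    qed
    show "?I H \<le> \<phi> H"
    proof (rule archimedean_le)
      show "real n * ?I H \<le> real n * \<phi> H + 2 * ?m U" for n
        unfolding sc[symmetric] by (rule cmp[of ?I \<phi>, OF sum2 sum1 upper2 lower1])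
    qed
  qed
qed

lemma riesz_representation:
  assumes H: "H \<in> Cc T" "fsupp T H \<subseteq> U"
  shows "\<phi> H = (\<integral>x. H x \<partial>riesz_measure)"
proof -
  have int: "f \<in> Cc T \<Longrightarrow> integrable riesz_measure f" for f
    by (rule Cc_integrable[OF _ sets_riesz_measure finite_riesz_measure])
  note P = Cc_pos_part[OF H(1)]
  have "\<phi> H = \<phi> (\<lambda>x. max (H x) 0) - \<phi> (\<lambda>x. max (- H x) 0)"
    by (rule order_dual_pos_part[OF order_dual H(1)])
  also have "\<dots> = (\<integral>x. max (H x) 0 \<partial>riesz_measure) - (\<integral>x. max (- H x) 0 \<partial>riesz_measure)"
    using P H by (intro arg_cong2[of _ _ _ _ "(-)"] riesz_representation_nonneg) auto
  also have "\<dots> = (\<integral>x. max (H x) 0 - max (- H x) 0 \<partial>riesz_measure)"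
    by (rule Bochner_Integration.integral_diff[symmetric]) (intro int P)+
  also have "\<dots> = (\<integral>x. H x \<partial>riesz_measure)"
    by (rule Bochner_Integration.integral_cong) auto
  finally show ?thesis .
qed

text \<open>Existence of a representing measure is what gives meaning to the choice in
  \<open>representing_measure\<close>.\<close>

lemma represents_on_riesz: "represents_on T \<phi> U (measure riesz_measure)"
proof -
  note v = pos_variation_measure[OF finite_riesz_measure sets_riesz_measure]
    neg_variation_measure[OF finite_riesz_measure sets_riesz_measure]
  show ?thesis
    unfolding represents_on_def regular_signed_borel_measure_def signed_integral_def v
    using finite_signed_borel_measure_measure[OF finite_riesz_measure sets_riesz_measure]
      regular_riesz_measure regular_borel_measure_null[OF sets_riesz_measure] riesz_representation
    by simp
qed

lemma represents_on_representing_measure: "represents_on T \<phi> U (representing_measure T \<phi> U)"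
  unfolding representing_measure_def
  by (rule someI[of "represents_on T \<phi> U"]) (rule represents_on_riesz)

text \<open>
  It is not shown that the negative variation of a representing measure \<open>\<nu>\<close> vanishes, which would
  require a Hahn decomposition; \<open>\<nu>\<^sup>+ = \<nu>\<^sup>- + \<mu>\<close> with the Riesz measure \<open>\<mu>\<close> is enough.
\<close>

lemma represents_on_measure_open:
  assumes r: "represents_on T \<phi> U \<nu>" and V: "openin T V" "V \<subseteq> U"
  shows "measure (pos_variation TU \<nu>) V = measure (neg_variation TU \<nu>) V + measure riesz_measure V"
proof -
  let ?P = "pos_variation TU \<nu>" and ?N = "neg_variation TU \<nu>"
  have fs: "finite_signed_borel_measure TU \<nu>" and reg: "regular_borel_measure TU ?P" "regular_borel_measure TU ?N"
    using r by (auto simp: represents_on_def regular_signed_borel_measure_def)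
  note fin = finite_measure_variations[OF fs] finite_riesz_measure
  have VT: "openin TU V" using V by (simp add: openin_TU)
  have approx: "\<exists>K. compactin TU K \<and> K \<subseteq> V \<and> measure M V < measure M K + e"
    if "finite_measure M" "sets M = sets (borel_of TU)" "regular_borel_measure TU M" "0 < e" for M and e :: real
  proof -
    have "space M = topspace TU" using sets_eq_imp_space_eq[OF that(2)] by simp
    moreover have "emeasure M V = (SUP K\<in>{K. compactin TU K \<and> K \<subseteq> V}. emeasure M K)"
      using that(3) openin_borel_of[OF VT] unfolding regular_borel_measure_def by blast
    ultimately show ?thesis
      using finite_measure_approx_compact[OF that(1) _ that(2) Hausdorff_TU VT _ that(4)] by metis
  qed
  have test: "\<exists>g. g \<in> below V \<and> (\<forall>x\<in>K. g x = 1)" if K: "compactin TU K" "K \<subseteq> V" for K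
  proof -
    have "compactin T K" using K by (simp add: compactin_TU)
    from Urysohn_Cc[OF this V(1) K(2)] show ?thesis unfolding below_def by (smt (verit) mem_Collect_eq subsetD)
  qed
  have rep: "(\<integral>x. g x \<partial>?P) = (\<integral>x. g x \<partial>?N) + (\<integral>x. g x \<partial>riesz_measure)" if "g \<in> below V" for g
  proof -
    have g: "g \<in> Cc T" "fsupp T g \<subseteq> U" using that V by (auto simp: below_def)
    then have "\<phi> g = signed_integral TU \<nu> g" using r by (auto simp: represents_on_def)
    then show ?thesis using riesz_representation[OF g] by (simp add: signed_integral_def)
  qed
  have belowU: "g \<in> below U" if "g \<in> below V" for g using that V by (auto simp: below_def)
  have upper: "(\<integral>x. g x \<partial>M) \<le> measure M V" if "g \<in> below V" "M \<in> {?P, ?N, riesz_measure}" for g M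
    using that fin by (intro integral_below_le V) auto
  have lower: "measure M K \<le> (\<integral>x. g x \<partial>M)"
    if "g \<in> below V" "compactin TU K" "\<And>x. x \<in> K \<Longrightarrow> g x = 1" "M \<in> {?P, ?N, riesz_measure}" for g M K
    using that fin by (intro integral_ge_measure belowU) (auto simp: compactin_TU_borel)
  show ?thesis
  proof (rule antisym)
    show "measure ?P V \<le> measure ?N V + measure riesz_measure V"
    proof (rule field_le_epsilon)
      fix e :: real assume "0 < e"
      then obtain K where K: "compactin TU K" "K \<subseteq> V" "measure ?P V < measure ?P K + e"
        using approx[OF fin(1) _ reg(1)] by auto
      obtain g where g: "g \<in> below V" "\<forall>x\<in>K. g x = 1" using test[OF K(1,2)] by blast
      show "measure ?P V \<le> measure ?N V + measure riesz_measure V + e"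
        using K(3) lower[OF g(1) K(1), of ?P] g(2) rep[OF g(1)] upper[OF g(1), of ?N] upper[OF g(1), of riesz_measure] by simp
    qed
    show "measure ?N V + measure riesz_measure V \<le> measure ?P V"
    proof (rule field_le_epsilon)
      fix e :: real assume e: "0 < e"
      obtain K1 where K1: "compactin TU K1" "K1 \<subseteq> V" "measure ?N V < measure ?N K1 + e/2"
        using approx[OF fin(2) _ reg(2), of "e/2"] e by auto
      obtain K2 where K2: "compactin TU K2" "K2 \<subseteq> V" "measure riesz_measure V < measure riesz_measure K2 + e/2"
        using approx[OF fin(3) _ regular_riesz_measure, of "e/2"] e by auto
      \<comment> \<open>A single test function has to bound both measures from below, so it is made
        equal to 1 on the union of the two compact sets.\<close>
      have "compactin TU (K1 \<union> K2)" "K1 \<union> K2 \<subseteq> V" using K1 K2 by (auto intro: compactin_Un)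
      then obtain g where g: "g \<in> below V" "\<forall>x\<in>K1 \<union> K2. g x = 1" using test by blast
      show "measure ?N V + measure riesz_measure V \<le> measure ?P V + e"
        using K1(3) K2(3) lower[OF g(1) K1(1), of ?N] lower[OF g(1) K2(1), of riesz_measure] g(2) rep[OF g(1)]
          upper[OF g(1), of ?P] by simp
    qed
  qed
qed

text \<open>The variations of \<nu> differ by the Riesz measure on open sets, hence on all Borel
  sets and under the integral. Thus the chosen signed measure may be replaced by a positive measure,
  which makes positivity and additivity of \<open>borel_multiple\<close> accessible.\<close>

lemma signed_integral_eq_riesz:
  assumes r: "represents_on T \<phi> U \<nu>"
    and f: "f \<in> borel_measurable (borel_of TU)" "\<And>x. 0 \<le> f x" "\<And>x. f x \<le> B"
  shows "signed_integral TU \<nu> f = (\<integral>x. f x \<partial>riesz_measure)"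
proof -
  let ?P = "pos_variation TU \<nu>" and ?N = "neg_variation TU \<nu>"
  have fs: "finite_signed_borel_measure TU \<nu>"
    using r by (auto simp: represents_on_def regular_signed_borel_measure_def)
  note fin = finite_measure_variations[OF fs] finite_riesz_measure
  have "(\<integral>x. f x \<partial>?P) = (\<integral>x. f x \<partial>?N) + (\<integral>x. f x \<partial>riesz_measure)"
  proof (rule integral_add_measures[OF _ _ fin(2,1,3) _ _ f(2,3)])
    show "emeasure ?P A = emeasure ?N A + emeasure riesz_measure A" if "A \<in> sets ?P" for A
      using that by (intro emeasure_add_eqI_open[OF _ _ _ fin(2,1,3)] represents_on_measure_open[OF r]) (auto simp: openin_TU)
    show "f \<in> borel_measurable ?P"
      unfolding measurable_cong_sets[OF sets_pos_variation refl] by (rule f(1))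
  qed auto
  then show ?thesis by (simp add: signed_integral_def)
qed

end

section \<open>Products of a functional with characteristic functions\<close>

context locally_compact_Hausdorff begin

lemma positive_functionalI:
  assumes "\<phi> \<in> order_dual T" "dual_le T 0 \<phi>" "relatively_compact_nhd T K U"
  shows "positive_functional T \<phi> U"
proof
  show "0 \<le> \<phi> f" if "f \<in> Cc T" "\<And>x. 0 \<le> f x" for f
    using assms(2) that by (auto simp: dual_le_def le_fun_def)
qed (use assms in \<open>auto simp: relatively_compact_nhd_def\<close>)

text \<open>The neighbourhood chosen in \<open>borel_multiple\<close> depends on \<open>f\<close>
  and not on \<open>A\<close>, so one finite measure \<open>M\<close> serves all \<open>A\<close> at
  once. It does not charge the complement of \<open>dsupp T y\<close>, because \<open>y\<close>
  vanishes on every function supported there.\<close>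

lemma borel_multiple_integral:
  assumes y: "y \<in> order_dual T" "dual_le T 0 y" and f: "f \<in> Cc T" "\<And>x. 0 \<le> f x" and T: "topspace T \<noteq> {}"
  obtains M where "finite_measure M" "f \<in> borel_measurable M" "y f = (\<integral>x. f x \<partial>M)"
    "\<And>A. A \<in> sets (borel_of T) \<Longrightarrow> (indicator A :: 'a \<Rightarrow> real) \<in> borel_measurable M"
    "\<And>A. A \<in> sets (borel_of T) \<Longrightarrow> borel_multiple T (indicator A) y f = (\<integral>x. f x * indicator A x \<partial>M)"
    "AE x in M. x \<in> dsupp T y"
proof -
  define U where "U = (SOME U. relatively_compact_nhd T (fsupp T f) U)"
  have U: "relatively_compact_nhd T (fsupp T f) U"
    unfolding U_def by (rule someI_ex[OF relatively_compact_nhd_ex[OF Cc_compact[OF f(1)] T]])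
  then have fU: "fsupp T f \<subseteq> U" by (simp add: relatively_compact_nhd_def)
  interpret positive_functional T y U by (rule positive_functionalI[OF y U])
  have ind: "(indicator A :: 'a \<Rightarrow> real) \<in> borel_measurable (borel_of TU)" if "A \<in> sets (borel_of T)" for A
  proof -
    have "{x \<in> space (borel_of TU). x \<in> A} = U \<inter> A"
      using topspace_Int_U by auto
    then show ?thesis
      using sets_borel_of_subtopology[OF that, of U]
      by (intro borel_measurable_indicator'[where f = "\<lambda>x. x"]) simp
  qed
  have eqs: "borel_measurable riesz_measure = borel_measurable (borel_of TU)"
    by (rule measurable_cong_sets[OF sets_riesz_measure refl])
  have fm: "f \<in> borel_measurable (borel_of TU)" by (rule Cc_measurable[OF f(1) refl])
  show thesis
  proof (rule that[OF finite_riesz_measure])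
    show "f \<in> borel_measurable riesz_measure" unfolding eqs by (rule fm)
    show "y f = (\<integral>x. f x \<partial>riesz_measure)" by (rule riesz_representation[OF f(1) fU])
    show "(indicator A :: 'a \<Rightarrow> real) \<in> borel_measurable riesz_measure" if "A \<in> sets (borel_of T)" for A
      unfolding eqs by (rule ind[OF that])
    show "borel_multiple T (indicator A) y f = (\<integral>x. f x * indicator A x \<partial>riesz_measure)"
      if "A \<in> sets (borel_of T)" for A
    proof -
      obtain B where B: "0 \<le> B" "\<And>x. \<bar>f x\<bar> \<le> B" using Cc_bounded[OF f(1)] by blast
      have "f x * indicator A x \<le> B" for x
        using B(1) B(2)[of x] by (auto simp: indicator_def)
      then have "signed_integral TU (representing_measure T y U) (\<lambda>x. f x * indicator A x) = (\<integral>x. f x * indicator A x \<partial>riesz_measure)"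
        using f(2) by (intro signed_integral_eq_riesz[OF represents_on_representing_measure]
            borel_measurable_times fm ind that) auto
      then show ?thesis
        using f(1) by (simp add: borel_multiple_def Let_def U_def)
    qed
    have "openin T (U - dsupp T y)" using open_U closedin_dsupp by (rule openin_diff)
    moreover have "content (U - dsupp T y) = 0"
    proof -
      have "y g = 0" if "g \<in> below (U - dsupp T y)" for g
        using that by (intro vanishes_off_dsupp[OF y(1)]) (auto simp: below_def)
      then show ?thesis
        unfolding content_def using zero_below[of "U - dsupp T y"] by (intro SUP_eq_const) force+
    qed
    ultimately have "U - dsupp T y \<in> null_sets riesz_measure"
      using emeasure_riesz_open[of "U - dsupp T y"] openin_borel_of[of TU "U - dsupp T y"]
      by (intro null_setsI) (auto simp: openin_TU)
    then show "AE x in riesz_measure. x \<in> dsupp T y"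
      by (rule AE_I') auto
  qed
qed

lemma borel_multiple_nonneg:
  assumes "y \<in> order_dual T" "dual_le T 0 y" "topspace T \<noteq> {}" "A \<in> sets (borel_of T)"
  shows "dual_le T 0 (borel_multiple T (indicator A) y)"
  unfolding dual_le_def
proof (intro ballI impI)
  fix f :: "'a \<Rightarrow> real" assume f: "f \<in> Cc T" "0 \<le> f"
  then have f0: "0 \<le> f x" for x by (simp add: le_fun_def)
  show "(0 :: ('a \<Rightarrow> real) \<Rightarrow> real) f \<le> borel_multiple T (indicator A) y f"
  proof (rule borel_multiple_integral[OF assms(1,2) f(1) f0 assms(3)])
    fix M
    assume "\<And>A. A \<in> sets (borel_of T) \<Longrightarrow> borel_multiple T (indicator A) y f = (\<integral>x. f x * indicator A x \<partial>M)"
    then show ?thesis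
      using assms(4) f0 by (simp add: integral_nonneg_AE)
  qed
qed

lemma dsupp_borel_multiple: "dsupp T (borel_multiple T (indicator A) y) \<subseteq> T closure_of A"
proof -
  let ?W = "topspace T - T closure_of A"
  have "borel_multiple T (indicator A) y f = 0" if f: "f \<in> Cc T" "fsupp T f \<subseteq> ?W" for f
  proof -
    have "f x * indicator A x = 0" for x :: 'a
    proof (cases "f x = 0")
      case False
      then have "x \<in> ?W" using f(2) Cc_fsuppD[OF f(1)] by auto
      then show ?thesis using closure_of_subset_Int[of T A] by (auto simp: indicator_def)
    qed simp
    then have "(\<lambda>x. f x * indicator A x) = (\<lambda>x. 0)" by blast
    then show ?thesis by (simp only: borel_multiple_def Let_def signed_integral_def) simp
  qed
  then have "vanishes_on T (borel_multiple T (indicator A) y) ?W"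
    by (simp add: vanishes_on_def)
  moreover have "openin T ?W" by auto
  ultimately show ?thesis unfolding dsupp_def by blast
qed

text \<open>For \<open>f \<ge> 0\<close> the indicators of the \<open>A i\<close> add up to 1 almost
  everywhere, since the measure is concentrated on \<open>dsupp T y\<close>. The assumption
  \<open>od\<close> supplies the linearity that carries the identity over to all \<open>f\<close>;
  in the application it comes from \<chi>-multiples of \<open>y\<close> belonging to
  \<open>Y\<close>.\<close>

lemma borel_multiple_partition:
  assumes y: "y \<in> order_dual T" "dual_le T 0 y" and T: "topspace T \<noteq> {}"
    and A: "\<And>i. i < n \<Longrightarrow> A i \<in> sets (borel_of T)" "disjoint_family_on A {..<n}" "dsupp T y \<subseteq> (\<Union>i<(n::nat). A i)"
    and od: "\<And>i. i < n \<Longrightarrow> borel_multiple T (indicator (A i)) y \<in> order_dual T"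
  shows "y = (\<Sum>i<n. borel_multiple T (indicator (A i)) y)"
proof
  fix f
  have pos: "y f = (\<Sum>i<n. borel_multiple T (indicator (A i)) y f)" if f: "f \<in> Cc T" "\<And>x. 0 \<le> f x" for f
  proof -
    show ?thesis
    proof (rule borel_multiple_integral[OF y f T])
      fix M
      assume M: "finite_measure M" "f \<in> borel_measurable M" "y f = (\<integral>x. f x \<partial>M)"
        "\<And>A. A \<in> sets (borel_of T) \<Longrightarrow> (indicator A :: 'a \<Rightarrow> real) \<in> borel_measurable M"
        "\<And>A. A \<in> sets (borel_of T) \<Longrightarrow> borel_multiple T (indicator A) y f = (\<integral>x. f x * indicator A x \<partial>M)"
        "AE x in M. x \<in> dsupp T y"
      interpret finite_measure M by fact
      obtain B where B: "0 \<le> B" "\<And>x. \<bar>f x\<bar> \<le> B" using Cc_bounded[OF f(1)] by blast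
      have int: "integrable M (\<lambda>x. f x * indicator (A i) x)" if "i < n" for i
      proof (rule integrable_const_bound[of _ B])
        show "(\<lambda>x. f x * indicator (A i) x) \<in> borel_measurable M"
          by (rule borel_measurable_times[OF M(2) M(4)[OF A(1)[OF that]]])
        have "\<bar>f x * indicator (A i) x\<bar> \<le> B" for x
          using B(1) B(2)[of x] by (cases "x \<in> A i") simp_all
        then show "AE x in M. norm (f x * indicator (A i) x) \<le> B" by simp
      qed
      have "y f = (\<integral>x. (\<Sum>i<n. f x * indicator (A i) x) \<partial>M)"
        unfolding M(3)
      proof (rule integral_cong_AE)
        show "f \<in> borel_measurable M" "(\<lambda>x. \<Sum>i<n. f x * indicator (A i) x) \<in> borel_measurable M"
          by (rule M(2), rule borel_measurable_sum, rule borel_measurable_integrable, rule int, simp)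
        show "AE x in M. f x = (\<Sum>i<n. f x * indicator (A i) x)"
          using M(6)
        proof eventually_elim
          case (elim x)
          then obtain i where i: "i < n" "x \<in> A i" using A(3) by auto
          have "f x * indicator (A j) x = (if j = i then f x else 0)" if "j < n" for j
            using i that A(2) by (auto simp: indicator_def disjoint_family_on_def)
          then show ?case using i by (simp add: sum.delta)
        qed
      qed
      also have "\<dots> = (\<Sum>i<n. \<integral>x. f x * indicator (A i) x \<partial>M)"
        using int by (intro Bochner_Integration.integral_sum) auto
      also have "\<dots> = (\<Sum>i<n. borel_multiple T (indicator (A i)) y f)"
        using M(5) A(1) by simp
      finally show ?thesis .
    qed
  qed
  show "y f = (\<Sum>i<n. borel_multiple T (indicator (A i)) y) f"
  proof (cases "f \<in> Cc T")
    case True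
    note P = Cc_pos_part[OF True]
    have "y f = y (\<lambda>x. max (f x) 0) - y (\<lambda>x. max (- f x) 0)"
      by (rule order_dual_pos_part[OF y(1) True])
    also have "\<dots> = (\<Sum>i<n. borel_multiple T (indicator (A i)) y (\<lambda>x. max (f x) 0) - borel_multiple T (indicator (A i)) y (\<lambda>x. max (- f x) 0))"
      using pos[OF P(1)] pos[OF P(3)] by (simp add: sum_subtractf)
    also have "\<dots> = (\<Sum>i<n. borel_multiple T (indicator (A i)) y f)"
      by (rule sum.cong[OF refl], rule order_dual_pos_part[OF od True, symmetric]) simp
    finally show ?thesis by (simp add: sum_fun_apply)
  next
    case False
    then show ?thesis using order_dual_outside[OF y(1)] by (simp add: sum_fun_apply borel_multiple_def)
  qed
qed

end

section \<open>The Riesz-Kantorovich formula\<close>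

text \<open>The formula for \<open>\<phi>\<^sup>+\<close> at a function \<open>f \<ge> 0\<close>. It
  proves existence of the positive part and also lets its support be compared with that of
  \<phi>.\<close>

definition dual_pos_cone :: "'a topology \<Rightarrow> (('a \<Rightarrow> real) \<Rightarrow> real) \<Rightarrow> ('a \<Rightarrow> real) \<Rightarrow> real" where
  "dual_pos_cone T \<phi> f = (SUP g\<in>{g \<in> Cc T. 0 \<le> g \<and> g \<le> f}. \<phi> g)"

definition dual_pos :: "'a topology \<Rightarrow> (('a \<Rightarrow> real) \<Rightarrow> real) \<Rightarrow> ('a \<Rightarrow> real) \<Rightarrow> real" where
  "dual_pos T \<phi> f = (if f \<in> Cc T
     then dual_pos_cone T \<phi> (\<lambda>x. max (f x) 0) - dual_pos_cone T \<phi> (\<lambda>x. max (- f x) 0) else 0)"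

context
  fixes T :: "'a topology" and \<phi>
  assumes \<phi>: "\<phi> \<in> order_dual T"
begin

lemma dual_pos_cone_upper:
  assumes "f \<in> Cc T" "g \<in> Cc T" "0 \<le> g" "g \<le> f"
  shows "\<phi> g \<le> dual_pos_cone T \<phi> f"
proof -
  have "bounded (\<phi> ` {g \<in> Cc T. 0 \<le> g \<and> g \<le> f})"
    using \<phi> assms(1) by (auto simp: order_dual_def)
  then show ?thesis
    unfolding dual_pos_cone_def using assms
    by (intro cSUP_upper bounded_imp_bdd_above) auto
qed

lemma dual_pos_cone_least:
  assumes "0 \<le> f" "\<And>g. g \<in> Cc T \<Longrightarrow> 0 \<le> g \<Longrightarrow> g \<le> f \<Longrightarrow> \<phi> g \<le> c"
  shows "dual_pos_cone T \<phi> f \<le> c"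
  unfolding dual_pos_cone_def using assms Cc_zero(1)[of T] by (intro cSUP_least) force+

lemma dual_pos_cone_nonneg: "f \<in> Cc T \<Longrightarrow> 0 \<le> f \<Longrightarrow> 0 \<le> dual_pos_cone T \<phi> f"
  using dual_pos_cone_upper[of f 0] order_dual_zero[OF \<phi>] by simp

lemma dual_pos_cone_zero: "dual_pos_cone T \<phi> 0 = 0"
proof (rule antisym)
  show "dual_pos_cone T \<phi> 0 \<le> 0"
    by (rule dual_pos_cone_least) (auto dest: antisym simp: order_dual_zero[OF \<phi>])
qed (rule dual_pos_cone_nonneg, auto)

lemma dual_pos_cone_add:
  assumes "f \<in> Cc T" "0 \<le> f" "g \<in> Cc T" "0 \<le> g"
  shows "dual_pos_cone T \<phi> (f + g) = dual_pos_cone T \<phi> f + dual_pos_cone T \<phi> g"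
proof (rule antisym)
  show "dual_pos_cone T \<phi> (f + g) \<le> dual_pos_cone T \<phi> f + dual_pos_cone T \<phi> g"
  proof (rule dual_pos_cone_least)
    fix h assume h: "h \<in> Cc T" "0 \<le> h" "h \<le> f + g"
    \<comment> \<open>Riesz decomposition: \<open>a\<close>, the infimum of \<open>h\<close> and
      \<open>f\<close>, lies below \<open>f\<close>, and the remainder \<open>h - a\<close> lies
      below \<open>g\<close>.\<close>
    define a where "a = (\<lambda>x. min (h x) (f x))"
    have a: "a \<in> Cc T" unfolding a_def by (rule Cc_min[OF h(1) assms(1)])
    have ha: "h - a \<in> Cc T" by (rule Cc_diff[OF h(1) a])
    have "\<phi> h = \<phi> a + \<phi> (h - a)"
      using order_dual_add[OF \<phi> a ha] by simp
    also have "\<dots> \<le> dual_pos_cone T \<phi> f + dual_pos_cone T \<phi> g"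
    proof (rule add_mono)
      show "\<phi> a \<le> dual_pos_cone T \<phi> f"
        using assms h by (intro dual_pos_cone_upper a) (auto simp: a_def le_fun_def)
      show "\<phi> (h - a) \<le> dual_pos_cone T \<phi> g"
        using assms h by (intro dual_pos_cone_upper ha) (auto simp: a_def le_fun_def min_def algebra_simps)
    qed
    finally show "\<phi> h \<le> dual_pos_cone T \<phi> f + dual_pos_cone T \<phi> g" .
  qed (use assms in \<open>auto simp: le_fun_def intro: add_nonneg_nonneg\<close>)
  have fg: "f + g \<in> Cc T" by (rule Cc_add[OF assms(1,3)])
  have "dual_pos_cone T \<phi> f \<le> dual_pos_cone T \<phi> (f + g) - dual_pos_cone T \<phi> g"
  proof (rule dual_pos_cone_least[OF assms(2)])
    fix a assume a: "a \<in> Cc T" "0 \<le> a" "a \<le> f"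
    have "dual_pos_cone T \<phi> g \<le> dual_pos_cone T \<phi> (f + g) - \<phi> a"
    proof (rule dual_pos_cone_least[OF assms(4)])
      fix b assume b: "b \<in> Cc T" "0 \<le> b" "b \<le> g"
      have "\<phi> (a + b) \<le> dual_pos_cone T \<phi> (f + g)"
        using a b by (intro dual_pos_cone_upper fg Cc_add) (auto simp: le_fun_def intro: add_nonneg_nonneg add_mono)
      then show "\<phi> b \<le> dual_pos_cone T \<phi> (f + g) - \<phi> a"
        using order_dual_add[OF \<phi> a(1) b(1)] by simp
    qed
    then show "\<phi> a \<le> dual_pos_cone T \<phi> (f + g) - dual_pos_cone T \<phi> g" by simp
  qed
  then show "dual_pos_cone T \<phi> f + dual_pos_cone T \<phi> g \<le> dual_pos_cone T \<phi> (f + g)" by simp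
qed

lemma dual_pos_cone_scale:
  assumes f: "f \<in> Cc T" "0 \<le> f" and "0 \<le> c"
  shows "dual_pos_cone T \<phi> (c *\<^sub>R f) = c * dual_pos_cone T \<phi> f"
proof (cases "c = 0")
  case True
  then show ?thesis using dual_pos_cone_zero by (simp add: scaleR_fun_def zero_fun_def)
next
  case False
  have le: "c * dual_pos_cone T \<phi> f \<le> dual_pos_cone T \<phi> (c *\<^sub>R f)" if f: "f \<in> Cc T" "0 \<le> f" and c: "0 < c" for c f
  proof -
    have "dual_pos_cone T \<phi> f \<le> dual_pos_cone T \<phi> (c *\<^sub>R f) / c"
    proof (rule dual_pos_cone_least[OF f(2)])
      fix g assume g: "g \<in> Cc T" "0 \<le> g" "g \<le> f"
      have "\<phi> (c *\<^sub>R g) \<le> dual_pos_cone T \<phi> (c *\<^sub>R f)"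
        using g c f by (intro dual_pos_cone_upper Cc_scale) (auto simp: le_fun_def scaleR_fun_def)
      then show "\<phi> g \<le> dual_pos_cone T \<phi> (c *\<^sub>R f) / c"
        using order_dual_scale[OF \<phi> g(1), of c] c by (simp add: field_simps)
    qed
    then show ?thesis using c by (simp add: field_simps)
  qed
  have c: "0 < c" using False assms by simp
  have "(1 / c) * dual_pos_cone T \<phi> (c *\<^sub>R f) \<le> dual_pos_cone T \<phi> ((1 / c) *\<^sub>R (c *\<^sub>R f))"
    using c f by (intro le Cc_scale) (auto simp: le_fun_def scaleR_fun_def)
  moreover have "(1 / c) *\<^sub>R (c *\<^sub>R f) = f" using c by simp
  ultimately show ?thesis using le[OF f c] c by (simp add: field_simps)
qed

text \<open>For two decompositions of \<open>f\<close> into positive functions the cross sums agree,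
  and \<open>dual_pos_cone\<close> is additive. Freedom in the decomposition gives linearity of
  \<open>dual_pos\<close> without computing the positive part of a sum.\<close>

lemma dual_pos_diff:
  assumes "f \<in> Cc T" "a \<in> Cc T" "b \<in> Cc T" "0 \<le> a" "0 \<le> b" "f = a - b"
  shows "dual_pos T \<phi> f = dual_pos_cone T \<phi> a - dual_pos_cone T \<phi> b"
proof -
  let ?p = "\<lambda>x. max (f x) 0" and ?n = "\<lambda>x. max (- f x) 0"
  note C = Cc_pos_part[OF assms(1)]
  have nn: "0 \<le> ?p" "0 \<le> ?n" by (auto simp: le_fun_def)
  have "?p + b = ?n + a" using assms(6) by (auto simp: fun_eq_iff max_def)
  then have "dual_pos_cone T \<phi> ?p + dual_pos_cone T \<phi> b = dual_pos_cone T \<phi> ?n + dual_pos_cone T \<phi> a"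
    using dual_pos_cone_add[OF C(1) nn(1) assms(3,5)] dual_pos_cone_add[OF C(3) nn(2) assms(2,4)] by simp
  then show ?thesis using assms(1) by (simp add: dual_pos_def)
qed

lemma dual_pos_eq_cone: "f \<in> Cc T \<Longrightarrow> 0 \<le> f \<Longrightarrow> dual_pos T \<phi> f = dual_pos_cone T \<phi> f"
  using dual_pos_diff[of f f 0] dual_pos_cone_zero by simp

lemma dual_pos_add:
  assumes "f \<in> Cc T" "g \<in> Cc T"
  shows "dual_pos T \<phi> (f + g) = dual_pos T \<phi> f + dual_pos T \<phi> g"
proof -
  let ?p = "\<lambda>f x. max (f x) (0::real)" and ?n = "\<lambda>f x. max (- f x) (0::real)"
  have nn: "0 \<le> ?p h" "0 \<le> ?n h" for h :: "'a \<Rightarrow> real" by (auto simp: le_fun_def)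
  note C = Cc_pos_part[OF assms(1)] and D = Cc_pos_part[OF assms(2)]
  have "dual_pos T \<phi> (f + g) = dual_pos_cone T \<phi> (?p f + ?p g) - dual_pos_cone T \<phi> (?n f + ?n g)"
  proof (rule dual_pos_diff)
    show "f + g = (?p f + ?p g) - (?n f + ?n g)" by (auto simp: fun_eq_iff max_def)
  qed (intro Cc_add assms C D add_nonneg_nonneg nn)+
  then show ?thesis
    using dual_pos_cone_add[OF C(1) nn(1) D(1) nn(1)] dual_pos_cone_add[OF C(3) nn(2) D(3) nn(2)] assms
    by (simp add: dual_pos_def)
qed

lemma dual_pos_scale:
  assumes "f \<in> Cc T"
  shows "dual_pos T \<phi> (c *\<^sub>R f) = c * dual_pos T \<phi> f"
proof -
  let ?p = "\<lambda>x. max (f x) (0::real)" and ?n = "\<lambda>x. max (- f x) (0::real)"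
  have nn: "0 \<le> ?p" "0 \<le> ?n" by (auto simp: le_fun_def)
  note C = Cc_pos_part[OF assms]
  have sn: "0 \<le> d *\<^sub>R h" if "0 \<le> d" "0 \<le> h" for d and h :: "'a \<Rightarrow> real"
    using that by (simp add: le_fun_def scaleR_fun_def)
  show ?thesis
  proof (cases "0 \<le> c")
    case True
    have "dual_pos T \<phi> (c *\<^sub>R f) = dual_pos_cone T \<phi> (c *\<^sub>R ?p) - dual_pos_cone T \<phi> (c *\<^sub>R ?n)"
    proof (rule dual_pos_diff)
      show "c *\<^sub>R f = c *\<^sub>R ?p - c *\<^sub>R ?n" by (auto simp: fun_eq_iff max_def scaleR_fun_def)
    qed (intro Cc_scale assms C sn nn True)+
    then show ?thesis
      using dual_pos_cone_scale[OF C(1) nn(1) True] dual_pos_cone_scale[OF C(3) nn(2) True] assms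
      by (simp add: dual_pos_def algebra_simps)
  next
    case False
    then have c: "0 \<le> - c" by simp
    have "dual_pos T \<phi> (c *\<^sub>R f) = dual_pos_cone T \<phi> ((- c) *\<^sub>R ?n) - dual_pos_cone T \<phi> ((- c) *\<^sub>R ?p)"
    proof (rule dual_pos_diff)
      show "c *\<^sub>R f = (- c) *\<^sub>R ?n - (- c) *\<^sub>R ?p" by (auto simp: fun_eq_iff max_def scaleR_fun_def)
    qed (intro Cc_scale assms C sn nn c)+
    then show ?thesis
      using dual_pos_cone_scale[OF C(1) nn(1) c] dual_pos_cone_scale[OF C(3) nn(2) c] assms
      by (simp add: dual_pos_def algebra_simps)
  qed
qed

lemma dual_pos_order_dual: "dual_pos T \<phi> \<in> order_dual T"
proof -
  let ?q = "dual_pos T \<phi>"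
  have lin: "linear_on (Cc T) UNIV ?q"
    by (auto simp: linear_on_def dual_pos_add dual_pos_scale)
  have mono: "?q f \<le> ?q g" if "f \<in> Cc T" "g \<in> Cc T" "f \<le> g" for f g
  proof -
    have "g - f \<in> Cc T" "0 \<le> g - f" using that by (auto intro: Cc_diff simp: le_fun_def)
    then have "0 \<le> ?q (g - f)" using dual_pos_eq_cone dual_pos_cone_nonneg by simp
    then show ?thesis using linear_on_diff[OF lin subspace_Cc that(2,1)] by simp
  qed
  have "bounded (?q ` {f \<in> Cc T. a \<le> f \<and> f \<le> b})" if "a \<in> Cc T" "b \<in> Cc T" for a b
    by (rule bounded_subset[OF bounded_closed_interval[of "?q a" "?q b"]]) (use mono that in auto)
  then show ?thesis
    using lin by (auto simp: order_dual_def dual_pos_def)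
qed

lemma dual_pos_supremum: "is_supremum (order_dual T) (dual_le T) {\<phi>, 0} (dual_pos T \<phi>)"
  unfolding is_supremum_def
proof (intro conjI ballI impI dual_pos_order_dual)
  fix a assume "a \<in> {\<phi>, 0}"
  then show "dual_le T a (dual_pos T \<phi>)"
    using dual_pos_eq_cone dual_pos_cone_nonneg dual_pos_cone_upper by (auto simp: dual_le_def)
next
  fix t assume t: "t \<in> order_dual T" "\<forall>a\<in>{\<phi>, 0}. dual_le T a t"
  show "dual_le T (dual_pos T \<phi>) t"
    unfolding dual_le_def
  proof (intro ballI impI)
    fix f :: "'a \<Rightarrow> real" assume f: "f \<in> Cc T" "0 \<le> f"
    have "dual_pos_cone T \<phi> f \<le> t f"
    proof (rule dual_pos_cone_least[OF f(2)])
      fix g assume g: "g \<in> Cc T" "0 \<le> g" "g \<le> f"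
      have "\<phi> g \<le> t g" using t(2) g by (auto simp: dual_le_def)
      moreover have "f - g \<in> Cc T" "0 \<le> f - g" using f g by (auto intro: Cc_diff simp: le_fun_def)
      then have "0 \<le> t (f - g)" using t(2) by (auto simp: dual_le_def)
      ultimately show "\<phi> g \<le> t f" using order_dual_diff[OF t(1) f(1) g(1)] by simp
    qed
    then show "dual_pos T \<phi> f \<le> t f" using dual_pos_eq_cone[OF f] by simp
  qed
qed

text \<open>If \<open>0 \<le> g \<le> f\<close>, then \<open>g\<close> is supported where
  \<open>f\<close> is, so \<phi> kills all competitors in the supremum as soon as it vanishes on the
  open set in question. This makes the supports of the positive and negative parts of
  \<open>x\<close> compact.\<close>

lemma dsupp_dual_pos: "dsupp T (dual_pos T \<phi>) \<subseteq> dsupp T \<phi>"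
proof -
  have "vanishes_on T (dual_pos T \<phi>) U" if U: "vanishes_on T \<phi> U" for U
    unfolding vanishes_on_def
  proof (intro ballI impI)
    have 0: "dual_pos_cone T \<phi> f = 0" if f: "f \<in> Cc T" "0 \<le> f" "fsupp T f \<subseteq> U" for f
    proof (rule antisym)
      show "dual_pos_cone T \<phi> f \<le> 0"
      proof (rule dual_pos_cone_least[OF f(2)])
        fix g assume g: "g \<in> Cc T" "0 \<le> g" "g \<le> f"
        have "g x = 0" if "f x = 0" for x
          using that le_funD[OF g(2), of x] le_funD[OF g(3), of x] by simp
        then have "fsupp T g \<subseteq> fsupp T f"
          using Cc_dominated(2)[OF f(1) Cc_continuous[OF g(1)]] by blast
        then show "\<phi> g \<le> 0" using U g f(3) by (auto simp: vanishes_on_def)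
      qed
    qed (rule dual_pos_cone_nonneg[OF f(1,2)])
    fix f assume f: "f \<in> Cc T" "fsupp T f \<subseteq> U"
    note C = Cc_pos_part[OF f(1)]
    have "dual_pos_cone T \<phi> (\<lambda>x. max (f x) 0) = 0" "dual_pos_cone T \<phi> (\<lambda>x. max (- f x) 0) = 0"
      using C f(2) by (auto intro!: 0 simp: le_fun_def)
    then show "dual_pos T \<phi> f = 0" by (simp add: dual_pos_def)
  qed
  then show ?thesis unfolding dsupp_def by blast
qed

end

section \<open>Banach lattices and positive operators\<close>

lemma vsup_eqI:
  assumes "is_supremum E leq {x, y} s" "\<And>a b. a \<in> E \<Longrightarrow> b \<in> E \<Longrightarrow> leq a b \<Longrightarrow> leq b a \<Longrightarrow> a = b"
  shows "vsup E leq x y = s"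
  unfolding vsup_def using assms by (intro the_equality) (auto simp: is_supremum_def)

locale Banach_lattice_on =
  fixes E :: "'v::real_vector set" and leq :: "'v \<Rightarrow> 'v \<Rightarrow> bool" and N :: "'v \<Rightarrow> real"
  assumes Banach_lattice: "Banach_lattice E leq N"
begin

lemma vl: "vector_lattice E leq"
  using Banach_lattice by (simp add: Banach_lattice_def)

lemma sub: "subspace E"
  using vl by (simp add: vector_lattice_def)

lemmas E_zero [simp] = subspace_0[OF sub]
  and E_add [simp] = subspace_add[OF sub]
  and E_diff [simp] = subspace_diff[OF sub]
  and E_neg [simp] = subspace_neg[OF sub]
  and E_scale [simp] = subspace_scale[OF sub]
  and E_sum = subspace_sum[OF sub]

lemma le_refl [simp]: "x \<in> E \<Longrightarrow> leq x x"
  and le_antisym: "leq x y \<Longrightarrow> leq y x \<Longrightarrow> x \<in> E \<Longrightarrow> y \<in> E \<Longrightarrow> x = y"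
  and le_trans: "leq x y \<Longrightarrow> leq y z \<Longrightarrow> x \<in> E \<Longrightarrow> y \<in> E \<Longrightarrow> z \<in> E \<Longrightarrow> leq x z"
  and le_add_right: "leq x y \<Longrightarrow> x \<in> E \<Longrightarrow> y \<in> E \<Longrightarrow> z \<in> E \<Longrightarrow> leq (x + z) (y + z)"
  and le_scale: "leq x y \<Longrightarrow> x \<in> E \<Longrightarrow> y \<in> E \<Longrightarrow> 0 \<le> c \<Longrightarrow> leq (c *\<^sub>R x) (c *\<^sub>R y)"
  and sup_ex: "x \<in> E \<Longrightarrow> y \<in> E \<Longrightarrow> \<exists>s. is_supremum E leq {x, y} s"
  using vl unfolding vector_lattice_def by blast+

lemma le_iff: "x \<in> E \<Longrightarrow> y \<in> E \<Longrightarrow> leq x y \<longleftrightarrow> leq 0 (y - x)"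
  using le_add_right[of x y "- x"] le_add_right[of 0 "y - x" x] by auto

lemma add_nonneg: "leq 0 x \<Longrightarrow> leq 0 y \<Longrightarrow> x \<in> E \<Longrightarrow> y \<in> E \<Longrightarrow> leq 0 (x + y)"
  using le_add_right[of 0 x y] le_trans[of 0 y "x + y"] by simp

lemma vsup_supremum: "x \<in> E \<Longrightarrow> y \<in> E \<Longrightarrow> is_supremum E leq {x, y} (vsup E leq x y)"
  using sup_ex[of x y] vsup_eqI[of E leq x y] le_antisym by metis

lemma vsup_unique: "is_supremum E leq {x, y} s \<Longrightarrow> vsup E leq x y = s"
  by (rule vsup_eqI) (auto intro: le_antisym)

lemma vpos_in [simp]: "x \<in> E \<Longrightarrow> vpos E leq x \<in> E"
  and vpos_nonneg: "x \<in> E \<Longrightarrow> leq 0 (vpos E leq x)"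
  and vpos_ge: "x \<in> E \<Longrightarrow> leq x (vpos E leq x)"
  and vpos_least: "x \<in> E \<Longrightarrow> y \<in> E \<Longrightarrow> leq x y \<Longrightarrow> leq 0 y \<Longrightarrow> leq (vpos E leq x) y"
  using vsup_supremum[of x 0] by (auto simp: vpos_def is_supremum_def)

lemma vabs_in [simp]: "x \<in> E \<Longrightarrow> vabs E leq x \<in> E"
  and vabs_ge: "x \<in> E \<Longrightarrow> leq x (vabs E leq x)"
  and vabs_ge': "x \<in> E \<Longrightarrow> leq (- x) (vabs E leq x)"
  and vabs_least: "x \<in> E \<Longrightarrow> y \<in> E \<Longrightarrow> leq x y \<Longrightarrow> leq (- x) y \<Longrightarrow> leq (vabs E leq x) y"
  using vsup_supremum[of x "- x"] by (auto simp: vabs_def is_supremum_def)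

lemma vabs_nonneg:
  assumes "x \<in> E"
  shows "leq 0 (vabs E leq x)"
proof -
  have "leq 0 (vabs E leq x - x)" "leq 0 (vabs E leq x + x)"
    using vabs_ge[OF assms] vabs_ge'[OF assms] assms le_iff[of x "vabs E leq x"] le_iff[of "- x" "vabs E leq x"] by auto
  then have "leq 0 ((vabs E leq x - x) + (vabs E leq x + x))"
    by (rule add_nonneg) (use assms in auto)
  then have "leq 0 (2 *\<^sub>R vabs E leq x)" by (simp add: scaleR_2)
  from le_scale[OF this, of "1/2"] show ?thesis using assms by simp
qed

lemma neg_le: "leq 0 x \<Longrightarrow> x \<in> E \<Longrightarrow> leq (- x) 0"
  using le_iff[of "- x" 0] by simp

lemma vabs_of_nonneg: "leq 0 x \<Longrightarrow> x \<in> E \<Longrightarrow> vabs E leq x = x"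
  unfolding vabs_def
  by (rule vsup_unique) (auto simp: is_supremum_def intro: le_trans[OF neg_le])

section \<open>Norm estimates and closedness of the positive cone\<close>

lemma norm_props: "norm_on E N"
  using Banach_lattice by (simp add: Banach_lattice_def)

lemma norm_ge_0 [simp]: "x \<in> E \<Longrightarrow> 0 \<le> N x"
  and norm_eq_0: "x \<in> E \<Longrightarrow> N x = 0 \<longleftrightarrow> x = 0"
  and norm_scale: "x \<in> E \<Longrightarrow> N (c *\<^sub>R x) = \<bar>c\<bar> * N x"
  and norm_triangle: "x \<in> E \<Longrightarrow> y \<in> E \<Longrightarrow> N (x + y) \<le> N x + N y"
  using norm_props by (auto simp: norm_on_def)

lemma norm_zero [simp]: "N 0 = 0"
  by (simp add: norm_eq_0)

lemma norm_neg: "x \<in> E \<Longrightarrow> N (- x) = N x"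
  using norm_scale[of x "-1"] by simp

lemma norm_diff: "x \<in> E \<Longrightarrow> y \<in> E \<Longrightarrow> N (x - y) \<le> N x + N y"
  using norm_triangle[of x "- y"] norm_neg[of y] by simp

lemma norm_le_vabs: "x \<in> E \<Longrightarrow> y \<in> E \<Longrightarrow> leq (vabs E leq x) (vabs E leq y) \<Longrightarrow> N x \<le> N y"
  using Banach_lattice by (auto simp: Banach_lattice_def)

lemma norm_mono: "leq 0 x \<Longrightarrow> leq x y \<Longrightarrow> x \<in> E \<Longrightarrow> y \<in> E \<Longrightarrow> N x \<le> N y"
  by (rule norm_le_vabs, assumption+) (simp add: vabs_of_nonneg le_trans[of 0 x y])

lemma norm_vabs_le: "x \<in> E \<Longrightarrow> N (vabs E leq x) \<le> N x"
  by (rule norm_le_vabs) (simp_all add: vabs_of_nonneg vabs_nonneg)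

text \<open>Both \<open>x\<close> and \<open>0\<close> lie below the modulus of \<open>w\<close>.
  The upper bound \<open>w\<close> is kept separate from \<open>x\<close> because closedness of the
  cone needs a small \<open>w\<close> above a fixed element.\<close>

lemma norm_vpos_le:
  assumes "x \<in> E" "w \<in> E" "leq x w"
  shows "N (vpos E leq x) \<le> N w"
proof -
  have "leq (vpos E leq x) (vabs E leq w)"
    by (rule vpos_least[OF assms(1) vabs_in[OF assms(2)] le_trans[OF assms(3) vabs_ge[OF assms(2)]] vabs_nonneg[OF assms(2)]])
      (simp_all add: assms)
  then have "N (vpos E leq x) \<le> N (vabs E leq w)"
    by (rule norm_mono[OF vpos_nonneg[OF assms(1)]]) (simp_all add: assms)
  then show ?thesis using norm_vabs_le[OF assms(2)] by linarith
qed

text \<open>Translation by \<open>- x\<close> turns the supremum of \<open>x\<close> and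
  \<open>0\<close> into that of \<open>0\<close> and \<open>- x\<close>.\<close>

lemma vpos_diff:
  assumes "x \<in> E"
  shows "x = vpos E leq x - vpos E leq (- x)"
proof -
  let ?p = "vpos E leq x"
  note E = assms vpos_in[OF assms]
  have "is_supremum E leq {- x, 0} (?p - x)"
    unfolding is_supremum_def
  proof (intro conjI ballI impI)
    fix t assume t: "t \<in> E" "\<forall>a\<in>{- x, 0}. leq a t"
    have "leq x (t + x)"
      using t le_add_right[of 0 t x] E by simp
    moreover have "leq 0 (t + x)"
      using t le_add_right[of "- x" t x] E by simp
    ultimately have "leq ?p (t + x)" using t E by (intro vpos_least) simp_all
    from le_add_right[OF this, of "- x"] show "leq (?p - x) t"
      using t E by simp
  next
    fix a assume "a \<in> {- x, 0}"
    then consider "a = - x" | "a = 0" by blast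
    then show "leq a (?p - x)"
    proof cases
      case 1
      then show ?thesis using le_add_right[OF vpos_nonneg[OF assms], of "- x"] E by simp
    next
      case 2
      then show ?thesis using le_add_right[OF vpos_ge[OF assms], of "- x"] E by simp
    qed
  qed (use E in simp)
  then have "vsup E leq (- x) 0 = ?p - x" by (rule vsup_unique)
  then show ?thesis by (simp add: vpos_def[of E leq "- x"])
qed

text \<open>From \<open>0 \<le> z + w\<close> follows \<open>- z \<le> w\<close>, so the positive
  part of \<open>- z\<close> has norm at most \<open>N w < e\<close>. As \<open>e\<close> is
  arbitrary, this positive part is 0.\<close>

lemma nonneg_closed:
  assumes z: "z \<in> E" and approx: "\<And>e. 0 < e \<Longrightarrow> \<exists>w\<in>E. N w < e \<and> leq 0 (z + w)"
  shows "leq 0 z"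
proof -
  have "N (vpos E leq (- z)) \<le> e" if "0 < e" for e
  proof -
    obtain w where w: "w \<in> E" "N w < e" "leq 0 (z + w)" using approx[OF \<open>0 < e\<close>] by blast
    then have "leq (- z) w" using z le_iff[of "- z" w] by (simp add: add.commute)
    then show ?thesis using norm_vpos_le[of "- z" w] z w by simp
  qed
  then have "N (vpos E leq (- z)) \<le> 0"
    by (rule field_le_epsilon[of _ 0, simplified])
  then have "vpos E leq (- z) = 0"
    using z norm_eq_0[of "vpos E leq (- z)"] norm_ge_0[OF vpos_in[of "- z"]] by fastforce
  then show ?thesis using vpos_ge[of "- z"] z le_iff[of "- z" 0] by simp
qed

text \<open>The upper bound is the sum of the series, which converges by completeness. Each
  \<open>S n - x k\<close> with \<open>n > k\<close> is a sum of positive terms, and positivity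
  survives the limit.\<close>

lemma geometric_series_upper_bound:
  assumes x: "\<And>k. x k \<in> E" "\<And>k. leq 0 (x k)" "\<And>k. N (x k) \<le> (1/2)^k"
  shows "\<exists>s\<in>E. leq 0 s \<and> (\<forall>k. leq (x k) s)"
proof -
  define S where "S n = (\<Sum>k<n. x k)" for n
  have SE: "S n \<in> E" for n unfolding S_def by (rule E_sum) (use x in auto)
  \<comment> \<open>The right-hand side is the exact geometric sum, the form that the induction on
    \<open>j\<close> reproduces; \<open>tail'\<close> then drops the subtracted term.\<close>
  have tail: "N (S (m + j) - S m) \<le> 2 * (1/2)^m - 2 * (1/2)^(m + j)" for m j
  proof (induction j)
    case (Suc j)
    have "S (m + Suc j) - S m = (S (m + j) - S m) + x (m + j)" by (simp add: S_def)
    moreover have "N ((S (m + j) - S m) + x (m + j)) \<le> N (S (m + j) - S m) + N (x (m + j))"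
      by (rule norm_triangle) (use SE x(1) in auto)
    ultimately have "N (S (m + Suc j) - S m) \<le> N (S (m + j) - S m) + N (x (m + j))"
      by (simp only:)
    then show ?case using Suc x(3)[of "m + j"] by simp
  qed simp
  have tail': "N (S n - S m) \<le> 2 * (1/2)^m" if "m \<le> n" for m n
  proof -
    have "N (S n - S m) \<le> 2 * (1/2)^m - 2 * (1/2)^n" using tail[of m "n - m"] that by simp
    moreover have "0 \<le> (1/2::real)^n" by simp
    ultimately show ?thesis by linarith
  qed
  have "\<exists>M. \<forall>m\<ge>M. \<forall>n\<ge>M. N (S m - S n) < e" if "0 < e" for e
  proof -
    obtain M where M: "(1/2::real)^M < e/4" using real_arch_pow_inv[of "e/4" "1/2"] \<open>0 < e\<close> by auto
    have "N (S m - S n) < e" if "m \<ge> M" "n \<ge> M" for m n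
    proof -
      have "S m - S n = (S m - S M) - (S n - S M)" by simp
      moreover have "N ((S m - S M) - (S n - S M)) \<le> N (S m - S M) + N (S n - S M)"
        by (rule norm_diff) (intro E_diff SE)+
      ultimately have "N (S m - S n) \<le> N (S m - S M) + N (S n - S M)" by (simp only:)
      then show ?thesis using tail'[OF that(1)] tail'[OF that(2)] M by linarith
    qed
    then show ?thesis by blast
  qed
  moreover have "range S \<subseteq> E" using SE by blast
  moreover have "complete_norm_on E N" using Banach_lattice by (simp add: Banach_lattice_def)
  ultimately have "\<exists>s\<in>E. (\<lambda>n. N (S n - s)) \<longlonglongrightarrow> 0"
    unfolding complete_norm_on_def by (elim allE[of _ S]) simp
  then obtain s where s: "s \<in> E" "(\<lambda>n. N (S n - s)) \<longlonglongrightarrow> 0" by blast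
  have ev: "leq 0 (s - a)" if a: "a \<in> E" "\<And>n. n0 \<le> n \<Longrightarrow> leq 0 (S n - a)" for a n0
  proof (rule nonneg_closed)
    fix e :: real assume "0 < e"
    from order_tendstoD(2)[OF s(2) this] obtain n1 where "\<forall>n\<ge>n1. N (S n - s) < e"
      unfolding eventually_sequentially by blast
    then have "N (S (max n0 n1) - s) < e" by simp
    moreover have "leq 0 (S (max n0 n1) - a)" by (rule a(2)) simp
    ultimately show "\<exists>w\<in>E. N w < e \<and> leq 0 (s - a + w)"
      using SE s(1) by (intro bexI[of _ "S (max n0 n1) - s"]) simp_all
  qed (use s a in simp)
  have Snn: "leq 0 (\<Sum>k\<in>I. x k)" if "finite I" for I
    using that
  proof (induction I)
    case (insert i I)
    have "sum x I \<in> E" by (rule E_sum) (rule x(1))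
    then show ?case using add_nonneg[OF x(2) insert.IH x(1)] insert.hyps by simp
  qed simp
  have "leq 0 (s - x k)" for k
  proof (rule ev[OF x(1)])
    fix n assume "Suc k \<le> n"
    then have "S n - x k = (\<Sum>j\<in>{..<n} - {k}. x j)"
      unfolding S_def by (subst sum.remove[of _ k]) auto
    then show "leq 0 (S n - x k)" using Snn by simp
  qed
  moreover have "leq 0 (s - 0)"
    by (rule ev[of 0 0]) (use Snn in \<open>auto simp: S_def\<close>)
  ultimately show ?thesis using s(1) le_iff[OF x(1) s(1)] by (intro bexI[of _ s]) simp_all
qed

end

section \<open>Automatic continuity of positive operators\<close>

locale positive_operator_on = dom: Banach_lattice_on E leq N + cod: Banach_lattice_on F leqF NF
  for E :: "'v::real_vector set" and leq N and F :: "'w::real_vector set" and leqF NF +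
  fixes P :: "'v \<Rightarrow> 'w"
  assumes positive: "positive_operator E leq F leqF P"
begin

lemma lin: "linear_on E F P"
  using positive by (simp add: positive_operator_def)

lemma P_in [simp]: "x \<in> E \<Longrightarrow> P x \<in> F"
  and P_scale: "x \<in> E \<Longrightarrow> P (c *\<^sub>R x) = c *\<^sub>R P x"
  using lin by (auto simp: linear_on_def)

lemma P_diff: "x \<in> E \<Longrightarrow> y \<in> E \<Longrightarrow> P (x - y) = P x - P y"
  by (rule linear_on_diff[OF lin dom.sub])

lemma P_nonneg: "x \<in> E \<Longrightarrow> leq 0 x \<Longrightarrow> leqF 0 (P x)"
  using positive by (auto simp: positive_operator_def positive_cone_def)

lemma P_mono: "x \<in> E \<Longrightarrow> y \<in> E \<Longrightarrow> leq x y \<Longrightarrow> leqF (P x) (P y)"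
  using P_nonneg[of "y - x"] P_diff[of y x] dom.le_iff[of x y] cod.le_iff[of "P x" "P y"] by simp

text \<open>Otherwise there are positive elements of norm \<open>(1/2)^n\<close> whose images have
  norm above \<open>n\<close>. All of them lie below one element \<open>s\<close>, and monotonicity
  of \<open>P\<close> and of the norm would give \<open>n \<le> NF (P s)\<close> for every
  \<open>n\<close>.\<close>

lemma bounded_on_cone: "\<exists>C\<ge>0. \<forall>x\<in>E. leq 0 x \<longrightarrow> NF (P x) \<le> C * N x"
proof (rule ccontr)
  assume unbdd: "\<not> ?thesis"
  \<comment> \<open>The factor \<open>2^n\<close> is spent on normalising \<open>u n\<close> to norm
    \<open>(1/2)^n\<close>, and the factor \<open>n\<close> remains as the growth of the
    images.\<close>
  have "\<exists>u\<in>E. leq 0 u \<and> (real n * 2^n) * N u < NF (P u)" for n :: nat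
  proof -
    have "0 \<le> real n * 2^n" by simp
    then show ?thesis using unbdd by (meson not_le_imp_less)
  qed
  then obtain u where u: "\<And>n. u n \<in> E" "\<And>n. leq 0 (u n)" "\<And>n. (real n * 2^n) * N (u n) < NF (P (u n))"
    by metis
  have pos: "0 < N (u n)" for n
  proof (rule ccontr)
    assume "\<not> 0 < N (u n)"
    then have "N (u n) = 0" using dom.norm_ge_0[OF u(1)[of n]] by linarith
    then have "u n = 0" using dom.norm_eq_0[OF u(1)] by blast
    moreover have "P 0 = 0" by (rule linear_on_zero[OF lin]) simp
    ultimately show False using u(3)[of n] by simp
  qed
  define x where "x n = (1 / (2^n * N (u n))) *\<^sub>R u n" for n
  have "\<exists>s\<in>E. leq 0 s \<and> (\<forall>k. leq (x k) s)"
  proof (rule dom.geometric_series_upper_bound)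
    fix k
    show "x k \<in> E" using u(1) by (simp add: x_def)
    show "leq 0 (x k)" using dom.le_scale[OF u(2)[of k], of "1 / (2^k * N (u k))"] u(1) pos[of k] by (simp add: x_def)
    show "N (x k) \<le> (1/2)^k" using u(1)[of k] pos[of k] by (simp add: x_def dom.norm_scale power_one_over)
  qed
  then obtain s where s: "s \<in> E" "\<And>k. leq (x k) s" by blast
  have "real n \<le> NF (P s)" for n
  proof -
    have xE: "x n \<in> E" using u(1) by (simp add: x_def)
    have x0: "leq 0 (x n)" using dom.le_scale[OF u(2)[of n], of "1 / (2^n * N (u n))"] u(1) pos[of n] by (simp add: x_def)
    have "NF (P (x n)) = NF (P (u n)) / (2^n * N (u n))"
      using u(1) pos[of n] by (simp add: x_def P_scale cod.norm_scale)
    moreover have "real n < NF (P (u n)) / (2^n * N (u n))"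
      using u(3)[of n] pos[of n] by (simp add: field_simps)
    moreover have "NF (P (x n)) \<le> NF (P s)"
      by (rule cod.norm_mono[OF P_nonneg[OF xE x0] P_mono[OF xE s(1) s(2)]]) (simp_all add: xE s)
    ultimately show ?thesis by simp
  qed
  then show False using reals_Archimedean2[of "NF (P s)"] by (meson not_le)
qed

lemma bounded: "\<exists>C\<ge>0. \<forall>x\<in>E. NF (P x) \<le> C * N x"
proof -
  obtain C where C: "0 \<le> C" "\<And>x. x \<in> E \<Longrightarrow> leq 0 x \<Longrightarrow> NF (P x) \<le> C * N x"
    using bounded_on_cone by blast
  have "NF (P x) \<le> (2 * C) * N x" if x: "x \<in> E" for x
  proof -
    have b: "NF (P (vpos E leq z)) \<le> C * N z" if "z \<in> E" for z
      using C(2)[of "vpos E leq z"] dom.vpos_nonneg[OF that] mult_left_mono[OF dom.norm_vpos_le[OF that that] C(1)] that by simp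
    have "P x = P (vpos E leq x) - P (vpos E leq (- x))"
      using dom.vpos_diff[OF x] P_diff[of "vpos E leq x" "vpos E leq (- x)"] x by simp
    then have "NF (P x) \<le> NF (P (vpos E leq x)) + NF (P (vpos E leq (- x)))"
      using x cod.norm_diff[of "P (vpos E leq x)" "P (vpos E leq (- x))"] by simp
    then show ?thesis using b[OF x] b[of "- x"] x dom.norm_neg[OF x] by simp
  qed
  then show ?thesis using C(1) by (intro exI[of _ "2 * C"]) simp
qed

end

section \<open>Sublattices of the order dual\<close>

lemma dual_le_diff: "dual_le T a b \<longleftrightarrow> dual_le T 0 (b - a)"
  by (auto simp: dual_le_def)

lemma dual_le_refl: "dual_le T a a"
  and dual_le_trans: "dual_le T a b \<Longrightarrow> dual_le T b c \<Longrightarrow> dual_le T a c"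
  and dual_le_add: "dual_le T a b \<Longrightarrow> dual_le T c d \<Longrightarrow> dual_le T (a + c) (b + d)"
  by (fastforce simp: dual_le_def intro: add_mono)+

lemma dual_le_sum: "(\<And>i. i \<in> I \<Longrightarrow> dual_le T (a i) (b i)) \<Longrightarrow> dual_le T (sum a I) (sum b I)"
  by (auto simp: dual_le_def sum_fun_apply intro!: sum_mono)

lemma order_dual_antisym:
  assumes "a \<in> order_dual T" "b \<in> order_dual T" "dual_le T a b" "dual_le T b a"
  shows "a = b"
proof
  fix f
  show "a f = b f"
  proof (cases "f \<in> Cc T")
    case True
    note C = Cc_pos_part[OF True]
    have "a g = b g" if "g \<in> Cc T" "0 \<le> g" for g
      using assms(3,4) that by (auto simp: dual_le_def intro: antisym)
    then have "a (\<lambda>x. max (f x) 0) = b (\<lambda>x. max (f x) 0)" "a (\<lambda>x. max (- f x) 0) = b (\<lambda>x. max (- f x) 0)"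
      using C by (auto simp: le_fun_def)
    then show ?thesis
      using order_dual_pos_part[OF assms(1) True] order_dual_pos_part[OF assms(2) True] by simp
  next
    case False
    then show ?thesis using order_dual_outside assms(1,2) by metis
  qed
qed

lemma vsup_order_dual: "is_supremum (order_dual T) (dual_le T) {x, y} s \<Longrightarrow> vsup (order_dual T) (dual_le T) x y = s"
  by (rule vsup_eqI) (auto intro: order_dual_antisym)

lemma order_dual_neg: "\<phi> \<in> order_dual T \<Longrightarrow> - \<phi> \<in> order_dual T"
proof -
  assume \<phi>: "\<phi> \<in> order_dual T"
  have "bounded ((- \<phi>) ` {f \<in> Cc T. a \<le> f \<and> f \<le> b})" if "a \<in> Cc T" "b \<in> Cc T" for a b
  proof -
    have "bounded (uminus ` \<phi> ` {f \<in> Cc T. a \<le> f \<and> f \<le> b})"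
      using \<phi> that by (simp add: order_dual_def bounded_uminus)
    then show ?thesis by (simp add: image_image)
  qed
  then show ?thesis using \<phi> by (auto simp: order_dual_def linear_on_def)
qed

lemma dsupp_neg: "dsupp T (- \<phi>) = dsupp T \<phi>"
  by (simp add: dsupp_def vanishes_on_def)

lemma vpos_order_dual: "\<phi> \<in> order_dual T \<Longrightarrow> vpos (order_dual T) (dual_le T) \<phi> = dual_pos T \<phi>"
  and vneg_order_dual: "\<phi> \<in> order_dual T \<Longrightarrow> vneg (order_dual T) (dual_le T) \<phi> = dual_pos T (- \<phi>)"
  unfolding vpos_def vneg_def
  by (intro vsup_order_dual dual_pos_supremum order_dual_neg; assumption)+

locale dual_sublattice = Banach_lattice_on X "dual_le T" N for X T N +
  assumes sublattice: "vector_sublattice (order_dual T) (dual_le T) X"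
begin

lemma in_order_dual: "x \<in> X \<Longrightarrow> x \<in> order_dual T"
  using sublattice by (auto simp: vector_sublattice_def)

lemma dual_pos_in: "x \<in> X \<Longrightarrow> dual_pos T x \<in> X"
  using sublattice vpos_order_dual[OF in_order_dual, of x] E_zero
  unfolding vector_sublattice_def vpos_def by metis

text \<open>As \<open>X\<close> is a sublattice, the supremum formed in the order dual lies in
  \<open>X\<close> and is also the supremum there. This links the lattice operations of
  \<open>X\<close> with \<open>separated_support\<close>, which refers to the order dual.\<close>

lemma vpos_eq_dual_pos: "x \<in> X \<Longrightarrow> vpos X (dual_le T) x = dual_pos T x"
  unfolding vpos_def
  using dual_pos_supremum[OF in_order_dual, of x] dual_pos_in[of x] in_order_dual
  by (intro vsup_unique) (auto simp: is_supremum_def)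

lemma vabs_eq:
  assumes "x \<in> X"
  shows "vabs X (dual_le T) x = dual_pos T x + dual_pos T (- x)"
  unfolding vabs_def
proof (rule vsup_unique)
  define p n where "p = dual_pos T x" and "n = dual_pos T (- x)"
  have x: "x = p - n"
    using vpos_diff[OF assms] vpos_eq_dual_pos[OF assms] vpos_eq_dual_pos[of "- x"] assms
    by (simp add: p_def n_def)
  have pn: "p \<in> X" "n \<in> X" using assms by (auto intro: dual_pos_in simp: p_def n_def)
  have nn: "dual_le T 0 p" "dual_le T 0 n"
    using dual_pos_supremum[OF in_order_dual[OF assms]] dual_pos_supremum[OF order_dual_neg[OF in_order_dual[OF assms]]]
    by (auto simp: is_supremum_def p_def n_def)
  show "is_supremum X (dual_le T) {x, - x} (dual_pos T x + dual_pos T (- x))"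
    unfolding is_supremum_def p_def[symmetric] n_def[symmetric]
  proof (intro conjI ballI impI)
    show "p + n \<in> X" using pn by simp
    fix a assume "a \<in> {x, - x}"
    then have "a = p - n \<or> a = n - p" using x by auto
    then show "dual_le T a (p + n)"
      using nn by (auto simp: dual_le_def)
  next
    fix t assume t: "t \<in> X" "\<forall>a\<in>{x, - x}. dual_le T a t"
    \<comment> \<open>From \<open>t \<ge> x\<close> and \<open>t \<ge> - x\<close> follow
      \<open>?h \<ge> x\<close> and \<open>?h \<ge> 0\<close>, hence \<open>p \<le> ?h\<close>. With
      \<open>x = p - n\<close> this reads \<open>2 p \<le> t + p - n\<close>, that is,
      \<open>p + n \<le> t\<close>.\<close>
    let ?h = "(1/2::real) *\<^sub>R (t + x)"
    have "?h \<in> order_dual T" using t assms by (intro in_order_dual) simp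
    moreover have "dual_le T x ?h" "dual_le T 0 ?h"
    proof -
      have "x f \<le> t f" "- x f \<le> t f" if "f \<in> Cc T" "0 \<le> f" for f
        using t(2) that by (auto simp: dual_le_def)
      then show "dual_le T x ?h" "dual_le T 0 ?h"
        by (auto simp: dual_le_def scaleR_fun_def field_simps)
          (metis add.commute add.left_inverse add_le_cancel_right)+
    qed
    ultimately have "dual_le T p ?h"
      using dual_pos_supremum[OF in_order_dual[OF assms]] by (auto simp: is_supremum_def p_def)
    then have p: "p f \<le> (t f + x f) / 2" if "f \<in> Cc T" "0 \<le> f" for f
      using that by (simp add: dual_le_def scaleR_fun_def)
    have xf: "x f = p f - n f" for f using x by (metis minus_apply)
    show "dual_le T (p + n) t"
      unfolding dual_le_def
    proof (intro ballI impI)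
      fix f :: "'a \<Rightarrow> real" assume "f \<in> Cc T" "0 \<le> f"
      from p[OF this] show "(p + n) f \<le> t f" using xf[of f] by simp
    qed
  qed
qed

end

section \<open>Small Borel partitions and disjoint translates\<close>

context locally_compact_Hausdorff begin

text \<open>Each point of \<open>K\<close> has a neighbourhood whose closure lies in a good
  \<open>W\<close>; finitely many of these cover \<open>K\<close>, and making them disjoint gives
  Borel pieces. \<open>Q\<close> is demanded for closures because the support of \<chi>-multiples is
  controlled only by the closure of the set.\<close>

lemma small_partition:
  assumes K: "compactin T K"
    and nhd: "\<And>k. k \<in> K \<Longrightarrow> \<exists>W. openin T W \<and> k \<in> W \<and> Q W"
    and anti: "\<And>V W. Q W \<Longrightarrow> V \<subseteq> W \<Longrightarrow> Q V"
  shows "\<exists>A n. (\<forall>i<n. A i \<in> sets (borel_of T) \<and> A i \<subseteq> K \<and> Q (T closure_of A i)) \<and>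
    disjoint_family_on A {..<n} \<and> (\<Union>i<(n::nat). A i) = K"
proof -
  let ?\<V> = "{V. openin T V \<and> Q (T closure_of V)}"
  have "\<exists>V\<in>?\<V>. k \<in> V" if k: "k \<in> K" for k
  proof -
    obtain W where W: "openin T W" "k \<in> W" "Q W" using nhd[OF k] by blast
    have "compactin T {k}" using compactin_subset_topspace[OF K] k by auto
    moreover have "{k} \<subseteq> W" using W by simp
    ultimately obtain r N where r: "r \<in> Cc T" "fsupp T r \<subseteq> W" "openin T N" "{k} \<subseteq> N" "\<And>x. x \<in> N \<Longrightarrow> r x = 1"
      using Urysohn_Cc[OF _ W(1)] by metis
    have "N \<subseteq> fsupp T r"
      using openin_subset[OF r(3)] r(5) by (auto intro!: fsuppD)
    then have "T closure_of N \<subseteq> W"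
      using order_trans[OF closure_of_minimal[OF _ closedin_fsupp] r(2)] by simp
    then show ?thesis using anti[OF W(3)] r(3,4) by blast
  qed
  then have "K \<subseteq> \<Union>?\<V>" by blast
  then obtain \<F> where F: "finite \<F>" "\<F> \<subseteq> ?\<V>" "K \<subseteq> \<Union>\<F>"
    using K unfolding compactin_def by (metis (lifting) mem_Collect_eq)
  obtain n :: nat and V where V: "\<F> = V ` {i. i < n}"
    using finite_imp_nat_seg_image_inj_on[OF F(1)] by blast
  have Vi: "openin T (V i)" "Q (T closure_of V i)" if "i < n" for i
    using F(2) V that by auto
  define A where "A i = K \<inter> disjointed V i" for i
  have sub: "A i \<subseteq> V i" for i
    using disjointed_subset[of V i] by (auto simp: A_def)
  show ?thesis
  proof (intro exI[of _ A] exI[of _ n] conjI allI impI)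
    fix i assume i: "i < n"
    have "K \<in> sets (borel_of T)" by (rule closedin_borel_of[OF compact_closed[OF K]])
    moreover have "V j \<in> sets (borel_of T)" if "j \<le> i" for j
      using Vi(1)[of j] that i openin_borel_of by auto
    then have "disjointed V i \<in> sets (borel_of T)"
      unfolding disjointed_def by (intro sets.Diff sets.finite_UN) auto
    ultimately show "A i \<in> sets (borel_of T)" by (simp add: A_def)
    show "A i \<subseteq> K" by (simp add: A_def)
    show "Q (T closure_of A i)"
      by (rule anti[OF Vi(2)[OF i] closure_of_mono[OF sub]])
  next
    show "disjoint_family_on A {..<n}"
      using disjoint_family_disjointed[of V] by (auto simp: A_def disjoint_family_on_def)
    have "(\<Union>i<n. disjointed V i) = (\<Union>i<n. V i)"
      using finite_UN_disjointed_eq[of V n] by (simp add: atLeast0LessThan)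
    moreover have "K \<subseteq> (\<Union>i<n. V i)" using F(3) V by auto
    ultimately show "(\<Union>i<n. A i) = K" by (auto simp: A_def)
  qed
qed

end

text \<open>Right cancellation keeps the translates by \<open>k\<close> disjoint, so disjoint open
  sets \<open>O1\<close> and \<open>O2\<close> separate them. The rectangle
  \<open>K1 \<times> {k}\<close> is compact and lies in the open preimage of \<open>O1\<close> under
  multiplication; by Wallace's theorem a tube around it does too, and likewise for
  \<open>K2\<close>.\<close>

lemma disjoint_translates_nhd:
  assumes G: "topological_group G TG" and H: "Hausdorff_space TG"
    and K: "compactin TG K1" "compactin TG K2" "K1 \<inter> K2 = {}" and k: "k \<in> carrier G"
  shows "\<exists>W. openin TG W \<and> k \<in> W \<and> (K1 <#>\<^bsub>G\<^esub> W) \<inter> (K2 <#>\<^bsub>G\<^esub> W) = {}"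
proof -
  interpret group G using G by (simp add: topological_group_def)
  have top: "topspace TG = carrier G"
    and mult: "continuous_map (prod_topology TG TG) TG (\<lambda>(a, b). a \<otimes>\<^bsub>G\<^esub> b)"
    using G by (auto simp: topological_group_def)
  have Kc: "K1 \<subseteq> carrier G" "K2 \<subseteq> carrier G"
    using compactin_subset_topspace[OF K(1)] compactin_subset_topspace[OF K(2)] top by auto
  have "continuous_map TG (prod_topology TG TG) (\<lambda>a. (a, k))"
    using k top by (auto simp: continuous_map_pairedI)
  from continuous_map_compose[OF this mult] have tr: "continuous_map TG TG (\<lambda>a. a \<otimes>\<^bsub>G\<^esub> k)"
    by (simp add: o_def)
  let ?t = "\<lambda>a. a \<otimes>\<^bsub>G\<^esub> k"
  have "disjnt (?t ` K1) (?t ` K2)"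
  proof -
    have False if "a \<in> K1" "b \<in> K2" "a \<otimes>\<^bsub>G\<^esub> k = b \<otimes>\<^bsub>G\<^esub> k" for a b
    proof -
      have "a = b" using that Kc k by (intro right_cancel[THEN iffD1, OF _ _ _ that(3)]) auto
      then show False using that K(3) by blast
    qed
    then show ?thesis unfolding disjnt_def by blast
  qed
  from Hausdorff_space_compact_separation[OF H image_compactin[OF K(1) tr] image_compactin[OF K(2) tr] this]
  obtain O1 O2 where O: "openin TG O1" "openin TG O2" "?t ` K1 \<subseteq> O1" "?t ` K2 \<subseteq> O2" "disjnt O1 O2"
    by metis
  have tube: "\<exists>V. openin TG V \<and> k \<in> V \<and> (K' <#>\<^bsub>G\<^esub> V) \<subseteq> O'"
    if K': "compactin TG K'" "?t ` K' \<subseteq> O'" "openin TG O'" for K' O'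
  proof -
    let ?W = "{p \<in> topspace (prod_topology TG TG). (case p of (a, b) \<Rightarrow> a \<otimes>\<^bsub>G\<^esub> b) \<in> O'}"
    have Wo: "openin (prod_topology TG TG) ?W"
      by (rule openin_continuous_map_preimage[OF mult K'(3)])
    have KW: "K' \<times> {k} \<subseteq> ?W"
      using K'(2) compactin_subset_topspace[OF K'(1)] k top by auto
    have ck: "compactin TG {k}" using k top by simp
    obtain U V where UV: "openin TG U" "openin TG V" "K' \<subseteq> U" "{k} \<subseteq> V" "U \<times> V \<subseteq> ?W"
      by (rule Wallace_theorem_prod_topology[OF K'(1) ck Wo KW])
    have "K' <#>\<^bsub>G\<^esub> V \<subseteq> O'"
    proof
      fix z assume "z \<in> K' <#>\<^bsub>G\<^esub> V"
      then obtain a b where ab: "a \<in> K'" "b \<in> V" "z = a \<otimes>\<^bsub>G\<^esub> b" by (auto simp: set_mult_def)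
      then have "(a, b) \<in> ?W" using UV(3,5) by blast
      then show "z \<in> O'" using ab(3) by simp
    qed
    then show ?thesis using UV by blast
  qed
  obtain V1 where V1: "openin TG V1" "k \<in> V1" "(K1 <#>\<^bsub>G\<^esub> V1) \<subseteq> O1"
    using tube[OF K(1) O(3,1)] by blast
  obtain V2 where V2: "openin TG V2" "k \<in> V2" "(K2 <#>\<^bsub>G\<^esub> V2) \<subseteq> O2"
    using tube[OF K(2) O(4,2)] by blast
  have "(K1 <#>\<^bsub>G\<^esub> (V1 \<inter> V2)) \<subseteq> O1" "(K2 <#>\<^bsub>G\<^esub> (V1 \<inter> V2)) \<subseteq> O2"
    using V1(3) V2(3) unfolding set_mult_def by blast+
  then show ?thesis
    using O(5) V1 V2 by (intro exI[of _ "V1 \<inter> V2"]) (auto simp: disjnt_def)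
qed

section \<open>Positive bilinear maps\<close>

locale positive_bilinear =
  X: dual_sublattice X T NX + Y: dual_sublattice Y T NY + Z: dual_sublattice Z T NZ
  for T :: "'a topology" and X NX Y NY Z NZ +
  fixes star :: "(('a \<Rightarrow> real) \<Rightarrow> real) \<Rightarrow> (('a \<Rightarrow> real) \<Rightarrow> real) \<Rightarrow> (('a \<Rightarrow> real) \<Rightarrow> real)"
  assumes bilinear: "x \<in> X \<Longrightarrow> linear_on Y Z (\<lambda>y. star x y)" "y \<in> Y \<Longrightarrow> linear_on X Z (\<lambda>x. star x y)"
    and positive: "x \<in> positive_cone X (dual_le T) \<Longrightarrow> y \<in> positive_cone Y (dual_le T) \<Longrightarrow>
        star x y \<in> positive_cone Z (dual_le T)"
begin

lemma star_in [simp]: "x \<in> X \<Longrightarrow> y \<in> Y \<Longrightarrow> star x y \<in> Z"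
  using bilinear(1)[of x] by (auto simp: linear_on_def)

lemma star_nonneg: "x \<in> X \<Longrightarrow> y \<in> Y \<Longrightarrow> dual_le T 0 x \<Longrightarrow> dual_le T 0 y \<Longrightarrow> dual_le T 0 (star x y)"
  using positive[of x y] by (simp add: positive_cone_def)

lemma star_add_left: "x \<in> X \<Longrightarrow> x' \<in> X \<Longrightarrow> y \<in> Y \<Longrightarrow> star (x + x') y = star x y + star x' y"
  and star_diff_left: "x \<in> X \<Longrightarrow> x' \<in> X \<Longrightarrow> y \<in> Y \<Longrightarrow> star (x - x') y = star x y - star x' y"
  using bilinear(2)[of y] linear_on_diff[OF bilinear(2)[of y] X.sub] by (auto simp: linear_on_def)

lemma star_neg_left: "x \<in> X \<Longrightarrow> y \<in> Y \<Longrightarrow> star (- x) y = - star x y"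
  using star_diff_left[of 0 x y] linear_on_zero[OF bilinear(2)[of y]] by simp

lemma star_scale_left: "x \<in> X \<Longrightarrow> y \<in> Y \<Longrightarrow> star (c *\<^sub>R x) y = c *\<^sub>R star x y"
  using bilinear(2)[of y] by (simp add: linear_on_def)

lemma star_mono_left:
  assumes "x \<in> X" "x' \<in> X" "y \<in> Y" "dual_le T 0 y" "dual_le T x x'"
  shows "dual_le T (star x y) (star x' y)"
  using star_nonneg[of "x' - x" y] assms dual_le_diff[of T x x'] dual_le_diff[of T "star x y" "star x' y"]
  by (simp add: star_diff_left)

lemma positive_operator_star_right:
  "x \<in> X \<Longrightarrow> dual_le T 0 x \<Longrightarrow> positive_operator Y (dual_le T) Z (dual_le T) (\<lambda>y. star x y)"
  using bilinear(1) star_nonneg by (auto simp: positive_operator_def positive_cone_def)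

lemma positive_operator_star_left:
  "y \<in> Y \<Longrightarrow> dual_le T 0 y \<Longrightarrow> positive_operator X (dual_le T) Z (dual_le T) (\<lambda>x. star x y)"
  using bilinear(2) star_nonneg by (auto simp: positive_operator_def positive_cone_def)

lemma positive_operator_bounded:
  "positive_operator Y (dual_le T) Z (dual_le T) P \<Longrightarrow> \<exists>C\<ge>0. \<forall>u\<in>Y. NZ (P u) \<le> C * NY u"
  "positive_operator X (dual_le T) Z (dual_le T) Q \<Longrightarrow> \<exists>C\<ge>0. \<forall>u\<in>X. NZ (Q u) \<le> C * NX u"
  using positive_operator_on.bounded[of Y "dual_le T" NY Z "dual_le T" NZ P]
    positive_operator_on.bounded[of X "dual_le T" NX Z "dual_le T" NZ Q]
    X.Banach_lattice_on_axioms Y.Banach_lattice_on_axioms Z.Banach_lattice_on_axioms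
  by (auto simp: positive_operator_on_def positive_operator_on_axioms_def)

text \<open>Continuity is available for positive operators, so the regular operator is presented as
  \<open>P - Q\<close>. For \<open>d\<close> close to \<open>y\<close> the correction
  \<open>?w\<close>, the value of \<open>P - Q\<close> at \<open>d - y\<close>, is small and turns
  the value at \<open>y\<close> into the non-negative value at \<open>d\<close>.\<close>

lemma difference_nonneg_of_dense:
  assumes P: "positive_operator Y (dual_le T) Z (dual_le T) P" "positive_operator Y (dual_le T) Z (dual_le T) Q"
    and dense: "norm_dense_in NY D (positive_cone Y (dual_le T))"
    and D: "\<And>y. y \<in> D \<Longrightarrow> dual_le T (Q y) (P y)"
    and y: "y \<in> Y" "dual_le T 0 y"
  shows "dual_le T (Q y) (P y)"
proof -
  have lin: "linear_on Y Z P" "linear_on Y Z Q" using P by (auto simp: positive_operator_def)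
  have in_Z: "P u \<in> Z" "Q u \<in> Z" if "u \<in> Y" for u using lin that by (auto simp: linear_on_def)
  obtain C where C: "0 \<le> C" "\<And>u. u \<in> Y \<Longrightarrow> NZ (P u) \<le> C * NY u"
    using positive_operator_bounded(1)[OF P(1)] by blast
  obtain C' where C': "0 \<le> C'" "\<And>u. u \<in> Y \<Longrightarrow> NZ (Q u) \<le> C' * NY u"
    using positive_operator_bounded(1)[OF P(2)] by blast
  have "dual_le T 0 (P y - Q y)"
  proof (rule Z.nonneg_closed)
    fix e :: real assume e: "0 < e"
    \<comment> \<open>The summand 1 keeps the denominator positive and the final estimate
      strict.\<close>
    define \<delta> where "\<delta> = e / (C + C' + 1)"
    have \<delta>: "0 < \<delta>" "(C + C') * \<delta> < e" using C(1) C'(1) e by (auto simp: \<delta>_def field_simps)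
    obtain d where d: "d \<in> D" "NY (y - d) < \<delta>"
      using dense y \<delta>(1) unfolding norm_dense_in_def positive_cone_def by blast
    have dY: "d \<in> Y" using dense d(1) by (auto simp: norm_dense_in_def positive_cone_def)
    have yd: "d - y \<in> Y" "y - d \<in> Y" using dY y by auto
    let ?w = "P (d - y) - Q (d - y)"
    have "NZ ?w \<le> NZ (P (d - y)) + NZ (Q (d - y))"
      using in_Z yd by (intro Z.norm_diff) auto
    also have "\<dots> \<le> (C + C') * NY (d - y)"
      using C(2)[OF yd(1)] C'(2)[OF yd(1)] by (simp add: distrib_right)
    also have "\<dots> = (C + C') * NY (y - d)"
      using Y.norm_neg[OF yd(2)] by simp
    also have "\<dots> \<le> (C + C') * \<delta>"
      using C(1) C'(1) d(2) by (intro mult_left_mono) auto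
    finally have "NZ ?w < e" using \<delta>(2) by simp
    moreover have "P y - Q y + ?w = P d - Q d"
      using linear_on_diff[OF lin(1) Y.sub dY y(1)] linear_on_diff[OF lin(2) Y.sub dY y(1)] by simp
    moreover have "dual_le T 0 (P d - Q d)" using D[OF d(1)] dual_le_diff by blast
    ultimately show "\<exists>w\<in>Z. NZ w < e \<and> dual_le T 0 (P y - Q y + w)"
      using in_Z yd by (intro bexI[of _ ?w]) auto
  qed (use in_Z y in auto)
  then show ?thesis using dual_le_diff by blast
qed

end

text \<open>The group enters through the set product \<open>mul\<close>, recorded by its
  monotonicity, by the separation of disjoint compact sets near every point, and by the support
  condition.\<close>

locale disintegrating_bilinear = positive_bilinear T X NX Y NY Z NZ star
    + locally_compact_Hausdorff T
  for T :: "'a topology" and X NX Y NY Z NZ star +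
  fixes mul :: "'a set \<Rightarrow> 'a set \<Rightarrow> 'a set"
  assumes nonempty: "topspace T \<noteq> {}"
    and mul_mono: "B \<subseteq> C \<Longrightarrow> mul A B \<subseteq> mul A C"
    and separating: "compactin T K1 \<Longrightarrow> compactin T K2 \<Longrightarrow> K1 \<inter> K2 = {} \<Longrightarrow> k \<in> topspace T \<Longrightarrow>
      \<exists>W. openin T W \<and> k \<in> W \<and> mul K1 W \<inter> mul K2 W = {}"
    and supp: "\<And>x y. x \<in> positive_cone X (dual_le T) \<Longrightarrow> y \<in> positive_cone Y (dual_le T) \<Longrightarrow>
        compactin T (dsupp T x) \<Longrightarrow> compactin T (dsupp T y) \<Longrightarrow>
        dsupp T (star x y) \<subseteq> mul (dsupp T x) (dsupp T y)"
    and denseX: "norm_dense_in NX {x \<in> X. compactin T (dsupp T x) \<and> separated_support T x} X"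
    and denseY: "norm_dense_in NY {y \<in> positive_cone Y (dual_le T). compactin T (dsupp T y)}
        (positive_cone Y (dual_le T))"
    and chi: "\<And>y A. y \<in> positive_cone Y (dual_le T) \<Longrightarrow> compactin T (dsupp T y) \<Longrightarrow>
        A \<in> sets (borel_of T) \<Longrightarrow> A \<subseteq> dsupp T y \<Longrightarrow> borel_multiple T (indicator A) y \<in> Y"
begin

text \<open>\<open>R\<close> is any linear map with the two dominations on the cone, since the
  result is later applied to a given regular operator corrected by \<open>\<pi>\<close> of a small
  element.\<close>

lemma abs_star_le_of_compact_support:
  assumes R: "linear_on Y Z R" "\<And>y. y \<in> Y \<Longrightarrow> dual_le T 0 y \<Longrightarrow> dual_le T (star x y) (R y)"
      "\<And>y. y \<in> Y \<Longrightarrow> dual_le T 0 y \<Longrightarrow> dual_le T (- star x y) (R y)"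
    and x: "x \<in> X" "compactin T (dsupp T x)" "separated_support T x"
    and y: "y \<in> Y" "dual_le T 0 y" "compactin T (dsupp T y)"
  shows "dual_le T (star (vabs X (dual_le T) x) y) (R y)"
proof -
  define p n where "p = dual_pos T x" and "n = dual_pos T (- x)"
  have xd: "x \<in> order_dual T" "- x \<in> order_dual T"
    using x(1) by (auto intro: X.in_order_dual)
  have pn: "p \<in> X" "n \<in> X" using x(1) by (auto simp: p_def n_def intro!: X.dual_pos_in)
  have x_eq: "x = p - n"
    using X.vpos_diff[OF x(1)] X.vpos_eq_dual_pos[OF x(1)] X.vpos_eq_dual_pos[of "- x"] x(1)
    by (simp add: p_def n_def)
  have nn: "dual_le T 0 p" "dual_le T 0 n"
    using dual_pos_supremum[OF xd(1)] dual_pos_supremum[OF xd(2)]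
    by (auto simp: is_supremum_def p_def n_def)
  have "dsupp T p \<subseteq> dsupp T x" "dsupp T n \<subseteq> dsupp T x"
    using dsupp_dual_pos[OF xd(1)] dsupp_dual_pos[OF xd(2)] by (simp_all add: p_def n_def dsupp_neg)
  then have cpt: "compactin T (dsupp T p)" "compactin T (dsupp T n)"
    using closed_compactin[OF x(2) _ closedin_dsupp] by auto
  have disj: "dsupp T p \<inter> dsupp T n = {}"
    using x(3) by (simp add: separated_support_def vpos_order_dual[OF xd(1)] vneg_order_dual[OF xd(1)] p_def n_def)
  let ?Q = "\<lambda>W. mul (dsupp T p) W \<inter> mul (dsupp T n) W = {}"
  have "\<exists>A m. (\<forall>i<m. A i \<in> sets (borel_of T) \<and> A i \<subseteq> dsupp T y \<and> ?Q (T closure_of A i)) \<and>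
    disjoint_family_on A {..<m} \<and> (\<Union>i<(m::nat). A i) = dsupp T y"
  proof (rule small_partition[OF y(3)])
    show "\<exists>W. openin T W \<and> k \<in> W \<and> ?Q W" if "k \<in> dsupp T y" for k
      using separating[OF cpt disj] that compactin_subset_topspace[OF y(3)] by blast
    show "?Q V" if "?Q W" "V \<subseteq> W" for V W
      using that mul_mono[OF that(2)] by blast
  qed
  then obtain A m where Am: "\<forall>i<m. A i \<in> sets (borel_of T) \<and> A i \<subseteq> dsupp T y \<and> ?Q (T closure_of A i)"
    and part: "disjoint_family_on A {..<m}" "(\<Union>i<(m::nat). A i) = dsupp T y"
    by (elim exE conjE) (rule that)
  have A: "A i \<in> sets (borel_of T)" "A i \<subseteq> dsupp T y" "?Q (T closure_of A i)" if "i < m" for i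
    using Am that by simp_all
  define z where "z i = borel_multiple T (indicator (A i)) y" for i
  have yc: "y \<in> positive_cone Y (dual_le T)" "y \<in> order_dual T"
    using y by (auto simp: positive_cone_def intro: Y.in_order_dual)
  have zY: "z i \<in> Y" if "i < m" for i
    unfolding z_def using chi[OF yc(1) y(3) A(1,2)] that by blast
  have z0: "dual_le T 0 (z i)" if "i < m" for i
    unfolding z_def by (rule borel_multiple_nonneg[OF yc(2) y(2) nonempty A(1)[OF that]])
  have zsupp: "dsupp T (z i) \<subseteq> T closure_of A i" for i
    unfolding z_def by (rule dsupp_borel_multiple)
  have zcpt: "compactin T (dsupp T (z i))" if "i < m" for i
  proof -
    have "T closure_of A i \<subseteq> dsupp T y"
      by (rule closure_of_minimal[OF A(2)[OF that] closedin_dsupp])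
    then show ?thesis
      using closed_compactin[OF y(3) _ closedin_dsupp] zsupp[of i] by blast
  qed
  have y_eq: "y = (\<Sum>i<m. z i)"
    unfolding z_def
    by (rule borel_multiple_partition[OF yc(2) y(2) nonempty A(1) part(1)])
      (use part(2) zY in \<open>auto simp: z_def intro: Y.in_order_dual\<close>)
  have "dual_le T (star p (z i) + star n (z i)) (R (z i))" if i: "i < m" for i
  proof -
    have s: "dsupp T (star q (z i)) \<subseteq> mul (dsupp T q) (T closure_of A i)"
      if "q \<in> X" "dual_le T 0 q" "compactin T (dsupp T q)" for q
    proof -
      have "dsupp T (star q (z i)) \<subseteq> mul (dsupp T q) (dsupp T (z i))"
        using that zY[OF i] z0[OF i] zcpt[OF i] by (intro supp) (auto simp: positive_cone_def)
      then show ?thesis using mul_mono[OF zsupp[of i], of "dsupp T q"] by blast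
    qed
    have "star x (z i) = star p (z i) - star n (z i)"
      unfolding x_eq by (rule star_diff_left[OF pn zY[OF i]])
    then have "dual_le T (star p (z i) - star n (z i)) (R (z i))" "dual_le T (star n (z i) - star p (z i)) (R (z i))"
      using R(2,3)[OF zY[OF i] z0[OF i]] by auto
    moreover have "R (z i) \<in> Z" using R(1) zY[OF i] by (auto simp: linear_on_def)
    moreover have "dsupp T (star p (z i)) \<inter> dsupp T (star n (z i)) = {}"
      using s[OF pn(1) nn(1) cpt(1)] s[OF pn(2) nn(2) cpt(2)] A(3)[OF i] by blast
    ultimately show ?thesis
      using pn zY[OF i] by (intro disjoint_supports_sum_le Z.in_order_dual star_in)
  qed
  then have "dual_le T (\<Sum>i<m. star p (z i) + star n (z i)) (\<Sum>i<m. R (z i))"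
    by (intro dual_le_sum) auto
  moreover have "(\<Sum>i<m. R (z i)) = R y"
    unfolding y_eq by (rule linear_on_sum[OF R(1) Y.sub, symmetric]) (use zY in auto)
  moreover have "(\<Sum>i<m. star q (z i)) = star q y" if "q \<in> X" for q
    unfolding y_eq by (rule linear_on_sum[OF bilinear(1)[OF that] Y.sub, symmetric]) (use zY in auto)
  moreover have "vabs X (dual_le T) x = p + n"
    unfolding p_def n_def by (rule X.vabs_eq[OF x(1)])
  ultimately show ?thesis
    using pn y(1) by (simp add: sum.distrib star_add_left)
qed

lemma abs_star_le:
  assumes R: "positive_operator Y (dual_le T) Z (dual_le T) P" "positive_operator Y (dual_le T) Z (dual_le T) Q"
      "\<And>y. y \<in> Y \<Longrightarrow> dual_le T 0 y \<Longrightarrow> dual_le T (star x y) (P y - Q y)"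
      "\<And>y. y \<in> Y \<Longrightarrow> dual_le T 0 y \<Longrightarrow> dual_le T (- star x y) (P y - Q y)"
    and x: "x \<in> X" and y: "y \<in> Y" "dual_le T 0 y"
  shows "dual_le T (star (vabs X (dual_le T) x) y) (P y - Q y)"
proof -
  let ?abs = "vabs X (dual_le T)"
  have lin: "linear_on Y Z P" "linear_on Y Z Q" using R by (auto simp: positive_operator_def)
  have in_Z: "P u \<in> Z" "Q u \<in> Z" if "u \<in> Y" for u using lin that by (auto simp: linear_on_def)
  have approx: "dual_le T (star (?abs x') y) (P y - Q y + star (?abs (x - x')) y)"
    if x': "x' \<in> X" "compactin T (dsupp T x')" "separated_support T x'" for x'
  proof -
    let ?d = "?abs (x - x')"
    have d: "?d \<in> X" "dual_le T 0 ?d" using x x'(1) by (auto intro: X.vabs_nonneg)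
    have dd: "dual_le T 0 (?d - (x - x'))" "dual_le T 0 (?d + (x - x'))"
      using dual_le_diff[THEN iffD1, OF X.vabs_ge[OF X.E_diff[OF x x'(1)]]]
        dual_le_diff[THEN iffD1, OF X.vabs_ge'[OF X.E_diff[OF x x'(1)]]]
      by (simp_all only: diff_minus_eq_add)
    have a: "?abs x' \<in> X" "dual_le T 0 (?abs x')" using x'(1) by (auto intro: X.vabs_nonneg)
    \<comment> \<open>Moving the negative terms across rewrites the claim as
      \<open>?Q \<le> ?P\<close> between two positive operators, the form that
      \<open>difference_nonneg_of_dense\<close> treats.\<close>
    let ?P = "\<lambda>u. P u + star ?d u" and ?Q = "\<lambda>u. Q u + star (?abs x') u"
    have posadd: "positive_operator Y (dual_le T) Z (dual_le T) (\<lambda>u. F u + star q u)"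
      if "positive_operator Y (dual_le T) Z (dual_le T) F" "q \<in> X" "dual_le T 0 q" for F q
      using that(1) positive_operator_star_right[OF that(2,3)]
      by (auto simp: positive_operator_def linear_on_def positive_cone_def scaleR_add_right Z.add_nonneg Pi_iff)
    have "dual_le T (?Q y) (?P y)"
    proof (rule difference_nonneg_of_dense[OF posadd[OF R(1) d] posadd[OF R(2) a] denseY _ y])
      fix u assume "u \<in> {y \<in> positive_cone Y (dual_le T). compactin T (dsupp T y)}"
      then have u: "u \<in> Y" "dual_le T 0 u" "compactin T (dsupp T u)" by (auto simp: positive_cone_def)
      let ?R = "\<lambda>v. P v - Q v + star ?d v"
      have "dual_le T (star (?abs x') u) (?R u)"
      proof (rule abs_star_le_of_compact_support[OF _ _ _ x' u])
        show "linear_on Y Z ?R"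
          using lin bilinear(1)[OF d(1)]
          by (auto simp: linear_on_def Pi_iff algebra_simps)
        fix v assume v: "v \<in> Y" "dual_le T 0 v"
        have e: "star (x - x') v = star x v - star x' v"
          by (rule star_diff_left[OF x x'(1) v(1)])
        have e1: "star (?d - (x - x')) v = star ?d v - (star x v - star x' v)"
          unfolding e[symmetric] by (rule star_diff_left[OF d(1) _ v(1)]) (use x x' in simp)
        have e2: "star (?d + (x - x')) v = star ?d v + (star x v - star x' v)"
          unfolding e[symmetric] by (rule star_add_left[OF d(1) _ v(1)]) (use x x' in simp)
        \<comment> \<open>This encodes \<open>x' \<le> x + ?d\<close>, combined with the bound for
          \<open>star x v\<close>; the second half below does the same with
          \<open>- x' \<le> - x + ?d\<close>.\<close>
        have "dual_le T (star x v + 0) (P v - Q v + star (?d + (x - x')) v)"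
          using d(1) x x'(1) dd v by (intro dual_le_add R(3) star_nonneg) auto
        then show "dual_le T (star x' v) (?R v)"
          unfolding e2 by (simp add: dual_le_diff[of T "star x' v"] dual_le_diff[of T "star x v"] algebra_simps)
        have "dual_le T (- star x v + 0) (P v - Q v + star (?d - (x - x')) v)"
          using d(1) x x'(1) dd v by (intro dual_le_add R(4) star_nonneg) auto
        then show "dual_le T (- star x' v) (?R v)"
          unfolding e1 by (simp add: dual_le_diff[of T "- star x' v"] dual_le_diff[of T "- star x v"] algebra_simps)
      qed
      then show "dual_le T (?Q u) (?P u)"
        by (simp add: dual_le_diff[of T "star (?abs x') u"] dual_le_diff[of T "?Q u"] algebra_simps)
    qed
    then show ?thesis
      by (simp add: dual_le_diff[of T "star (?abs x') y"] dual_le_diff[of T "?Q y"] algebra_simps)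
  qed
  obtain C where C: "0 \<le> C" "\<And>u. u \<in> X \<Longrightarrow> NZ (star u y) \<le> C * NX u"
    using positive_operator_bounded(2)[OF positive_operator_star_left[OF y]] by blast
  have "dual_le T 0 (P y - Q y - star (?abs x) y)"
  proof (rule Z.nonneg_closed)
    fix e :: real assume e: "0 < e"
    \<comment> \<open>The factor 2 stems from the error term \<open>?w\<close>: one copy of
      \<open>star ?d y\<close> comes from \<open>approx\<close>, the other from
      \<open>\<bar>x\<bar> \<le> \<bar>x'\<bar> + ?d\<close>.\<close>
    define \<delta> where "\<delta> = e / (2 * C + 1)"
    have \<delta>: "0 < \<delta>" "2 * (C * \<delta>) < e" using C(1) e by (auto simp: \<delta>_def field_simps)
    obtain x' where x': "x' \<in> X" "compactin T (dsupp T x')" "separated_support T x'" "NX (x - x') < \<delta>"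
      using denseX x \<delta>(1) unfolding norm_dense_in_def by blast
    let ?d = "?abs (x - x')"
    have d: "?d \<in> X" "?abs x' \<in> X" "?abs x \<in> X" using x x' by auto
    let ?w = "2 *\<^sub>R star ?d y"
    have "NZ (star ?d y) \<le> C * NX ?d" by (rule C(2)[OF d(1)])
    also have "\<dots> \<le> C * \<delta>"
      using C(1) X.norm_vabs_le[of "x - x'"] x x' by (intro mult_left_mono) auto
    finally have "NZ ?w < e"
      using \<delta>(2) d(1) y(1) by (simp add: Z.norm_scale)
    moreover have "dual_le T 0 (P y - Q y - star (?abs x) y + ?w)"
    proof -
      have "dual_le T x (?abs x' + ?d)"
        using dual_le_add[OF X.vabs_ge[OF x'(1)] X.vabs_ge[of "x - x'"]] x x' by simp
      moreover have "dual_le T (- x) (?abs x' + ?d)"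
        using dual_le_add[OF X.vabs_ge'[OF x'(1)] X.vabs_ge'[of "x - x'"]] x x' by simp
      ultimately have "dual_le T (?abs x) (?abs x' + ?d)"
        using d x by (intro X.vabs_least) auto
      then have "dual_le T (star (?abs x) y) (star (?abs x' + ?d) y)"
        using d y by (intro star_mono_left) auto
      moreover have "star (?abs x' + ?d) y = star (?abs x') y + star ?d y"
        using d y by (intro star_add_left) auto
      moreover have "dual_le T (star (?abs x') y + star ?d y) (P y - Q y + star ?d y + star ?d y)"
        by (rule dual_le_add[OF approx[OF x'(1-3)] dual_le_refl])
      ultimately have "dual_le T (star (?abs x) y) (P y - Q y + star ?d y + star ?d y)"
        using dual_le_trans by metis
      then show ?thesis
        by (simp add: dual_le_diff[of T "star (?abs x) y"] scaleR_2 algebra_simps)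
    qed
    ultimately show "\<exists>w\<in>Z. NZ w < e \<and> dual_le T 0 (P y - Q y - star (?abs x) y + w)"
      using d y by (intro bexI[of _ ?w]) auto
  qed (use in_Z y x in auto)
  then show ?thesis using dual_le_diff by blast
qed

end

section \<open>\<pi> as a map into the regular operators\<close>

context positive_bilinear begin

abbreviation "regular \<equiv> regular_operators Y (dual_le T) Z (dual_le T)"
abbreviation "regular_le \<equiv> operator_le Y (dual_le T) (dual_le T)"

definition star_operator where
  "star_operator x = (\<lambda>y. if y \<in> Y then star x y else 0)"

lemma regular_linear:
  assumes "R \<in> regular"
  shows "linear_on Y Z R"
proof -
  obtain P Q where "linear_on Y Z P" "linear_on Y Z Q" "\<forall>y\<in>Y. R y = P y - Q y"
    using assms by (auto simp: regular_operators_def positive_operator_def)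
  then show ?thesis
    by (auto simp: linear_on_def Pi_iff scaleR_diff_right)
qed

text \<open>Operators that agree on the cone agree on \<open>Y\<close> by \<open>vpos_diff\<close>,
  and outside \<open>Y\<close> both are 0. This gives the uniqueness of suprema on which the
  description in \<open>vsup\<close> relies.\<close>

lemma regular_antisym:
  assumes R: "R \<in> regular" "R' \<in> regular" and le: "regular_le R R'" "regular_le R' R"
  shows "R = R'"
proof
  fix y
  note lin = regular_linear[OF R(1)] regular_linear[OF R(2)]
  have cone: "R u = R' u" if "u \<in> Y" "dual_le T 0 u" for u
  proof (rule Z.le_antisym)
    show "dual_le T (R u) (R' u)" "dual_le T (R' u) (R u)"
      using le that by (auto simp: operator_le_def positive_cone_def)
    show "R u \<in> Z" "R' u \<in> Z" using lin that by (auto simp: linear_on_def)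
  qed
  show "R y = R' y"
  proof (cases "y \<in> Y")
    case True
    let ?p = "vpos Y (dual_le T) y" and ?n = "vpos Y (dual_le T) (- y)"
    have pn: "?p \<in> Y" "?n \<in> Y" "dual_le T 0 ?p" "dual_le T 0 ?n"
      using True by (auto intro: Y.vpos_nonneg)
    have "R (?p - ?n) = R' (?p - ?n)"
      using linear_on_diff[OF lin(1) Y.sub pn(1,2)] linear_on_diff[OF lin(2) Y.sub pn(1,2)] cone pn by simp
    then show ?thesis using Y.vpos_diff[OF True] by simp
  next
    case False
    then show ?thesis using R by (simp add: regular_operators_def)
  qed
qed

lemma star_operator_regular:
  assumes "x \<in> X"
  shows "star_operator x \<in> regular"
proof -
  let ?p = "vpos X (dual_le T) x" and ?n = "vpos X (dual_le T) (- x)"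
  have pn: "?p \<in> X" "?n \<in> X" "dual_le T 0 ?p" "dual_le T 0 ?n"
    using assms by (auto intro: X.vpos_nonneg)
  have "star_operator x y = star ?p y - star ?n y" if "y \<in> Y" for y
    using star_diff_left[OF pn(1,2) that] X.vpos_diff[OF assms] that by (simp add: star_operator_def)
  then show ?thesis
    unfolding regular_operators_def
    using positive_operator_star_right[OF pn(1,3)] positive_operator_star_right[OF pn(2,4)]
    by (auto simp: star_operator_def)
qed

lemma linear_star_operator: "linear_on X regular star_operator"
  unfolding linear_on_def
proof (intro conjI ballI allI funcsetI)
  show "star_operator x \<in> regular" if "x \<in> X" for x by (rule star_operator_regular[OF that])
  show "star_operator (x + x') = star_operator x + star_operator x'" if "x \<in> X" "x' \<in> X" for x x'
    using that by (auto simp: star_operator_def star_add_left)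
  show "star_operator (c *\<^sub>R x) = c *\<^sub>R star_operator x" if x: "x \<in> X" for c x
  proof
    show "star_operator (c *\<^sub>R x) y = (c *\<^sub>R star_operator x) y" for y
      unfolding scaleR_fun_def[of c "star_operator x"]
      by (simp add: star_operator_def star_scale_left[OF x])
  qed
qed

end

context disintegrating_bilinear begin

text \<open>The modulus of \<open>\<pi>\<^sub>x\<close> is identified by its universal property:
  monotonicity in the left factor makes \<pi> at the modulus of \<open>x\<close> an upper bound of
  \<open>\<plusminus> \<pi>\<^sub>x\<close>, and \<open>abs_star_le\<close> puts it below every
  other regular upper bound.\<close>

lemma lattice_homomorphism_star_operator:
  "lattice_homomorphism X (dual_le T) regular regular_le star_operator"
  unfolding lattice_homomorphism_def
proof (intro conjI ballI linear_star_operator)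
  fix x assume x: "x \<in> X"
  let ?abs = "vabs X (dual_le T)"
  have a: "?abs x \<in> X" "dual_le T 0 (?abs x)" using x by (auto intro: X.vabs_nonneg)
  have "is_supremum regular regular_le {star_operator x, - star_operator x} (star_operator (?abs x))"
    unfolding is_supremum_def
  proof (intro conjI ballI impI)
    show "star_operator (?abs x) \<in> regular" by (rule star_operator_regular[OF a(1)])
    fix F assume F: "F \<in> {star_operator x, - star_operator x}"
    show "regular_le F (star_operator (?abs x))"
      unfolding operator_le_def
    proof
      fix y assume "y \<in> positive_cone Y (dual_le T)"
      then have y: "y \<in> Y" "dual_le T 0 y" by (auto simp: positive_cone_def)
      have "dual_le T (star x y) (star (?abs x) y)"
        by (rule star_mono_left[OF x a(1) y X.vabs_ge[OF x]])
      moreover have "dual_le T (star (- x) y) (star (?abs x) y)"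
        by (rule star_mono_left[OF _ a(1) y X.vabs_ge'[OF x]]) (use x in simp)
      ultimately show "dual_le T (F y) (star_operator (?abs x) y)"
        using F y star_neg_left[OF x y(1)] by (auto simp: star_operator_def)
    qed
  next
    fix R assume R: "R \<in> regular" "\<forall>F\<in>{star_operator x, - star_operator x}. regular_le F R"
    obtain P Q where PQ: "positive_operator Y (dual_le T) Z (dual_le T) P"
      "positive_operator Y (dual_le T) Z (dual_le T) Q" "\<And>y. y \<in> Y \<Longrightarrow> R y = P y - Q y"
      using R(1) by (auto simp: regular_operators_def)
    have ge: "dual_le T (star x y) (P y - Q y)" "dual_le T (- star x y) (P y - Q y)"
      if "y \<in> Y" "dual_le T 0 y" for y
      using R(2) that by (auto simp: operator_le_def positive_cone_def star_operator_def PQ(3))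
    show "regular_le (star_operator (?abs x)) R"
      unfolding operator_le_def
    proof
      fix y assume "y \<in> positive_cone Y (dual_le T)"
      then have y: "y \<in> Y" "dual_le T 0 y" by (auto simp: positive_cone_def)
      show "dual_le T (star_operator (?abs x) y) (R y)"
        using abs_star_le[OF PQ(1,2) ge x y] y PQ(3) by (simp add: star_operator_def)
    qed
  qed
  then show "vabs regular regular_le (star_operator x) = star_operator (?abs x)"
    unfolding vabs_def by (rule vsup_eqI) (rule regular_antisym)
qed

end

theorem theorem10p3:
  fixes G :: "('g, 'm) monoid_scheme"
    and TG T :: "'g topology"
    and S :: "'g set"
    and X Y Z :: "(('g \<Rightarrow> real) \<Rightarrow> real) set"
    and NX NY NZ :: "(('g \<Rightarrow> real) \<Rightarrow> real) \<Rightarrow> real"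
    and star :: "(('g \<Rightarrow> real) \<Rightarrow> real) \<Rightarrow> (('g \<Rightarrow> real) \<Rightarrow> real) \<Rightarrow> (('g \<Rightarrow> real) \<Rightarrow> real)"
  defines "T \<equiv> subtopology TG S"
  assumes G: "locally_compact_group G TG"
    and S: "S \<noteq> {}" "closedin TG S" "\<And>a b. a \<in> S \<Longrightarrow> b \<in> S \<Longrightarrow> a \<otimes>\<^bsub>G\<^esub> b \<in> S"
    and sublattices: "vector_sublattice (order_dual T) (dual_le T) X"
      "vector_sublattice (order_dual T) (dual_le T) Y"
      "vector_sublattice (order_dual T) (dual_le T) Z"
    and Banach: "Banach_lattice X (dual_le T) NX"
      "Banach_lattice Y (dual_le T) NY"
      "Banach_lattice Z (dual_le T) NZ"
    and Dedekind: "Dedekind_complete Z (dual_le T)"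
    and bilinear: "\<And>x. x \<in> X \<Longrightarrow> linear_on Y Z (\<lambda>y. star x y)"
      "\<And>y. y \<in> Y \<Longrightarrow> linear_on X Z (\<lambda>x. star x y)"
    and positive: "\<And>x y. x \<in> positive_cone X (dual_le T) \<Longrightarrow> y \<in> positive_cone Y (dual_le T) \<Longrightarrow>
        star x y \<in> positive_cone Z (dual_le T)"
    and supp: "\<And>x y. x \<in> positive_cone X (dual_le T) \<Longrightarrow> y \<in> positive_cone Y (dual_le T) \<Longrightarrow>
        compactin T (dsupp T x) \<Longrightarrow> compactin T (dsupp T y) \<Longrightarrow>
        dsupp T (star x y) \<subseteq> dsupp T x <#>\<^bsub>G\<^esub> dsupp T y"
    and denseX: "norm_dense_in NX {x \<in> X. compactin T (dsupp T x) \<and> separated_support T x} X"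
    and denseY: "norm_dense_in NY {y \<in> positive_cone Y (dual_le T). compactin T (dsupp T y)}
        (positive_cone Y (dual_le T))"
    and chi: "\<And>y A. y \<in> positive_cone Y (dual_le T) \<Longrightarrow> compactin T (dsupp T y) \<Longrightarrow>
        A \<in> sets (borel_of T) \<Longrightarrow> A \<subseteq> dsupp T y \<Longrightarrow> borel_multiple T (indicator A) y \<in> Y"
  shows "lattice_homomorphism X (dual_le T)
           (regular_operators Y (dual_le T) Z (dual_le T)) (operator_le Y (dual_le T) (dual_le T))
           (\<lambda>x y. if y \<in> Y then star x y else 0)"
proof -
  have TG: "topological_group G TG" "Hausdorff_space TG" "locally_compact_space TG"
    using G by (auto simp: locally_compact_group_def)
  have top: "topspace TG = carrier G" using TG(1) by (simp add: topological_group_def)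
  have ST: "topspace T = S"
    using closedin_subset[OF S(2)] by (auto simp: T_def)
  interpret disintegrating_bilinear T X NX Y NY Z NZ star "\<lambda>A B. A <#>\<^bsub>G\<^esub> B"
  proof unfold_locales
    show "Hausdorff_space T" "locally_compact_space T"
      unfolding T_def using TG S(2)
      by (auto intro: Hausdorff_space_subtopology locally_compact_space_closed_subset)
    show "topspace T \<noteq> {}" using ST S(1) by simp
    show mono: "A <#>\<^bsub>G\<^esub> B \<subseteq> A <#>\<^bsub>G\<^esub> C" if "B \<subseteq> C" for A B C
      using that unfolding set_mult_def by blast
    show "\<exists>W. openin T W \<and> k \<in> W \<and> (K1 <#>\<^bsub>G\<^esub> W) \<inter> (K2 <#>\<^bsub>G\<^esub> W) = {}"
      if K: "compactin T K1" "compactin T K2" "K1 \<inter> K2 = {}" "k \<in> topspace T" for K1 K2 k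
    proof -
      have kG: "k \<in> carrier G" "k \<in> S" using K(4) ST closedin_subset[OF S(2)] top by auto
      \<comment> \<open>Cancellation holds in the group, so \<open>W\<close> is found there and then
        cut down to \<open>S\<close>; shrinking \<open>W\<close> keeps the products
        disjoint.\<close>
      obtain W where W: "openin TG W" "k \<in> W" "(K1 <#>\<^bsub>G\<^esub> W) \<inter> (K2 <#>\<^bsub>G\<^esub> W) = {}"
        using disjoint_translates_nhd[OF TG(1,2) _ _ K(3) kG(1)] K(1,2)
        by (auto simp: T_def compactin_subtopology)
      have "openin T (S \<inter> W)" unfolding T_def by (rule openin_subtopology_Int2[OF W(1)])
      moreover have "(K1 <#>\<^bsub>G\<^esub> (S \<inter> W)) \<inter> (K2 <#>\<^bsub>G\<^esub> (S \<inter> W)) = {}"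
        using W(3) mono[of "S \<inter> W" W K1] mono[of "S \<inter> W" W K2] by blast
      ultimately show ?thesis using W(2) kG(2) by blast
    qed
  qed (fact sublattices Banach bilinear positive supp denseX denseY chi)+
  show ?thesis
    using lattice_homomorphism_star_operator unfolding star_operator_def .
qed

end
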